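(* Let $\mathbf{u}$ be a global-in-time Leray--Hopf weak solution of the Navier--Stokes equations on $\Omega$ with viscosity $\nu>0$, initial datum $\mathbf{u}(0)\in H$ and time-independent force $\mathbf{f}\in L^2(\Omega)^3$ with $\mathbf{P}_m\mathbf{f}=\mathbf{f}$. Let $\mathbf{y}=\mathbf{P}_m\mathbf{u}$ and $\mathbf{z}=(\mathbf{I}-\mathbf{P}_m)\mathbf{u}$ be the splitting of $\mathbf{u}$ determined by the first $m$ elements of the $L^2$-orthonormal (POD) basis $\{\mathbf{w}_k\}_{k\in\mathbb{N}}$. Then there exist a sequence $\{t_n\}$ with $t_n\to+\infty$ and a field $\overline{\mathbf{z}}\in H$ such that $$M_{t_n}(\mathbf{z})\rightharpoonup\overline{\mathbf{z}}\quad\text{weakly in }H,$$ and $$\liminf_{n\to+\infty}M_{t_n}\big(\mathrm{e}_m(\mathbf{u})+\mathcal{E}_m(\mathbf{u})\big)\ge 0 .$$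
   Context: $\Omega\subset\mathbb{R}^3$ is a smooth bounded domain with boundary $\Gamma$ and outward unit normal $\mathbf{n}$; $\|\cdot\|$ and $(\cdot,\cdot)$ denote the $L^2(\Omega)$ norm and scalar product. $H=\{\mathbf{u}\in L^2(\Omega)^3:\nabla\cdot\mathbf{u}=0,\ \mathbf{u}\cdot\mathbf{n}=0\text{ on }\Gamma\}$ and $V=\{\mathbf{u}\in H^1_0(\Omega)^3:\nabla\cdot\mathbf{u}=0\}$; $V'$ is the dual of $V$ (with $V$ normed by $\|\nabla\cdot\|$) and $\langle\cdot,\cdot\rangle$ is the duality pairing. Navier--Stokes equations: $\partial_t\mathbf{u}-\nu\Delta\mathbf{u}+(\mathbf{u}\cdot\nabla)\mathbf{u}+\nabla p=\mathbf{f}$, $\nabla\cdot\mathbf{u}=0$ in $\Omega\times(0,\infty)$, $\mathbf{u}=\mathbf{0}$ on $\Gamma$, $\mathbf{u}(\cdot,0)=\mathbf{u}(0)$. A global-in-time (Leray--Hopf) weak solution is a function $\mathbf{u}\in L^\infty(\mathbb{R}_+;H)\cap L^2_{\rm loc}([0,\infty);V)$, weakly continuous in time with values in $H$, attaining the initial datum, with $\frac{d}{dt}(\mathbf{u},\boldsymbol{\phi})+\nu(\nabla\mathbf{u},\nabla\boldsymbol{\phi})+\langle(\mathbf{u}\cdot\nabla)\mathbf{u},\boldsymbol{\phi}\rangle=\langle\mathbf{f},\boldsymbol{\phi}\rangle$ in the sense of distributions on $(0,\infty)$ for all $\boldsymbol{\phi}\in V$, and satisfying for all $t>0$ the energy inequality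 $\frac12\|\mathbf{u}(t)\|^2+\nu\int_0^t\|\nabla\mathbf{u}\|^2ds\le\frac12\|\mathbf{u}(0)\|^2+\int_0^t\langle\mathbf{f},\mathbf{u}\rangle ds$ as well as the standard estimates $\|\mathbf{u}(t)\|^2\le\|\mathbf{u}(0)\|^2e^{-\nu C_Pt}+\frac{\|\mathbf{f}\|_{V'}^2}{\nu^2C_P}(1-e^{-\nu C_Pt})$ and $\frac1t\int_0^t\|\nabla\mathbf{u}(s)\|^2ds\le\frac{\|\mathbf{f}\|_{V'}^2}{\nu^2}+\frac{\|\mathbf{u}(0)\|^2}{\nu t}$, where $C_P$ is the best constant in $C_P\|\mathbf{v}\|^2\le\|\nabla\mathbf{v}\|^2$, $\mathbf{v}\in H^1_0(\Omega)^3$. $\{\mathbf{w}_k\}_{k\in\mathbb{N}}$ is a family of (divergence-free, vanishing on $\Gamma$) functions in $V$ forming an orthonormal basis of $H$ for the $L^2$ scalar product; their gradients are not assumed orthogonal. For fixed $m\in\mathbb{N}$, $\mathbf{P}_m$ is the $L^2$-orthogonal projection onto $V_m=\mathrm{span}\{\mathbf{w}_1,\dots,\mathbf{w}_m\}$. $B(\mathbf{u},\mathbf{v})$ denotes the Leray projection of $(\mathbf{u}\cdot\nabla)\mathbf{v}$ (so $(B(\mathbf{u},\mathbf{v}),\mathbf{w})=\int_\Omega(\mathbf{u}\cdot\nabla)\mathbf{v}\cdot\mathbf{w}\,dx$ for $\mathbf{w}$ divergence-free). Define $$\mathrm{e}_m(\mathbf{u})=-(B(\mathbf{y},\mathbf{y}),\mathbf{z})+(B(\mathbf{z},\mathbf{z}),\mathbf{y}),\qquad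 \mathcal{E}_m(\mathbf{u})=-\nu(\nabla\mathbf{y},\nabla\mathbf{z}).$$ These are functions of time. For any field or function of time $\psi$, $M_t(\psi)=\frac1t\int_0^t\psi(s)\,ds$, $t>0$. *)

theory Defs
  imports "HOL-Analysis.Analysis"
begin

type_synonym vfield = "real^3 \<Rightarrow> real^3"

section \<open>Smooth functions, smooth domains, test functions\<close>

primrec Ck_on :: "nat \<Rightarrow> 'a::euclidean_space set \<Rightarrow> ('a \<Rightarrow> 'b::real_normed_vector) \<Rightarrow> bool" where
  "Ck_on 0 S f \<longleftrightarrow> continuous_on S f"
| "Ck_on (Suc k) S f \<longleftrightarrow>
     (\<forall>x\<in>S. f differentiable (at x)) \<and>
     (\<forall>e\<in>Basis. Ck_on k S (\<lambda>x. frechet_derivative f (at x) e))"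

definition Cinf_on :: "'a::euclidean_space set \<Rightarrow> ('a \<Rightarrow> 'b::real_normed_vector) \<Rightarrow> bool" where
  "Cinf_on S f \<longleftrightarrow> (\<forall>k. Ck_on k S f)"

text \<open>The boundary is smooth if near each of its points \<open>\<Omega>\<close> is a sublevel set
  \<open>{g < 0}\<close> of a smooth function without critical points.\<close>

definition smooth_bounded_domain :: "(real^3) set \<Rightarrow> bool" where
  "smooth_bounded_domain \<Omega> \<longleftrightarrow>
     open \<Omega> \<and> connected \<Omega> \<and> bounded \<Omega> \<and> \<Omega> \<noteq> {} \<and>
     (\<forall>p\<in>frontier \<Omega>. \<exists>U (g :: real^3 \<Rightarrow> real).
        open U \<and> p \<in> U \<and> Cinf_on U g \<and>
        (\<forall>x\<in>U. frechet_derivative g (at x) \<noteq> (\<lambda>_. 0)) \<and>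
        \<Omega> \<inter> U = {x \<in> U. g x < 0})"

definition test_functions :: "'a::euclidean_space set \<Rightarrow> ('a \<Rightarrow> 'b::real_normed_vector) set" where
  "test_functions S =
     {\<phi>. Cinf_on UNIV \<phi> \<and> (\<exists>K. compact K \<and> K \<subseteq> S \<and> (\<forall>x. x \<notin> K \<longrightarrow> \<phi> x = 0))}"

definition grad :: "(real^3 \<Rightarrow> real) \<Rightarrow> real^3 \<Rightarrow> real^3" where
  "grad \<phi> x = (\<chi> j. frechet_derivative \<phi> (at x) (axis j 1))"

definition jac :: "vfield \<Rightarrow> real^3 \<Rightarrow> real^3^3" where
  "jac \<phi> x = matrix (frechet_derivative \<phi> (at x))"

section \<open>Lebesgue and Sobolev spaces\<close>

text \<open>Elements of the spaces below are functions, not equivalence classes; equality in the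
  sense of the spaces is equality almost everywhere in \<open>\<Omega>\<close>.\<close>

definition L2 :: "(real^3) set \<Rightarrow> (real^3 \<Rightarrow> 'b::euclidean_space) set" where
  "L2 \<Omega> = {f \<in> borel_measurable (lebesgue_on \<Omega>). integrable (lebesgue_on \<Omega>) (\<lambda>x. (norm (f x))\<^sup>2)}"

definition L2_inner :: "(real^3) set \<Rightarrow> (real^3 \<Rightarrow> 'b::euclidean_space) \<Rightarrow> (real^3 \<Rightarrow> 'b) \<Rightarrow> real" where
  "L2_inner \<Omega> f g = (LINT x|lebesgue_on \<Omega>. f x \<bullet> g x)"

definition L2_norm :: "(real^3) set \<Rightarrow> (real^3 \<Rightarrow> 'b::euclidean_space) \<Rightarrow> real" where
  "L2_norm \<Omega> f = sqrt (L2_inner \<Omega> f f)"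

definition has_weak_grad :: "(real^3) set \<Rightarrow> (real^3 \<Rightarrow> real) \<Rightarrow> (real^3 \<Rightarrow> real^3) \<Rightarrow> bool" where
  "has_weak_grad \<Omega> f g \<longleftrightarrow> f \<in> L2 \<Omega> \<and> g \<in> L2 \<Omega> \<and>
     (\<forall>\<phi>\<in>test_functions \<Omega>. \<forall>j.
        (LINT x|lebesgue_on \<Omega>. f x * grad \<phi> x $ j) = - (LINT x|lebesgue_on \<Omega>. g x $ j * \<phi> x))"

text \<open>As for \<^const>\<open>jac\<close>, the entry \<open>G x $ i $ j\<close> is the derivative of the \<open>i\<close>-th component
  in direction \<open>j\<close>.\<close>

definition has_weak_jac :: "(real^3) set \<Rightarrow> vfield \<Rightarrow> (real^3 \<Rightarrow> real^3^3) \<Rightarrow> bool" where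
  "has_weak_jac \<Omega> u G \<longleftrightarrow> u \<in> L2 \<Omega> \<and> G \<in> L2 \<Omega> \<and>
     (\<forall>i. has_weak_grad \<Omega> (\<lambda>x. u x $ i) (\<lambda>x. G x $ i))"

text \<open>The gradient of a field in \<open>H\<^sup>1\<close>, unique up to null sets.\<close>

definition weak_jac :: "(real^3) set \<Rightarrow> vfield \<Rightarrow> real^3 \<Rightarrow> real^3^3" where
  "weak_jac \<Omega> u = (SOME G. has_weak_jac \<Omega> u G)"

text \<open>\<open>H\<^sup>1\<^sub>0(\<Omega>)\<^sup>3\<close>: the closure of the smooth compactly supported fields in the \<open>H\<^sup>1\<close> norm.\<close>

definition H10 :: "(real^3) set \<Rightarrow> vfield set" where
  "H10 \<Omega> = {u. \<exists>G. has_weak_jac \<Omega> u G \<and>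
     (\<exists>\<phi>. (\<forall>n::nat. \<phi> n \<in> test_functions \<Omega>) \<and>
          (\<lambda>n. L2_norm \<Omega> (\<lambda>x. \<phi> n x - u x)) \<longlonglongrightarrow> 0 \<and>
          (\<lambda>n. L2_norm \<Omega> (\<lambda>x. jac (\<phi> n) x - G x)) \<longlonglongrightarrow> 0)}"

definition div_free :: "(real^3) set \<Rightarrow> vfield \<Rightarrow> bool" where
  "div_free \<Omega> u \<longleftrightarrow> (\<forall>\<phi>\<in>test_functions \<Omega>. (LINT x|lebesgue_on \<Omega>. u x \<bullet> grad \<phi> x) = 0)"

text \<open>The normal trace of a square integrable divergence-free field \<open>u\<close> is the functional
  sending the trace of \<open>q \<in> H\<^sup>1(\<Omega>)\<close> to the integral of \<open>u \<bullet> \<nabla>q\<close> over \<open>\<Omega>\<close> (Green's formula).\<close>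

definition normal_trace_zero :: "(real^3) set \<Rightarrow> vfield \<Rightarrow> bool" where
  "normal_trace_zero \<Omega> u \<longleftrightarrow>
     (\<forall>q g. has_weak_grad \<Omega> q g \<longrightarrow> (LINT x|lebesgue_on \<Omega>. u x \<bullet> g x) = 0)"

definition H_space :: "(real^3) set \<Rightarrow> vfield set" where
  "H_space \<Omega> = {u \<in> L2 \<Omega>. div_free \<Omega> u \<and> normal_trace_zero \<Omega> u}"

definition V_space :: "(real^3) set \<Rightarrow> vfield set" where
  "V_space \<Omega> = {u \<in> H10 \<Omega>. div_free \<Omega> u}"

definition V_norm :: "(real^3) set \<Rightarrow> vfield \<Rightarrow> real" where
  "V_norm \<Omega> v = L2_norm \<Omega> (weak_jac \<Omega> v)"

text \<open>The norm in \<open>V'\<close> of the functional \<open>\<phi> \<mapsto> (f, \<phi>)\<close>.\<close>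

definition V_dual_norm :: "(real^3) set \<Rightarrow> vfield \<Rightarrow> real" where
  "V_dual_norm \<Omega> f = Sup {\<bar>L2_inner \<Omega> f \<phi>\<bar> | \<phi>. \<phi> \<in> V_space \<Omega> \<and> V_norm \<Omega> \<phi> \<le> 1}"

definition poincare_const :: "(real^3) set \<Rightarrow> real" where
  "poincare_const \<Omega> =
     Sup {C. \<forall>v\<in>H10 \<Omega>. C * (L2_norm \<Omega> v)\<^sup>2 \<le> (L2_norm \<Omega> (weak_jac \<Omega> v))\<^sup>2}"

text \<open>The pairing \<open>(B(u,v), w)\<close> for divergence-free \<open>w\<close>, that is, the integral of
  \<open>(u \<bullet> \<nabla>)v \<bullet> w\<close>; it is also the pairing of \<open>(u \<bullet> \<nabla>)v\<close> with \<open>w\<close>.\<close>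

definition B_pairing :: "(real^3) set \<Rightarrow> vfield \<Rightarrow> vfield \<Rightarrow> vfield \<Rightarrow> real" where
  "B_pairing \<Omega> u v w = (LINT x|lebesgue_on \<Omega>. (weak_jac \<Omega> v x *v u x) \<bullet> w x)"

section \<open>Functions of time with values in a space of fields\<close>

definition simple_in :: "vfield set \<Rightarrow> real set \<Rightarrow> (real \<Rightarrow> vfield) \<Rightarrow> bool" where
  "simple_in X I s \<longleftrightarrow> finite (s ` I) \<and> s ` I \<subseteq> X \<and> (\<forall>v. {t \<in> I. s t = v} \<in> sets lebesgue)"

definition strongly_measurable ::
    "(vfield \<Rightarrow> real) \<Rightarrow> vfield set \<Rightarrow> real set \<Rightarrow> (real \<Rightarrow> vfield) \<Rightarrow> bool" where
  "strongly_measurable N X I \<psi> \<longleftrightarrow>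
     (\<exists>s. (\<forall>n::nat. simple_in X I (s n)) \<and>
          (AE t in lebesgue_on I. (\<lambda>n. N (\<lambda>x. s n t x - \<psi> t x)) \<longlonglongrightarrow> 0))"

definition simple_time_integral :: "real set \<Rightarrow> (real \<Rightarrow> vfield) \<Rightarrow> vfield" where
  "simple_time_integral I s = (\<lambda>x. \<Sum>v\<in>s ` I. measure lebesgue {t \<in> I. s t = v} *\<^sub>R v x)"

text \<open>\<open>a\<close> is the Bochner integral in \<open>H\<close> of \<open>\<psi>\<close> over the bounded time interval \<open>I\<close>. A pointwise
  integral in time would depend on the representatives chosen for the \<open>\<psi> t\<close>.\<close>

definition has_H_integral :: "(real^3) set \<Rightarrow> real set \<Rightarrow> (real \<Rightarrow> vfield) \<Rightarrow> vfield \<Rightarrow> bool" where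
  "has_H_integral \<Omega> I \<psi> a \<longleftrightarrow> a \<in> H_space \<Omega> \<and>
     (\<exists>s. (\<forall>n::nat. simple_in (H_space \<Omega>) I (s n) \<and>
             integrable (lebesgue_on I) (\<lambda>t. L2_norm \<Omega> (\<lambda>x. s n t x - \<psi> t x))) \<and>
          (\<lambda>n. LINT t|lebesgue_on I. L2_norm \<Omega> (\<lambda>x. s n t x - \<psi> t x)) \<longlonglongrightarrow> 0 \<and>
          (\<lambda>n. L2_norm \<Omega> (\<lambda>x. simple_time_integral I (s n) x - a x)) \<longlonglongrightarrow> 0)"

definition field_mean :: "(real^3) set \<Rightarrow> real \<Rightarrow> (real \<Rightarrow> vfield) \<Rightarrow> vfield" where
  "field_mean \<Omega> t \<psi> = (\<lambda>x. (1 / t) *\<^sub>R (SOME a. has_H_integral \<Omega> {0..t} \<psi> a) x)"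

definition scalar_mean :: "real \<Rightarrow> (real \<Rightarrow> real) \<Rightarrow> real" where
  "scalar_mean t \<psi> = (1 / t) * (LINT s|lebesgue_on {0..t}. \<psi> s)"

definition weakly_converges_H :: "(real^3) set \<Rightarrow> (nat \<Rightarrow> vfield) \<Rightarrow> vfield \<Rightarrow> bool" where
  "weakly_converges_H \<Omega> v a \<longleftrightarrow>
     (\<forall>\<phi>\<in>H_space \<Omega>. (\<lambda>n. L2_inner \<Omega> (v n) \<phi>) \<longlonglongrightarrow> L2_inner \<Omega> a \<phi>)"

definition Linf_H :: "(real^3) set \<Rightarrow> (real \<Rightarrow> vfield) \<Rightarrow> bool" where
  "Linf_H \<Omega> u \<longleftrightarrow>
     (AE t in lebesgue_on {0..}. u t \<in> H_space \<Omega>) \<and>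
     strongly_measurable (L2_norm \<Omega>) (H_space \<Omega>) {0..} u \<and>
     (\<exists>C. AE t in lebesgue_on {0..}. L2_norm \<Omega> (u t) \<le> C)"

definition L2loc_V :: "(real^3) set \<Rightarrow> (real \<Rightarrow> vfield) \<Rightarrow> bool" where
  "L2loc_V \<Omega> u \<longleftrightarrow>
     (AE t in lebesgue_on {0..}. u t \<in> V_space \<Omega>) \<and>
     strongly_measurable (V_norm \<Omega>) (V_space \<Omega>) {0..} u \<and>
     (\<forall>T>0. integrable (lebesgue_on {0..T}) (\<lambda>t. (V_norm \<Omega> (u t))\<^sup>2))"

definition weakly_continuous_H :: "(real^3) set \<Rightarrow> (real \<Rightarrow> vfield) \<Rightarrow> bool" where
  "weakly_continuous_H \<Omega> u \<longleftrightarrow>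
     (\<forall>t\<ge>0. u t \<in> H_space \<Omega>) \<and>
     (\<forall>\<phi>\<in>H_space \<Omega>. continuous_on {0..} (\<lambda>t. L2_inner \<Omega> (u t) \<phi>))"

section \<open>Leray--Hopf weak solutions with a time-independent square integrable force\<close>

definition NSE_weak_form :: "(real^3) set \<Rightarrow> real \<Rightarrow> vfield \<Rightarrow> (real \<Rightarrow> vfield) \<Rightarrow> bool" where
  "NSE_weak_form \<Omega> \<nu> f u \<longleftrightarrow>
     (\<forall>\<phi>\<in>V_space \<Omega>. \<forall>\<theta>\<in>test_functions {0<..}.
        - (LINT t|lebesgue_on {0<..}. L2_inner \<Omega> (u t) \<phi> * deriv \<theta> t)
        + (LINT t|lebesgue_on {0<..}.
             (\<nu> * L2_inner \<Omega> (weak_jac \<Omega> (u t)) (weak_jac \<Omega> \<phi>) + B_pairing \<Omega> (u t) (u t) \<phi>) * \<theta> t)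
        = (LINT t|lebesgue_on {0<..}. L2_inner \<Omega> f \<phi> * \<theta> t))"

definition leray_hopf_solution ::
    "(real^3) set \<Rightarrow> real \<Rightarrow> vfield \<Rightarrow> vfield \<Rightarrow> (real \<Rightarrow> vfield) \<Rightarrow> bool" where
  "leray_hopf_solution \<Omega> \<nu> f u0 u \<longleftrightarrow>
     Linf_H \<Omega> u \<and> L2loc_V \<Omega> u \<and> weakly_continuous_H \<Omega> u \<and>
     (AE x in lebesgue_on \<Omega>. u 0 x = u0 x) \<and>
     NSE_weak_form \<Omega> \<nu> f u \<and>
     (\<forall>t>0. (L2_norm \<Omega> (u t))\<^sup>2 / 2 + \<nu> * (LINT s|lebesgue_on {0..t}. (V_norm \<Omega> (u s))\<^sup>2)
         \<le> (L2_norm \<Omega> u0)\<^sup>2 / 2 + (LINT s|lebesgue_on {0..t}. L2_inner \<Omega> f (u s))) \<and>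
     (\<forall>t>0. (L2_norm \<Omega> (u t))\<^sup>2
         \<le> (L2_norm \<Omega> u0)\<^sup>2 * exp (- \<nu> * poincare_const \<Omega> * t)
           + (V_dual_norm \<Omega> f)\<^sup>2 / (\<nu>\<^sup>2 * poincare_const \<Omega>)
             * (1 - exp (- \<nu> * poincare_const \<Omega> * t))) \<and>
     (\<forall>t>0. scalar_mean t (\<lambda>s. (V_norm \<Omega> (u s))\<^sup>2)
         \<le> (V_dual_norm \<Omega> f)\<^sup>2 / \<nu>\<^sup>2 + (L2_norm \<Omega> u0)\<^sup>2 / (\<nu> * t))"

section \<open>The splitting by an orthonormal basis\<close>

text \<open>Indices start at 0, so the first \<open>m\<close> basis elements are \<open>w 0, \<dots>, w (m - 1)\<close>.\<close>

definition orthonormal_basis_H :: "(real^3) set \<Rightarrow> (nat \<Rightarrow> vfield) \<Rightarrow> bool" where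
  "orthonormal_basis_H \<Omega> w \<longleftrightarrow>
     (\<forall>k. w k \<in> H_space \<Omega>) \<and>
     (\<forall>i j. L2_inner \<Omega> (w i) (w j) = (if i = j then 1 else 0)) \<and>
     (\<forall>v\<in>H_space \<Omega>. (\<lambda>n. L2_norm \<Omega> (\<lambda>x. v x - (\<Sum>k<n. L2_inner \<Omega> v (w k) *\<^sub>R w k x))) \<longlonglongrightarrow> 0)"

definition span_first :: "(nat \<Rightarrow> vfield) \<Rightarrow> nat \<Rightarrow> vfield set" where
  "span_first w m = {\<lambda>x. \<Sum>k<m. c k *\<^sub>R w k x | c. True}"

definition P_proj :: "(real^3) set \<Rightarrow> (nat \<Rightarrow> vfield) \<Rightarrow> nat \<Rightarrow> vfield \<Rightarrow> vfield" where
  "P_proj \<Omega> w m v = (THE p. p \<in> span_first w m \<and>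
     (\<forall>q\<in>span_first w m. L2_inner \<Omega> (\<lambda>x. v x - p x) q = 0))"

definition Q_proj :: "(real^3) set \<Rightarrow> (nat \<Rightarrow> vfield) \<Rightarrow> nat \<Rightarrow> vfield \<Rightarrow> vfield" where
  "Q_proj \<Omega> w m v = (\<lambda>x. v x - P_proj \<Omega> w m v x)"

definition e_m :: "(real^3) set \<Rightarrow> (nat \<Rightarrow> vfield) \<Rightarrow> nat \<Rightarrow> vfield \<Rightarrow> real" where
  "e_m \<Omega> w m v = (let y = P_proj \<Omega> w m v; z = Q_proj \<Omega> w m v in
     - B_pairing \<Omega> y y z + B_pairing \<Omega> z z y)"

definition E_m :: "(real^3) set \<Rightarrow> real \<Rightarrow> (nat \<Rightarrow> vfield) \<Rightarrow> nat \<Rightarrow> vfield \<Rightarrow> real" where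
  "E_m \<Omega> \<nu> w m v = (let y = P_proj \<Omega> w m v; z = Q_proj \<Omega> w m v in
     - \<nu> * L2_inner \<Omega> (weak_jac \<Omega> y) (weak_jac \<Omega> z))"

end

theory Submission
  imports Defs "HOL-Library.Diagonal_Subsequence"
begin

text \<open>
  Why the theorem holds. Test the equation with the first \<open>m\<close> basis fields. The coefficients of
  \<open>y = P\<^sub>m u\<close> are continuous in time with a locally integrable derivative, so the low modes satisfy an
  energy \<^emph>\<open>equality\<close>. The full solution satisfies the energy \<^emph>\<open>inequality\<close>. The force pairs only with
  \<open>y\<close>, hence it cancels when the equality is subtracted from the inequality, and what remains is
  \<open>\<integral>\<^sub>0\<^sup>T (e\<^sub>m(u) + E\<^sub>m(u)) dt \<ge> \<nu> \<integral>\<^sub>0\<^sup>T \<parallel>\<nabla>z\<parallel>\<^sup>2 dt - \<parallel>u(0)\<parallel>\<^sup>2 / 2\<close>. After division by \<open>T\<close> the lower bound tends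
  to 0 along every sequence of times tending to infinity (\<open>energy_transfer_lower_bound\<close>). The sequence is
  therefore only chosen to make the means of \<open>z\<close> converge weakly: they are bounded in the Hilbert
  space \<open>H\<close>, which has a countable orthonormal basis (\<open>weak_compactness\<close>).

  The rewriting of \<open>(B(u,u), y)\<close> as \<open>e\<^sub>m(u)\<close> rests on the antisymmetry of the trilinear form on \<open>V\<close>
  (\<open>B_pairing_antisymmetric\<close>). It is the product rule for smooth fields, and it extends to \<open>V\<close> because
  the form is continuous there: \<open>\<parallel>u\<parallel>\<^sub>4 \<le> K \<parallel>\<nabla>u\<parallel>\<close> for fields vanishing on the boundary. This inequality
  (\<open>Ladyzhenskaya_test_functions\<close>) is proved by integrating along the coordinate axes.

  Three further points need care. Weak gradients are unique up to null sets
  (\<open>fundamental_lemma\<close>), which makes the chosen gradient linear almost everywhere. The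
  passage from distributional derivatives in time to increments uses smoothed indicators of
  intervals (\<open>weak_derivative_increment\<close>), and the equation for the coefficients is multiplied by
  the coefficients through an estimate on fine partitions (\<open>square_increment\<close>). Finally, the mean of
  \<open>z\<close> is a Bochner integral, whose existence has to be established before anything can be said about
  it; it is found as a Riesz representative (\<open>has_H_integral_exists\<close>).
\<close>

section \<open>The spaces of square integrable functions\<close>

lemma L2_measurable: "f \<in> L2 \<Omega> \<Longrightarrow> f \<in> borel_measurable (lebesgue_on \<Omega>)"
  by (simp add: L2_def)

lemma L2_integrable_sq: "f \<in> L2 \<Omega> \<Longrightarrow> integrable (lebesgue_on \<Omega>) (\<lambda>x. (norm (f x))\<^sup>2)"
  by (simp add: L2_def)

lemma L2I_bound:
  assumes "f \<in> borel_measurable (lebesgue_on \<Omega>)" and "integrable (lebesgue_on \<Omega>) g"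
    and "\<And>x. (norm (f x))\<^sup>2 \<le> g x"
  shows "f \<in> L2 \<Omega>"
proof -
  have "integrable (lebesgue_on \<Omega>) (\<lambda>x. (norm (f x))\<^sup>2)"
  proof (rule Bochner_Integration.integrable_bound[OF assms(2)])
    show "(\<lambda>x. (norm (f x))\<^sup>2) \<in> borel_measurable (lebesgue_on \<Omega>)" using assms(1) by measurable
    show "AE x in lebesgue_on \<Omega>. norm ((norm (f x))\<^sup>2) \<le> norm (g x)"
      using assms(3) by (intro AE_I2) (simp add: order_trans[OF _ abs_ge_self])
  qed
  then show ?thesis using assms(1) by (simp add: L2_def)
qed

lemma L2_inner_integrable:
  assumes "f \<in> L2 \<Omega>" "g \<in> L2 \<Omega>"
  shows "integrable (lebesgue_on \<Omega>) (\<lambda>x. f x \<bullet> g x)"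
proof (rule Bochner_Integration.integrable_bound)
  show "integrable (lebesgue_on \<Omega>) (\<lambda>x. (norm (f x))\<^sup>2 + (norm (g x))\<^sup>2)"
    using assms by (intro Bochner_Integration.integrable_add L2_integrable_sq)
  show "(\<lambda>x. f x \<bullet> g x) \<in> borel_measurable (lebesgue_on \<Omega>)"
    using assms[THEN L2_measurable] by measurable
  have "\<bar>f x \<bullet> g x\<bar> \<le> (norm (f x))\<^sup>2 + (norm (g x))\<^sup>2" for x
  proof -
    have "\<bar>f x \<bullet> g x\<bar> \<le> norm (f x) * norm (g x)" by (rule Cauchy_Schwarz_ineq2)
    moreover have "0 \<le> (norm (f x) - norm (g x))\<^sup>2" "0 \<le> (norm (f x) + norm (g x))\<^sup>2" by auto
    moreover have "0 \<le> norm (f x) * norm (g x)" by simp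
    ultimately show ?thesis by (simp add: power2_eq_square algebra_simps)
  qed
  then show "AE x in lebesgue_on \<Omega>. norm (f x \<bullet> g x) \<le> norm ((norm (f x))\<^sup>2 + (norm (g x))\<^sup>2)"
    by (intro AE_I2) (simp add: order_trans[OF _ abs_ge_self])
qed

lemma L2_add: 
  assumes "f \<in> L2 \<Omega>" "g \<in> L2 \<Omega>"
  shows "(\<lambda>x. f x + g x) \<in> L2 \<Omega>"
proof (rule L2I_bound)
  show "(\<lambda>x. f x + g x) \<in> borel_measurable (lebesgue_on \<Omega>)"
    using assms[THEN L2_measurable] by measurable
  show "integrable (lebesgue_on \<Omega>) (\<lambda>x. 2 * ((norm (f x))\<^sup>2 + (norm (g x))\<^sup>2))"
    using assms by (intro integrable_mult_right Bochner_Integration.integrable_add L2_integrable_sq)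
  show "(norm (f x + g x))\<^sup>2 \<le> 2 * ((norm (f x))\<^sup>2 + (norm (g x))\<^sup>2)" for x
  proof -
    have "(norm (f x + g x))\<^sup>2 + (norm (f x - g x))\<^sup>2 = 2 * ((norm (f x))\<^sup>2 + (norm (g x))\<^sup>2)"
      by (simp add: power2_norm_eq_inner inner_simps inner_commute)
    then show ?thesis by (smt (verit) zero_le_power2)
  qed
qed

lemma L2_scaleR: "f \<in> L2 \<Omega> \<Longrightarrow> (\<lambda>x. c *\<^sub>R f x) \<in> L2 \<Omega>"
  by (auto simp: L2_def power_mult_distrib)

lemma L2_zero: "(\<lambda>x. 0) \<in> L2 \<Omega>"
  by (simp add: L2_def)

lemma L2_diff: "f \<in> L2 \<Omega> \<Longrightarrow> g \<in> L2 \<Omega> \<Longrightarrow> (\<lambda>x. f x - g x) \<in> L2 \<Omega>"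
  using L2_add[of f \<Omega> "\<lambda>x. (-1) *\<^sub>R g x"] L2_scaleR[of g \<Omega> "-1"] by simp

lemma L2_sum: "(\<And>k. k \<in> A \<Longrightarrow> f k \<in> L2 \<Omega>) \<Longrightarrow> (\<lambda>x. \<Sum>k\<in>A. f k x) \<in> L2 \<Omega>"
  by (induction A rule: infinite_finite_induct) (auto intro: L2_add L2_zero)

lemma L2_norm_fun: "f \<in> L2 \<Omega> \<Longrightarrow> (\<lambda>x. norm (f x)) \<in> L2 \<Omega>"
  by (auto simp: L2_def)

lemma L2_component: 
  fixes f :: "real^3 \<Rightarrow> 'b::euclidean_space^'n"
  assumes "f \<in> L2 \<Omega>" shows "(\<lambda>x. f x $ i) \<in> L2 \<Omega>"
proof (rule L2I_bound[OF _ L2_integrable_sq[OF assms]])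
  show "(\<lambda>x. f x $ i) \<in> borel_measurable (lebesgue_on \<Omega>)"
    using L2_measurable[OF assms]
    by (rule borel_measurable_continuous_on[rotated]) (intro continuous_intros)
  show "(norm (f x $ i))\<^sup>2 \<le> (norm (f x))\<^sup>2" for x
    by (intro power_mono Finite_Cartesian_Product.norm_nth_le norm_ge_zero)
qed

lemma L2_inner_commute: "L2_inner \<Omega> f g = L2_inner \<Omega> g f"
  by (simp add: L2_inner_def inner_commute)

lemma L2_inner_add_left:
  "f \<in> L2 \<Omega> \<Longrightarrow> g \<in> L2 \<Omega> \<Longrightarrow> h \<in> L2 \<Omega> \<Longrightarrow>
    L2_inner \<Omega> (\<lambda>x. f x + g x) h = L2_inner \<Omega> f h + L2_inner \<Omega> g h"
  by (simp add: L2_inner_def inner_add_left L2_inner_integrable)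

lemma L2_inner_diff_left:
  "f \<in> L2 \<Omega> \<Longrightarrow> g \<in> L2 \<Omega> \<Longrightarrow> h \<in> L2 \<Omega> \<Longrightarrow>
    L2_inner \<Omega> (\<lambda>x. f x - g x) h = L2_inner \<Omega> f h - L2_inner \<Omega> g h"
  by (simp add: L2_inner_def inner_diff_left L2_inner_integrable)

lemma L2_inner_scaleR_left: "L2_inner \<Omega> (\<lambda>x. c *\<^sub>R f x) h = c * L2_inner \<Omega> f h"
  by (simp add: L2_inner_def)

lemma L2_inner_sum_left:
  "(\<And>k. k \<in> A \<Longrightarrow> f k \<in> L2 \<Omega>) \<Longrightarrow> h \<in> L2 \<Omega> \<Longrightarrow>
    L2_inner \<Omega> (\<lambda>x. \<Sum>k\<in>A. f k x) h = (\<Sum>k\<in>A. L2_inner \<Omega> (f k) h)"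
  by (simp add: L2_inner_def inner_sum_left L2_inner_integrable)

lemma L2_inner_add_right:
  "f \<in> L2 \<Omega> \<Longrightarrow> g \<in> L2 \<Omega> \<Longrightarrow> h \<in> L2 \<Omega> \<Longrightarrow>
    L2_inner \<Omega> h (\<lambda>x. f x + g x) = L2_inner \<Omega> h f + L2_inner \<Omega> h g"
  by (simp add: L2_inner_def inner_add_right L2_inner_integrable)

lemma L2_inner_diff_right:
  "f \<in> L2 \<Omega> \<Longrightarrow> g \<in> L2 \<Omega> \<Longrightarrow> h \<in> L2 \<Omega> \<Longrightarrow>
    L2_inner \<Omega> h (\<lambda>x. f x - g x) = L2_inner \<Omega> h f - L2_inner \<Omega> h g"
  by (simp add: L2_inner_def inner_diff_right L2_inner_integrable)

lemma L2_inner_scaleR_right: "L2_inner \<Omega> h (\<lambda>x. c *\<^sub>R f x) = c * L2_inner \<Omega> h f"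
  by (simp add: L2_inner_def)

lemma L2_inner_sum_right:
  "(\<And>k. k \<in> A \<Longrightarrow> f k \<in> L2 \<Omega>) \<Longrightarrow> h \<in> L2 \<Omega> \<Longrightarrow>
    L2_inner \<Omega> h (\<lambda>x. \<Sum>k\<in>A. f k x) = (\<Sum>k\<in>A. L2_inner \<Omega> h (f k))"
  by (simp add: L2_inner_def inner_sum_right L2_inner_integrable)

lemma L2_inner_cong_AE:
  assumes "f \<in> L2 \<Omega>" "f' \<in> L2 \<Omega>" "g \<in> L2 \<Omega>" "g' \<in> L2 \<Omega>"
    and "AE x in lebesgue_on \<Omega>. f x = f' x" "AE x in lebesgue_on \<Omega>. g x = g' x"
  shows "L2_inner \<Omega> f g = L2_inner \<Omega> f' g'"
  unfolding L2_inner_def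
proof (rule integral_cong_AE)
  show "(\<lambda>x. f x \<bullet> g x) \<in> borel_measurable (lebesgue_on \<Omega>)"
    "(\<lambda>x. f' x \<bullet> g' x) \<in> borel_measurable (lebesgue_on \<Omega>)"
    using assms(1-4)[THEN L2_measurable] by measurable
  show "AE x in lebesgue_on \<Omega>. f x \<bullet> g x = f' x \<bullet> g' x" using assms(5,6) by eventually_elim simp
qed

lemma L2_inner_self_nonneg: "0 \<le> L2_inner \<Omega> f f"
  by (simp add: L2_inner_def)

lemma L2_norm_nonneg [simp]: "0 \<le> L2_norm \<Omega> f"
  by (simp add: L2_norm_def L2_inner_self_nonneg)

lemma L2_norm_sq: "(L2_norm \<Omega> f)\<^sup>2 = L2_inner \<Omega> f f"
  by (simp add: L2_norm_def L2_inner_self_nonneg)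

lemma L2_norm_sq_integral: "(L2_norm \<Omega> f)\<^sup>2 = (LINT x|lebesgue_on \<Omega>. (norm (f x))\<^sup>2)"
  by (simp add: L2_norm_sq L2_inner_def power2_norm_eq_inner)

lemma L2_norm_sq_nn_integral:
  assumes "f \<in> L2 \<Omega>"
  shows "(\<integral>\<^sup>+x. ennreal ((norm (f x))\<^sup>2) \<partial>lebesgue_on \<Omega>) = ennreal ((L2_norm \<Omega> f)\<^sup>2)"
  unfolding L2_norm_sq_integral by (intro nn_integral_eq_integral L2_integrable_sq assms AE_I2) simp

lemma L2I_nn_integral:
  assumes "f \<in> borel_measurable (lebesgue_on \<Omega>)"
    and "(\<integral>\<^sup>+x. ennreal ((norm (f x))\<^sup>2) \<partial>lebesgue_on \<Omega>) \<le> ennreal C"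
  shows "f \<in> L2 \<Omega>"
proof -
  have "integrable (lebesgue_on \<Omega>) (\<lambda>x. (norm (f x))\<^sup>2)"
  proof (rule integrableI_bounded)
    show "(\<lambda>x. (norm (f x))\<^sup>2) \<in> borel_measurable (lebesgue_on \<Omega>)" using assms(1) by measurable
    show "(\<integral>\<^sup>+x. ennreal (norm ((norm (f x))\<^sup>2)) \<partial>lebesgue_on \<Omega>) < \<infinity>"
      using assms(2) le_less_trans[OF _ ennreal_less_top] by auto
  qed
  then show ?thesis using assms(1) by (simp add: L2_def)
qed

lemma L2_norm_le_nn_integral:
  assumes "f \<in> borel_measurable (lebesgue_on \<Omega>)" "0 \<le> C"
    and "(\<integral>\<^sup>+x. ennreal ((norm (f x))\<^sup>2) \<partial>lebesgue_on \<Omega>) \<le> ennreal (C\<^sup>2)"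
  shows "f \<in> L2 \<Omega>" "L2_norm \<Omega> f \<le> C"
proof -
  show 1: "f \<in> L2 \<Omega>" using L2I_nn_integral assms(1,3) by blast
  then have "ennreal ((L2_norm \<Omega> f)\<^sup>2) \<le> ennreal (C\<^sup>2)"
    using assms(3) L2_norm_sq_nn_integral by metis
  then have "(L2_norm \<Omega> f)\<^sup>2 \<le> C\<^sup>2" by (simp add: ennreal_le_iff)
  then show "L2_norm \<Omega> f \<le> C" using assms(2) power2_le_imp_le by blast
qed

lemma L2_norm_scaleR: "L2_norm \<Omega> (\<lambda>x. c *\<^sub>R f x) = \<bar>c\<bar> * L2_norm \<Omega> f"
  unfolding L2_norm_def L2_inner_scaleR_left L2_inner_scaleR_right
  by (simp add: real_sqrt_mult flip: mult.assoc)

lemma L2_norm_cong_AE: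
  "f \<in> L2 \<Omega> \<Longrightarrow> f' \<in> L2 \<Omega> \<Longrightarrow> AE x in lebesgue_on \<Omega>. f x = f' x \<Longrightarrow> L2_norm \<Omega> f = L2_norm \<Omega> f'"
  unfolding L2_norm_def by (simp add: L2_inner_cong_AE[of f \<Omega> f' f f'])

text \<open>Pairing the pointwise norms, rather than \<open>f\<close> and \<open>g\<close> themselves, gives the form of the
  Cauchy--Schwarz inequality that also controls the integral of \<open>\<bar>f \<bullet> g\<bar>\<close>.\<close>

lemma L2_Cauchy_Schwarz_norms:
  assumes "f \<in> L2 \<Omega>" "g \<in> L2 \<Omega>"
  shows "integrable (lebesgue_on \<Omega>) (\<lambda>x. norm (f x) * norm (g x))"
    and "(LINT x|lebesgue_on \<Omega>. norm (f x) * norm (g x)) \<le> L2_norm \<Omega> f * L2_norm \<Omega> g"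
proof -
  show int: "integrable (lebesgue_on \<Omega>) (\<lambda>x. norm (f x) * norm (g x))"
    using L2_inner_integrable[OF L2_norm_fun[OF assms(1)] L2_norm_fun[OF assms(2)]] by simp
  let ?I = "LINT x|lebesgue_on \<Omega>. norm (f x) * norm (g x)"
  have nn: "ennreal ?I = (\<integral>\<^sup>+x. ennreal (norm (f x)) * ennreal (norm (g x)) \<partial>lebesgue_on \<Omega>)"
    by (subst nn_integral_eq_integral[OF int, symmetric]) (auto simp: ennreal_mult)
  have "(ennreal ?I)\<^sup>2 \<le> (\<integral>\<^sup>+x. (ennreal (norm (f x)))\<^sup>2 \<partial>lebesgue_on \<Omega>) *
      (\<integral>\<^sup>+x. (ennreal (norm (g x)))\<^sup>2 \<partial>lebesgue_on \<Omega>)"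
    unfolding nn using assms[THEN L2_measurable] by (intro Cauchy_Schwarz_nn_integral; measurable)
  also have "\<dots> = ennreal ((L2_norm \<Omega> f)\<^sup>2 * (L2_norm \<Omega> g)\<^sup>2)"
    using assms by (simp add: L2_norm_sq_nn_integral ennreal_mult ennreal_power)
  finally have "ennreal (?I\<^sup>2) \<le> ennreal ((L2_norm \<Omega> f * L2_norm \<Omega> g)\<^sup>2)"
    by (simp add: ennreal_power power_mult_distrib)
  then have "?I\<^sup>2 \<le> (L2_norm \<Omega> f * L2_norm \<Omega> g)\<^sup>2" by (simp add: ennreal_le_iff)
  then show "?I \<le> L2_norm \<Omega> f * L2_norm \<Omega> g" by (rule power2_le_imp_le) simp
qed

lemma L2_Cauchy_Schwarz:
  assumes "f \<in> L2 \<Omega>" "g \<in> L2 \<Omega>"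
  shows "\<bar>L2_inner \<Omega> f g\<bar> \<le> L2_norm \<Omega> f * L2_norm \<Omega> g"
proof -
  have "\<bar>L2_inner \<Omega> f g\<bar> \<le> (LINT x|lebesgue_on \<Omega>. norm (f x \<bullet> g x))"
    using integral_norm_bound[of "lebesgue_on \<Omega>" "\<lambda>x. f x \<bullet> g x"] by (simp add: L2_inner_def)
  also have "\<dots> \<le> (LINT x|lebesgue_on \<Omega>. norm (f x) * norm (g x))"
    using L2_inner_integrable[OF assms] L2_Cauchy_Schwarz_norms(1)[OF assms]
    by (intro integral_mono) (auto simp: Cauchy_Schwarz_ineq2)
  finally have "\<bar>L2_inner \<Omega> f g\<bar> \<le> (LINT x|lebesgue_on \<Omega>. norm (f x) * norm (g x))" .
  then show ?thesis using L2_Cauchy_Schwarz_norms(2)[OF assms] by linarith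
qed

lemma L2_triangle:
  assumes "f \<in> L2 \<Omega>" "g \<in> L2 \<Omega>"
  shows "L2_norm \<Omega> (\<lambda>x. f x + g x) \<le> L2_norm \<Omega> f + L2_norm \<Omega> g"
proof (rule power2_le_imp_le)
  have "(L2_norm \<Omega> (\<lambda>x. f x + g x))\<^sup>2 = L2_inner \<Omega> f f + 2 * L2_inner \<Omega> f g + L2_inner \<Omega> g g"
    using assms by (simp add: L2_norm_sq L2_inner_add_left L2_inner_add_right L2_add L2_inner_commute)
  also have "\<dots> \<le> (L2_norm \<Omega> f + L2_norm \<Omega> g)\<^sup>2"
    using L2_Cauchy_Schwarz[OF assms] by (simp add: power2_sum L2_norm_sq[symmetric])
  finally show "(L2_norm \<Omega> (\<lambda>x. f x + g x))\<^sup>2 \<le> (L2_norm \<Omega> f + L2_norm \<Omega> g)\<^sup>2" .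
qed simp

lemma L2_norm_minus_commute: "L2_norm \<Omega> (\<lambda>x. f x - g x) = L2_norm \<Omega> (\<lambda>x. g x - f x)"
  by (simp add: L2_norm_def L2_inner_def inner_diff_left inner_diff_right inner_commute algebra_simps)

lemma L2_triangle_diff:
  assumes "f \<in> L2 \<Omega>" "g \<in> L2 \<Omega>" "h \<in> L2 \<Omega>"
  shows "L2_norm \<Omega> (\<lambda>x. f x - g x) \<le> L2_norm \<Omega> (\<lambda>x. f x - h x) + L2_norm \<Omega> (\<lambda>x. h x - g x)"
  using L2_triangle[of "\<lambda>x. f x - h x" \<Omega> "\<lambda>x. h x - g x"] assms L2_diff by fastforce

lemma L2_norm_diff_ge:
  assumes "f \<in> L2 \<Omega>" "g \<in> L2 \<Omega>"
  shows "\<bar>L2_norm \<Omega> f - L2_norm \<Omega> g\<bar> \<le> L2_norm \<Omega> (\<lambda>x. f x - g x)"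
  using L2_triangle_diff[OF assms(1) L2_zero assms(2)] L2_triangle_diff[OF assms(2) L2_zero assms(1)]
    L2_norm_minus_commute[of \<Omega> f g] by simp

lemma L2_norm_tendsto:
  assumes "\<And>n. f n \<in> L2 \<Omega>" "g \<in> L2 \<Omega>" "(\<lambda>n. L2_norm \<Omega> (\<lambda>x. f n x - g x)) \<longlonglongrightarrow> 0"
  shows "(\<lambda>n. L2_norm \<Omega> (f n)) \<longlonglongrightarrow> L2_norm \<Omega> g"
proof -
  have "(\<lambda>n. L2_norm \<Omega> (f n) - L2_norm \<Omega> g) \<longlonglongrightarrow> 0"
    by (rule Lim_null_comparison[OF _ assms(3)]) (simp add: L2_norm_diff_ge assms)
  then show ?thesis by (simp add: LIM_zero_iff)
qed

lemma L2_inner_tendsto: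
  assumes "\<And>n. f n \<in> L2 \<Omega>" "g \<in> L2 \<Omega>" "h \<in> L2 \<Omega>" "(\<lambda>n. L2_norm \<Omega> (\<lambda>x. f n x - g x)) \<longlonglongrightarrow> 0"
  shows "(\<lambda>n. L2_inner \<Omega> (f n) h) \<longlonglongrightarrow> L2_inner \<Omega> g h"
proof -
  have "(\<lambda>n. L2_inner \<Omega> (f n) h - L2_inner \<Omega> g h) \<longlonglongrightarrow> 0"
  proof (rule Lim_null_comparison)
    show "(\<lambda>n. L2_norm \<Omega> (\<lambda>x. f n x - g x) * L2_norm \<Omega> h) \<longlonglongrightarrow> 0"
      using tendsto_mult_right[OF assms(4)] by simp
    have "\<bar>L2_inner \<Omega> (f n) h - L2_inner \<Omega> g h\<bar> \<le> L2_norm \<Omega> (\<lambda>x. f n x - g x) * L2_norm \<Omega> h" for n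
      using L2_Cauchy_Schwarz[OF L2_diff[OF assms(1)[of n] assms(2)] assms(3)] assms(1-3)
      by (simp add: L2_inner_diff_left)
    then show "\<forall>\<^sub>F n in sequentially. norm (L2_inner \<Omega> (f n) h - L2_inner \<Omega> g h) 
        \<le> L2_norm \<Omega> (\<lambda>x. f n x - g x) * L2_norm \<Omega> h" by simp
  qed
  then show ?thesis by (simp add: LIM_zero_iff)
qed

lemma L2_convergent_AE_subseq:
  assumes "\<And>n. f n \<in> L2 \<Omega>" "g \<in> L2 \<Omega>" "(\<lambda>n. L2_norm \<Omega> (\<lambda>x. f n x - g x)) \<longlonglongrightarrow> 0"
  obtains r :: "nat \<Rightarrow> nat" where "strict_mono r" "AE x in lebesgue_on \<Omega>. (\<lambda>n. f (r n) x) \<longlonglongrightarrow> g x"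
proof -
  have "(\<lambda>n. (L2_norm \<Omega> (\<lambda>x. f n x - g x))\<^sup>2) \<longlonglongrightarrow> 0"
    using tendsto_power[OF assms(3), of 2] by simp
  then have "(\<lambda>n. LINT x|lebesgue_on \<Omega>. norm ((norm (f n x - g x))\<^sup>2)) \<longlonglongrightarrow> 0"
    by (simp add: L2_norm_sq_integral)
  moreover have "integrable (lebesgue_on \<Omega>) (\<lambda>x. (norm (f n x - g x))\<^sup>2)" for n
    by (intro L2_integrable_sq L2_diff assms(1,2))
  ultimately obtain r :: "nat \<Rightarrow> nat" where r: "strict_mono r"
    "AE x in lebesgue_on \<Omega>. (\<lambda>n. (norm (f (r n) x - g x))\<^sup>2) \<longlonglongrightarrow> 0"
    using tendsto_L1_AE_subseq[of "lebesgue_on \<Omega>" "\<lambda>n x. (norm (f n x - g x))\<^sup>2"] by blast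
  have "AE x in lebesgue_on \<Omega>. (\<lambda>n. f (r n) x) \<longlonglongrightarrow> g x"
    using r(2)
  proof eventually_elim
    case (elim x)
    from tendsto_real_sqrt[OF elim] have "(\<lambda>n. norm (f (r n) x - g x)) \<longlonglongrightarrow> 0" by simp
    then show ?case by (simp add: LIM_zero_iff tendsto_norm_zero_iff)
  qed
  then show thesis using r(1) that by blast
qed

text \<open>Letting the bounds vary with \<open>n\<close> keeps the sharp constant when they converge, as the norms of the
  gradients of approximating test functions do.\<close>

lemma L2_Fatou:
  assumes f: "\<And>n. f n \<in> L2 \<Omega>" and g: "g \<in> borel_measurable (lebesgue_on \<Omega>)"
    and lim: "AE x in lebesgue_on \<Omega>. (\<lambda>n. f n x) \<longlonglongrightarrow> g x"
    and bound: "\<And>n. L2_norm \<Omega> (f n) \<le> C n" "C \<longlonglongrightarrow> c"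
  shows "g \<in> L2 \<Omega>" "L2_norm \<Omega> g \<le> c"
proof -
  have C0: "0 \<le> C n" for n using bound(1)[of n] L2_norm_nonneg[of \<Omega> "f n"] by linarith
  then have c0: "0 \<le> c" using LIMSEQ_le_const[OF bound(2)] by auto
  have [measurable]: "f n \<in> borel_measurable (lebesgue_on \<Omega>)" for n using f by (rule L2_measurable)
  have "(\<integral>\<^sup>+x. ennreal ((norm (g x))\<^sup>2) \<partial>lebesgue_on \<Omega>)
      = (\<integral>\<^sup>+x. liminf (\<lambda>n. ennreal ((norm (f n x))\<^sup>2)) \<partial>lebesgue_on \<Omega>)"
  proof (rule nn_integral_cong_AE)
    show "AE x in lebesgue_on \<Omega>. ennreal ((norm (g x))\<^sup>2) = liminf (\<lambda>n. ennreal ((norm (f n x))\<^sup>2))"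
      using lim
    proof eventually_elim
      case (elim x)
      then have "(\<lambda>n. ennreal ((norm (f n x))\<^sup>2)) \<longlonglongrightarrow> ennreal ((norm (g x))\<^sup>2)"
        by (intro tendsto_intros)
      from lim_imp_Liminf[OF _ this] show ?case by simp
    qed
  qed
  also have "\<dots> \<le> liminf (\<lambda>n. \<integral>\<^sup>+x. ennreal ((norm (f n x))\<^sup>2) \<partial>lebesgue_on \<Omega>)"
    by (rule nn_integral_liminf) measurable
  also have "\<dots> \<le> liminf (\<lambda>n. ennreal ((C n)\<^sup>2))"
    by (intro Liminf_mono always_eventually allI)
      (simp add: L2_norm_sq_nn_integral[OF f] ennreal_leI power_mono bound(1))
  also have "\<dots> = ennreal (c\<^sup>2)"
    using bound(2) by (intro lim_imp_Liminf tendsto_intros) auto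
  finally have "(\<integral>\<^sup>+x. ennreal ((norm (g x))\<^sup>2) \<partial>lebesgue_on \<Omega>) \<le> ennreal (c\<^sup>2)" .
  then show "g \<in> L2 \<Omega>" "L2_norm \<Omega> g \<le> c"
    using L2_norm_le_nn_integral[OF g c0] by auto
qed


section \<open>Smooth functions and test functions\<close>

text \<open>The recursion is only unfolded through the two rules below; as rewrite rules its equations would
  replace every statement about smoothness by statements about first derivatives.\<close>

declare Ck_on.simps(2) [simp del]

lemma Ck_on_SucI:
  assumes "\<And>x. (f has_derivative f' x) (at x)"
    and "\<And>e. e \<in> Basis \<Longrightarrow> Ck_on k UNIV (\<lambda>x. f' x e)"
  shows "Ck_on (Suc k) UNIV f"
proof -
  have "frechet_derivative f (at x) = f' x" for x
    using frechet_derivative_at[OF assms(1)] by simp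
  then show ?thesis using assms by (auto simp: Ck_on.simps(2) differentiable_def)
qed

lemma Ck_on_SucD:
  assumes "Ck_on (Suc k) UNIV f"
  shows "(f has_derivative frechet_derivative f (at x)) (at x)"
    and "e \<in> Basis \<Longrightarrow> Ck_on k UNIV (\<lambda>x. frechet_derivative f (at x) e)"
  using assms by (auto simp: Ck_on.simps(2) frechet_derivative_works[symmetric])

lemma Ck_on_Suc_imp: "Ck_on (Suc k) UNIV f \<Longrightarrow> Ck_on k UNIV f"
proof (induction k arbitrary: f)
  case 0
  then show ?case
    by (auto intro!: differentiable_imp_continuous_on simp: Ck_on.simps(2) differentiable_on_def)
next
  case (Suc k)
  have "Ck_on k UNIV (\<lambda>x. frechet_derivative f (at x) e)" if "e \<in> Basis" for e
    using Suc.IH[OF Ck_on_SucD(2)[OF Suc.prems that]] .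
  then show ?case using Ck_on_SucD(1)[OF Suc.prems] by (intro Ck_on_SucI)
qed

lemma Ck_on_const: "Ck_on k UNIV (\<lambda>x. c)"
proof (induction k arbitrary: c)
  case (Suc k)
  show ?case by (rule Ck_on_SucI[where f' = "\<lambda>x e. 0"]) (auto simp: Suc)
qed simp

lemma Ck_on_add: "Ck_on k UNIV f \<Longrightarrow> Ck_on k UNIV g \<Longrightarrow> Ck_on k UNIV (\<lambda>x. f x + g x)"
proof (induction k arbitrary: f g)
  case (Suc k)
  show ?case
    by (rule Ck_on_SucI[where f' = "\<lambda>x e. frechet_derivative f (at x) e + frechet_derivative g (at x) e"])
      (intro has_derivative_add Suc.IH Suc.prems[THEN Ck_on_SucD(1)] Suc.prems[THEN Ck_on_SucD(2)]; assumption)+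
qed (auto intro: continuous_on_add)

lemma Ck_on_bounded_linear:
  assumes L: "bounded_linear L"
  shows "Ck_on k UNIV f \<Longrightarrow> Ck_on k UNIV (\<lambda>x. L (f x))"
proof (induction k arbitrary: f)
  case 0
  then show ?case using bounded_linear.continuous_on[OF L] by auto
next
  case (Suc k)
  show ?case
    by (rule Ck_on_SucI[where f' = "\<lambda>x e. L (frechet_derivative f (at x) e)"])
      (intro bounded_linear.has_derivative[OF L] Suc.IH Ck_on_SucD[OF Suc.prems]; assumption)+
qed

lemma Ck_on_mult:
  fixes f g :: "'a::euclidean_space \<Rightarrow> real"
  shows "Ck_on k UNIV f \<Longrightarrow> Ck_on k UNIV g \<Longrightarrow> Ck_on k UNIV (\<lambda>x. f x * g x)"
proof (induction k arbitrary: f g)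
  case (Suc k)
  show ?case
  proof (rule Ck_on_SucI)
    fix x
    show "((\<lambda>x. f x * g x) has_derivative
        (\<lambda>e. f x * frechet_derivative g (at x) e + frechet_derivative f (at x) e * g x)) (at x)"
      using Suc.prems Ck_on_SucD(1) by (intro has_derivative_mult) auto
  next
    fix e :: 'a assume "e \<in> Basis"
    then show "Ck_on k UNIV (\<lambda>x. f x * frechet_derivative g (at x) e + frechet_derivative f (at x) e * g x)"
      using Suc Ck_on_SucD(2) Ck_on_Suc_imp by (intro Ck_on_add Suc.IH) blast+
  qed
qed (auto intro: continuous_on_mult)

lemma Ck_on_affine_real:
  fixes L :: "'a::euclidean_space \<Rightarrow> real" and f :: "real \<Rightarrow> real"
  assumes L: "bounded_linear L"
  shows "Ck_on k UNIV f \<Longrightarrow> Ck_on k UNIV (\<lambda>x. f (L x + d))"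
proof (induction k arbitrary: f)
  case 0
  then show ?case
    by (auto intro!: continuous_on_compose2[of UNIV f] continuous_intros bounded_linear.continuous_on[OF L])
next
  case (Suc k)
  show ?case
  proof (rule Ck_on_SucI)
    fix x
    have "((\<lambda>x. L x + d) has_derivative L) (at x)"
      using bounded_linear_imp_has_derivative[OF L] by (auto intro!: derivative_eq_intros)
    from has_derivative_compose[OF this Ck_on_SucD(1)[OF Suc.prems]]
    have "((\<lambda>x. f (L x + d)) has_derivative (\<lambda>e. frechet_derivative f (at (L x + d)) (L e))) (at x)" .
    moreover have "frechet_derivative f (at (L x + d)) (L e) = L e * frechet_derivative f (at (L x + d)) 1" for e
      using linear_cmul[OF has_derivative_linear[OF Ck_on_SucD(1)[OF Suc.prems]], of "L x + d" "L e" 1]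
      by simp
    ultimately show "((\<lambda>x. f (L x + d)) has_derivative
        (\<lambda>e. L e * frechet_derivative f (at (L x + d)) 1)) (at x)" by simp
  next
    fix e :: 'a
    show "Ck_on k UNIV (\<lambda>x. L e * frechet_derivative f (at (L x + d)) 1)"
      using Suc.IH[OF Ck_on_SucD(2)[OF Suc.prems, of 1]] 
      by (intro Ck_on_mult Ck_on_const) auto
  qed
qed

lemma Ck_on_SucI_real:
  fixes f f' :: "real \<Rightarrow> real"
  assumes "\<And>x. (f has_real_derivative f' x) (at x)" and "Ck_on k UNIV f'"
  shows "Ck_on (Suc k) UNIV f"
  by (rule Ck_on_SucI[where f' = "\<lambda>x e. f' x * e"])
    (use assms in \<open>auto simp: has_field_derivative_def\<close>)

lemma Cinf_on_const: "Cinf_on UNIV (\<lambda>x. c)"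
  by (simp add: Cinf_on_def Ck_on_const)

lemma Cinf_on_add: "Cinf_on UNIV f \<Longrightarrow> Cinf_on UNIV g \<Longrightarrow> Cinf_on UNIV (\<lambda>x. f x + g x)"
  by (simp add: Cinf_on_def Ck_on_add)

lemma Cinf_on_mult:
  fixes f g :: "'a::euclidean_space \<Rightarrow> real"
  shows "Cinf_on UNIV f \<Longrightarrow> Cinf_on UNIV g \<Longrightarrow> Cinf_on UNIV (\<lambda>x. f x * g x)"
  by (simp add: Cinf_on_def Ck_on_mult)

lemma Cinf_on_bounded_linear:
  "bounded_linear L \<Longrightarrow> Cinf_on UNIV f \<Longrightarrow> Cinf_on UNIV (\<lambda>x. L (f x))"
  by (simp add: Cinf_on_def Ck_on_bounded_linear)

lemma Cinf_on_diff: "Cinf_on UNIV f \<Longrightarrow> Cinf_on UNIV g \<Longrightarrow> Cinf_on UNIV (\<lambda>x. f x - g x)"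
  using Cinf_on_add[of f "\<lambda>x. - g x"] Cinf_on_bounded_linear[OF bounded_linear_minus[OF bounded_linear_ident]]
  by auto

lemma Cinf_on_affine_real:
  fixes L :: "'a::euclidean_space \<Rightarrow> real" and f :: "real \<Rightarrow> real"
  shows "bounded_linear L \<Longrightarrow> Cinf_on UNIV f \<Longrightarrow> Cinf_on UNIV (\<lambda>x. f (L x + d))"
  by (simp add: Cinf_on_def Ck_on_affine_real)

lemma Cinf_on_prod:
  fixes f :: "'i \<Rightarrow> 'a::euclidean_space \<Rightarrow> real"
  shows "(\<And>i. i \<in> I \<Longrightarrow> Cinf_on UNIV (f i)) \<Longrightarrow> Cinf_on UNIV (\<lambda>x. \<Prod>i\<in>I. f i x)"
  by (induction I rule: infinite_finite_induct) (auto intro: Cinf_on_mult Cinf_on_const)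

lemma Cinf_on_power:
  fixes f :: "'a::euclidean_space \<Rightarrow> real"
  shows "Cinf_on UNIV f \<Longrightarrow> Cinf_on UNIV (\<lambda>x. f x ^ n)"
  by (induction n) (auto intro: Cinf_on_mult Cinf_on_const)

lemma Cinf_on_antiderivative:
  fixes f f' :: "real \<Rightarrow> real"
  assumes "\<And>x. (f has_real_derivative f' x) (at x)" and "Cinf_on UNIV f'"
  shows "Cinf_on UNIV f"
  unfolding Cinf_on_def
proof
  fix k show "Ck_on k UNIV f"
    using Ck_on_Suc_imp[OF Ck_on_SucI_real[OF assms(1)]] assms(2) by (auto simp: Cinf_on_def)
qed

lemma Cinf_on_has_derivative:
  "Cinf_on UNIV f \<Longrightarrow> (f has_derivative frechet_derivative f (at x)) (at x)"
  unfolding Cinf_on_def by (blast intro: Ck_on_SucD(1))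

lemma Cinf_on_continuous: "Cinf_on UNIV f \<Longrightarrow> continuous_on UNIV f"
  unfolding Cinf_on_def using Ck_on.simps(1) by blast

lemma Cinf_on_continuous_deriv:
  "Cinf_on UNIV f \<Longrightarrow> e \<in> Basis \<Longrightarrow> continuous_on UNIV (\<lambda>x. frechet_derivative f (at x) e)"
  unfolding Cinf_on_def using Ck_on_SucD(2)[of 0 f e] by simp

subsection \<open>Bump functions\<close>

text \<open>Differentiating \<open>exp (- 1 / x)\<close> only produces combinations of the functions below with
  other exponents, and each of them tends to 0 at the origin.\<close>

definition flat_exp :: "nat \<Rightarrow> real \<Rightarrow> real" where
  "flat_exp n x = (if 0 < x then exp (- (1 / x)) / x ^ n else 0)"

lemma flat_exp_tendsto_0: "(flat_exp n \<longlongrightarrow> 0) (at 0)"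
proof -
  have "((\<lambda>y::real. y ^ n / exp y) \<longlongrightarrow> 0) at_top" by (rule tendsto_power_div_exp_0)
  then have "((\<lambda>x::real. (inverse x) ^ n / exp (inverse x)) \<longlongrightarrow> 0) (at_right 0)"
    by (rule filterlim_compose[OF _ filterlim_inverse_at_top_right])
  moreover have "\<forall>\<^sub>F x::real in at_right 0. (inverse x) ^ n / exp (inverse x) = flat_exp n x"
    by (rule eventually_at_rightI[of 0 1])
      (auto simp: flat_exp_def exp_minus field_simps power_inverse)
  ultimately have r: "(flat_exp n \<longlongrightarrow> 0) (at_right 0)" using Lim_transform_eventually by blast
  have "\<forall>\<^sub>F x::real in at_left 0. 0 = flat_exp n x"
    by (rule eventually_at_leftI[of "-1" 0]) (auto simp: flat_exp_def)
  then have "(flat_exp n \<longlongrightarrow> 0) (at_left 0)" using Lim_transform_eventually tendsto_const by blast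
  with r show ?thesis by (simp add: filterlim_at_split)
qed

lemma flat_exp_has_derivative:
  "(flat_exp n has_real_derivative (flat_exp (n + 2) x - real n * flat_exp (n + 1) x)) (at x)"
proof (cases x "0::real" rule: linorder_cases)
  case less
  have "((\<lambda>x. 0) has_real_derivative 0) (at x)" by simp
  then have "(flat_exp n has_real_derivative 0) (at x)"
    by (rule has_field_derivative_transform_within_open[where S = "{..<0}"])
      (use less in \<open>auto simp: flat_exp_def\<close>)
  then show ?thesis using less by (simp add: flat_exp_def)
next
  case equal
  have "((\<lambda>h. (flat_exp n (0 + h) - flat_exp n 0) / h) \<longlongrightarrow> 0) (at 0)"
  proof (rule Lim_transform_eventually[OF flat_exp_tendsto_0[of "Suc n"]])
    show "\<forall>\<^sub>F h in at 0. flat_exp (Suc n) h = (flat_exp n (0 + h) - flat_exp n 0) / h"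
      by (auto simp: flat_exp_def eventually_at_filter field_simps)
  qed
  then have "(flat_exp n has_real_derivative 0) (at 0)" by (simp add: has_field_derivative_iff)
  then show ?thesis using equal by (simp add: flat_exp_def)
next
  case greater
  have "((\<lambda>x. exp (- (1 / x)) / x ^ n) has_real_derivative
      ((exp (- (1 / x)) * (1 / x\<^sup>2)) * x ^ n - exp (- (1 / x)) * (real n * x ^ (n - 1))) / (x ^ n * x ^ n)) (at x)"
    using greater by (auto intro!: derivative_eq_intros simp: power2_eq_square field_simps)
  also have "((exp (- (1 / x)) * (1 / x\<^sup>2)) * x ^ n - exp (- (1 / x)) * (real n * x ^ (n - 1))) / (x ^ n * x ^ n)
      = flat_exp (n + 2) x - real n * flat_exp (n + 1) x"
    using greater by (cases n) (auto simp: flat_exp_def field_simps power2_eq_square)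
  finally show ?thesis
    by (rule has_field_derivative_transform_within_open[where S = "{0<..}"])
      (use greater in \<open>auto simp: flat_exp_def\<close>)
qed

lemma Cinf_on_flat_exp: "Cinf_on UNIV (flat_exp n)"
  unfolding Cinf_on_def
proof
  fix k show "Ck_on k UNIV (flat_exp n)"
  proof (induction k arbitrary: n)
    case 0
    show ?case 
      using flat_exp_has_derivative by (auto intro!: continuous_at_imp_continuous_on DERIV_isCont)
  next
    case (Suc k)
    have "Ck_on k UNIV (\<lambda>x. flat_exp (n + 2) x + (- real n) * flat_exp (n + 1) x)"
      by (intro Ck_on_add Ck_on_mult Ck_on_const Suc)
    then show ?case using flat_exp_has_derivative by (intro Ck_on_SucI_real) auto
  qed
qed

definition bump :: "real \<Rightarrow> real \<Rightarrow> real \<Rightarrow> real" where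
  "bump a b x = flat_exp 0 (x - a) * flat_exp 0 (b - x)"

lemma Cinf_on_bump: "Cinf_on UNIV (bump a b)"
proof -
  have "Cinf_on UNIV (\<lambda>x. flat_exp 0 (x + (- a)) * flat_exp 0 (- x + b))"
    by (intro Cinf_on_mult Cinf_on_affine_real bounded_linear_ident bounded_linear_minus Cinf_on_flat_exp)
  then show ?thesis by (simp add: bump_def[abs_def] algebra_simps)
qed

lemma bump_bounds: "0 \<le> bump a b x" "bump a b x \<le> 1" "0 < bump a b x \<longleftrightarrow> a < x \<and> x < b"
  by (auto simp: bump_def flat_exp_def intro!: mult_le_one)

definition box_bump :: "real^3 \<Rightarrow> real^3 \<Rightarrow> real^3 \<Rightarrow> real" where
  "box_bump a b x = (\<Prod>i\<in>UNIV. bump (a $ i) (b $ i) (x $ i))"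

lemma Cinf_on_box_bump: "Cinf_on UNIV (box_bump a b)"
  unfolding box_bump_def[abs_def]
proof (rule Cinf_on_prod)
  fix i :: 3
  show "Cinf_on UNIV (\<lambda>x. bump (a $ i) (b $ i) (x $ i))"
    using Cinf_on_affine_real[OF bounded_linear_vec_nth[of i] Cinf_on_bump, where d = 0] by simp
qed

lemma box_bump_bounds:
  "0 \<le> box_bump a b x" "box_bump a b x \<le> 1" "0 < box_bump a b x \<longleftrightarrow> x \<in> box a b"
proof -
  show "0 \<le> box_bump a b x" "box_bump a b x \<le> 1"
    by (auto simp: box_bump_def bump_bounds intro!: prod_nonneg prod_le_1)
  show "0 < box_bump a b x \<longleftrightarrow> x \<in> box a b"
  proof
    assume "x \<in> box a b"
    then show "0 < box_bump a b x"
      by (auto simp: box_bump_def mem_box_cart bump_bounds(3) intro!: prod_pos)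
  next
    assume *: "0 < box_bump a b x"
    have "bump (a $ i) (b $ i) (x $ i) \<noteq> 0" for i
      using * unfolding box_bump_def by (metis finite iso_tuple_UNIV_I less_irrefl prod_zero_iff)
    then have "0 < bump (a $ i) (b $ i) (x $ i)" for i
      using bump_bounds(1) less_eq_real_def by metis
    then show "x \<in> box a b" by (auto simp: mem_box_cart bump_bounds(3))
  qed
qed

subsection \<open>Test functions\<close>

lemma test_functionsI:
  "Cinf_on UNIV \<phi> \<Longrightarrow> compact K \<Longrightarrow> K \<subseteq> S \<Longrightarrow> (\<And>x. x \<notin> K \<Longrightarrow> \<phi> x = 0) \<Longrightarrow> \<phi> \<in> test_functions S"
  by (auto simp: test_functions_def)

lemma test_functions_mono:
  assumes "\<phi> \<in> test_functions S" "S \<subseteq> T"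
  shows "\<phi> \<in> test_functions T"
proof -
  obtain K where K: "Cinf_on UNIV \<phi>" "compact K" "K \<subseteq> S" "\<And>x. x \<notin> K \<Longrightarrow> \<phi> x = 0"
    using assms(1) unfolding test_functions_def by blast
  then show ?thesis using test_functionsI[OF K(1,2) order_trans[OF K(3) assms(2)] K(4)] by blast
qed

lemma test_functions_Cinf: "\<phi> \<in> test_functions S \<Longrightarrow> Cinf_on UNIV \<phi>"
  by (auto simp: test_functions_def)

lemma test_functions_add:
  assumes "\<phi> \<in> test_functions S" "\<psi> \<in> test_functions S"
  shows "(\<lambda>x. \<phi> x + \<psi> x) \<in> test_functions S"
proof -
  obtain K where K: "Cinf_on UNIV \<phi>" "compact K" "K \<subseteq> S" "\<And>x. x \<notin> K \<Longrightarrow> \<phi> x = 0"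
    using assms(1) unfolding test_functions_def by blast
  obtain L where L: "Cinf_on UNIV \<psi>" "compact L" "L \<subseteq> S" "\<And>x. x \<notin> L \<Longrightarrow> \<psi> x = 0"
    using assms(2) unfolding test_functions_def by blast
  show ?thesis
    by (rule test_functionsI[where K = "K \<union> L"])
      (use K L in \<open>simp_all add: Cinf_on_add compact_Un\<close>)
qed

lemma test_functions_bounded_linear:
  assumes "bounded_linear L" "\<phi> \<in> test_functions S"
  shows "(\<lambda>x. L (\<phi> x)) \<in> test_functions S"
proof -
  obtain K where K: "Cinf_on UNIV \<phi>" "compact K" "K \<subseteq> S" "\<And>x. x \<notin> K \<Longrightarrow> \<phi> x = 0"
    using assms(2) unfolding test_functions_def by blast
  show ?thesis
    by (rule test_functionsI[OF Cinf_on_bounded_linear[OF assms(1) K(1)] K(2,3)])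
      (simp add: K(4) linear_0 bounded_linear.linear[OF assms(1)])
qed

lemma test_functions_mult:
  fixes \<phi> \<psi> :: "'a::euclidean_space \<Rightarrow> real"
  assumes "\<phi> \<in> test_functions S" "Cinf_on UNIV \<psi>"
  shows "(\<lambda>x. \<phi> x * \<psi> x) \<in> test_functions S"
proof -
  obtain K where K: "Cinf_on UNIV \<phi>" "compact K" "K \<subseteq> S" "\<And>x. x \<notin> K \<Longrightarrow> \<phi> x = 0"
    using assms(1) unfolding test_functions_def by blast
  show ?thesis
    by (rule test_functionsI[OF Cinf_on_mult[OF K(1) assms(2)] K(2,3)]) (simp add: K(4))
qed

lemma test_functions_scaleR: "\<phi> \<in> test_functions S \<Longrightarrow> (\<lambda>x. c *\<^sub>R \<phi> x) \<in> test_functions S"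
  by (rule test_functions_bounded_linear[OF bounded_linear_scaleR_right])

lemma test_functions_diff:
  assumes "\<phi> \<in> test_functions S" "\<psi> \<in> test_functions S"
  shows "(\<lambda>x. \<phi> x - \<psi> x) \<in> test_functions S"
  using test_functions_add[OF assms(1) test_functions_scaleR[OF assms(2), of "-1"]] by simp

lemma test_functions_zero: "(\<lambda>x. 0) \<in> test_functions S"
  by (rule test_functionsI[where K = "{}"]) (auto simp: Cinf_on_const)

lemma frechet_derivative_outside_support:
  fixes \<phi> :: "'a::euclidean_space \<Rightarrow> 'b::real_normed_vector"
  assumes "closed K" "\<And>x. x \<notin> K \<Longrightarrow> \<phi> x = 0" "x \<notin> K"
  shows "frechet_derivative \<phi> (at x) = (\<lambda>e. 0)"
proof -
  have "((\<lambda>x. 0) has_derivative (\<lambda>e. 0)) (at x)" by simp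
  then have "(\<phi> has_derivative (\<lambda>e. 0)) (at x)"
    by (rule has_derivative_transform_within_open[where s = "- K"]) (use assms in auto)
  then show ?thesis by (rule frechet_derivative_at[symmetric])
qed

lemma jac_nth: "jac \<phi> x $ i $ j = frechet_derivative \<phi> (at x) (axis j 1) $ i"
  by (simp add: jac_def matrix_def)

lemma jac_add:
  assumes "Cinf_on UNIV \<phi>" "Cinf_on UNIV \<psi>"
  shows "jac (\<lambda>x. \<phi> x + \<psi> x) x = jac \<phi> x + jac \<psi> x"
proof -
  have "frechet_derivative (\<lambda>x. \<phi> x + \<psi> x) (at x) =
      (\<lambda>e. frechet_derivative \<phi> (at x) e + frechet_derivative \<psi> (at x) e)"
    by (rule frechet_derivative_at[OF has_derivative_add[OF assms[THEN Cinf_on_has_derivative]], symmetric])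
  then show ?thesis by (simp add: vec_eq_iff jac_nth)
qed

lemma jac_scaleR:
  assumes "Cinf_on UNIV \<phi>"
  shows "jac (\<lambda>x. c *\<^sub>R \<phi> x) x = c *\<^sub>R jac \<phi> x"
proof -
  have "frechet_derivative (\<lambda>x. c *\<^sub>R \<phi> x) (at x) = (\<lambda>e. c *\<^sub>R frechet_derivative \<phi> (at x) e)"
    by (rule frechet_derivative_at[OF has_derivative_scaleR_right[OF Cinf_on_has_derivative[OF assms]], symmetric])
  then show ?thesis by (simp add: vec_eq_iff jac_nth)
qed

lemma jac_diff:
  assumes "Cinf_on UNIV \<phi>" "Cinf_on UNIV \<psi>"
  shows "jac (\<lambda>x. \<phi> x - \<psi> x) x = jac \<phi> x - jac \<psi> x"
proof -
  have "frechet_derivative (\<lambda>x. \<phi> x - \<psi> x) (at x) =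
      (\<lambda>e. frechet_derivative \<phi> (at x) e - frechet_derivative \<psi> (at x) e)"
    by (rule frechet_derivative_at[OF has_derivative_diff[OF assms[THEN Cinf_on_has_derivative]], symmetric])
  then show ?thesis by (simp add: vec_eq_iff jac_nth)
qed

lemma continuous_on_jac: "Cinf_on UNIV \<phi> \<Longrightarrow> continuous_on UNIV (jac \<phi>)"
proof -
  assume *: "Cinf_on UNIV \<phi>"
  have "continuous_on UNIV (\<lambda>x. \<chi> i. \<chi> j. frechet_derivative \<phi> (at x) (axis j 1) $ i)"
    by (intro continuous_on_vec_lambda continuous_on_component Cinf_on_continuous_deriv[OF *])
      (auto simp: axis_in_Basis_iff)
  also have "(\<lambda>x. \<chi> i. \<chi> j. frechet_derivative \<phi> (at x) (axis j 1) $ i) = jac \<phi>"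
    by (auto simp: vec_eq_iff jac_nth fun_eq_iff)
  finally show ?thesis .
qed

lemma continuous_on_grad: "Cinf_on UNIV \<phi> \<Longrightarrow> continuous_on UNIV (grad \<phi>)"
  unfolding grad_def[abs_def]
  by (intro continuous_on_vec_lambda Cinf_on_continuous_deriv) (auto simp: axis_in_Basis_iff)

lemma continuous_compact_support_L2:
  fixes f :: "real^3 \<Rightarrow> 'b::euclidean_space"
  assumes "open \<Omega>" "continuous_on UNIV f" "compact K" "K \<subseteq> \<Omega>" "\<And>x. x \<notin> K \<Longrightarrow> f x = 0"
  shows "f \<in> L2 \<Omega>"
proof -
  have m: "f \<in> borel_measurable lebesgue"
    using assms(2) by (intro measurable_completion) (simp add: borel_measurable_continuous_onI)
  have "continuous_on K (\<lambda>x. (norm (f x))\<^sup>2)"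
    by (intro continuous_intros continuous_on_subset[OF assms(2)]) auto
  from borel_integrable_compact[OF assms(3) this]
  have "integrable lborel (\<lambda>x. indicator K x *\<^sub>R (norm (f x))\<^sup>2)" .
  also have "(\<lambda>x. indicator K x *\<^sub>R (norm (f x))\<^sup>2) = (\<lambda>x. indicator \<Omega> x *\<^sub>R (norm (f x))\<^sup>2)"
    using assms(4,5) by (auto simp: fun_eq_iff indicator_def)
  finally have "integrable lebesgue (\<lambda>x. indicator \<Omega> x *\<^sub>R (norm (f x))\<^sup>2)"
    by (intro integrable_completion[THEN iffD2]) (use assms(1,2) in \<open>auto intro: borel_measurable_continuous_onI\<close>)
  then have "integrable (lebesgue_on \<Omega>) (\<lambda>x. (norm (f x))\<^sup>2)"
    using assms(1) by (subst integrable_restrict_space) auto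
  then show ?thesis using m by (auto simp: L2_def intro: measurable_restrict_space1)
qed

lemma test_functions_L2:
  fixes \<phi> :: "real^3 \<Rightarrow> 'b::euclidean_space"
  assumes "open \<Omega>" "\<phi> \<in> test_functions \<Omega>"
  shows "\<phi> \<in> L2 \<Omega>"
proof -
  obtain K where K: "Cinf_on UNIV \<phi>" "compact K" "K \<subseteq> \<Omega>" "\<And>x. x \<notin> K \<Longrightarrow> \<phi> x = 0"
    using assms(2) unfolding test_functions_def by blast
  show ?thesis by (rule continuous_compact_support_L2[OF assms(1) Cinf_on_continuous[OF K(1)] K(2-4)])
qed

lemma jac_outside_support:
  assumes "closed K" "\<And>x. x \<notin> K \<Longrightarrow> \<phi> x = 0" "x \<notin> K" shows "jac \<phi> x = 0"
  using frechet_derivative_outside_support[of K \<phi> x, OF assms] by (simp add: vec_eq_iff jac_nth)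

lemma jac_test_L2:
  assumes "open \<Omega>" "\<phi> \<in> test_functions \<Omega>"
  shows "jac \<phi> \<in> L2 \<Omega>"
proof -
  obtain K where K: "Cinf_on UNIV \<phi>" "compact K" "K \<subseteq> \<Omega>" "\<And>x. x \<notin> K \<Longrightarrow> \<phi> x = 0"
    using assms(2) unfolding test_functions_def by blast
  show ?thesis
    by (rule continuous_compact_support_L2[OF assms(1) continuous_on_jac[OF K(1)] K(2,3)])
      (rule jac_outside_support[OF compact_imp_closed[OF K(2)] K(4)])
qed

lemma grad_test_L2:
  assumes "open \<Omega>" "\<phi> \<in> test_functions \<Omega>"
  shows "grad \<phi> \<in> L2 \<Omega>"
proof -
  obtain K where K: "Cinf_on UNIV \<phi>" "compact K" "K \<subseteq> \<Omega>" "\<And>x. x \<notin> K \<Longrightarrow> \<phi> x = 0"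
    using assms(2) unfolding test_functions_def by blast
  have "grad \<phi> x = 0" if "x \<notin> K" for x
    using frechet_derivative_outside_support[of K \<phi> x, OF compact_imp_closed[OF K(2)] K(4) that]
    by (simp add: grad_def vec_eq_iff)
  then show ?thesis
    by (rule continuous_compact_support_L2[OF assms(1) continuous_on_grad[OF K(1)] K(2,3)])
qed

section \<open>The fundamental lemma of the calculus of variations and weak derivatives\<close>

text \<open>For a countable family of boxes with bump functions \<open>\<rho>\<^sub>i\<close> that together cover \<open>U\<close>,
  the functions \<open>1 - (\<Prod>i<n. (1 - \<rho>\<^sub>i)\<^sup>n)\<close> stay in \<open>[0, 1]\<close> and increase to 1 exactly where some
  \<open>\<rho>\<^sub>i\<close> is positive. This gives smooth approximations of the indicator without mollification.\<close>

lemma open_indicator_limit_of_test_functions: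
  fixes U :: "(real^3) set"
  assumes "open U"
  obtains \<phi> where "\<And>n::nat. \<phi> n \<in> test_functions U" "\<And>n x. 0 \<le> \<phi> n x" "\<And>n x. \<phi> n x \<le> (1::real)"
    "\<And>x. (\<lambda>n. \<phi> n x) \<longlonglongrightarrow> indicator U x"
proof (cases "U = {}")
  case True
  then show thesis using that[of "\<lambda>n x. 0"] by (auto intro: test_functions_zero)
next
  case False
  define P where "P = {(a, b). cbox a b \<subseteq> U}"
  have cover: "\<exists>p\<in>P. x \<in> box (fst p) (snd p)" if xU: "x \<in> U" for x
  proof -
    obtain a b where "cbox a b \<subseteq> U" "x \<in> box a b" by (rule open_contains_cbox[OF assms xU])
    then show ?thesis by (intro bexI[of _ "(a, b)"]) (simp_all add: P_def)
  qed
  obtain \<F> where "\<F> \<subseteq> (\<lambda>p. box (fst p) (snd p)) ` P" "countable \<F>" 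
      "\<Union>\<F> = (\<Union>p\<in>P. box (fst p) (snd p))"
    by (rule Lindelof[of "(\<lambda>p. box (fst p) (snd p)) ` P"]) auto
  then obtain Q where Q: "Q \<subseteq> P" "countable Q" 
      "(\<Union>p\<in>Q. box (fst p) (snd p)) = (\<Union>p\<in>P. box (fst p) (snd p))"
    using countable_subset_image[of \<F> "\<lambda>p. box (fst p) (snd p)" P] by auto
  have "Q \<noteq> {}" using False cover Q(3) by fastforce
  then obtain e :: "nat \<Rightarrow> (real^3) \<times> (real^3)" where e: "range e = Q"
    using Q(2) uncountable_def by blast
  have eP: "cbox (fst (e i)) (snd (e i)) \<subseteq> U" for i
  proof -
    have "e i \<in> P" using e Q(1) by blast
    then show ?thesis by (simp add: P_def case_prod_beta)
  qed
  have ecover: "\<exists>i. x \<in> box (fst (e i)) (snd (e i))" if "x \<in> U" for x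
    using cover[OF that] Q(3) e by blast
  define \<rho> where "\<rho> i = box_bump (fst (e i)) (snd (e i))" for i
  have \<rho>: "0 \<le> \<rho> i x" "\<rho> i x \<le> 1" for i x by (simp_all add: \<rho>_def box_bump_bounds)
  have \<rho>0: "\<rho> i x = 0" if "x \<notin> box (fst (e i)) (snd (e i))" for i x
    using that box_bump_bounds(1,3)[of "fst (e i)" "snd (e i)" x] by (simp add: \<rho>_def less_eq_real_def)
  define \<phi> where "\<phi> n x = 1 - (\<Prod>i<n. (1 - \<rho> i x) ^ n)" for n x
  have "\<phi> n \<in> test_functions U" for n
  proof (rule test_functionsI[where K = "\<Union>i<n. cbox (fst (e i)) (snd (e i))"])
    show "Cinf_on UNIV (\<phi> n)"
      unfolding \<phi>_def \<rho>_def 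
      by (intro Cinf_on_diff Cinf_on_const Cinf_on_prod Cinf_on_power Cinf_on_box_bump)
    show "\<phi> n x = 0" if "x \<notin> (\<Union>i<n. cbox (fst (e i)) (snd (e i)))" for x
    proof -
      have "\<rho> i x = 0" if "i < n" for i
        using that \<open>x \<notin> _\<close> box_subset_cbox[of "fst (e i)" "snd (e i)"] by (intro \<rho>0) blast
      then show ?thesis by (simp add: \<phi>_def)
    qed
  qed (use eP in \<open>auto intro!: compact_UN\<close>)
  moreover have p01: "0 \<le> (\<Prod>i<n. (1 - \<rho> i x) ^ n)" "(\<Prod>i<n. (1 - \<rho> i x) ^ n) \<le> 1" for n x
    using \<rho> by (auto intro!: prod_nonneg prod_le_1 power_le_one)
  moreover have "(\<lambda>n. \<phi> n x) \<longlonglongrightarrow> indicator U x" for x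
  proof (cases "x \<in> U")
    case True
    then obtain j where j: "x \<in> box (fst (e j)) (snd (e j))" using ecover by blast
    have pos: "0 < \<rho> j x" using j by (simp add: \<rho>_def box_bump_bounds)
    have "(\<lambda>n. \<Prod>i<n. (1 - \<rho> i x) ^ n) \<longlonglongrightarrow> 0"
    proof (rule Lim_null_comparison)
      show "(\<lambda>n. (1 - \<rho> j x) ^ n) \<longlonglongrightarrow> 0" using pos \<rho> by (intro LIMSEQ_power_zero) auto
      have "(\<Prod>i<n. (1 - \<rho> i x) ^ n) \<le> (1 - \<rho> j x) ^ n" if "n > j" for n
      proof -
        have "(\<Prod>i<n. (1 - \<rho> i x) ^ n) = (1 - \<rho> j x) ^ n * (\<Prod>i\<in>{..<n} - {j}. (1 - \<rho> i x) ^ n)"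
          using that by (intro prod.remove) auto
        also have "\<dots> \<le> (1 - \<rho> j x) ^ n * 1"
          using \<rho> by (intro mult_left_mono prod_le_1) (auto intro: power_le_one)
        finally show ?thesis by simp
      qed
      then show "\<forall>\<^sub>F n in sequentially. norm (\<Prod>i<n. (1 - \<rho> i x) ^ n) \<le> (1 - \<rho> j x) ^ n"
        using p01 by (intro eventually_sequentiallyI[of "Suc j"]) simp
    qed
    from tendsto_diff[OF tendsto_const this, of 1] show ?thesis using True by (simp add: \<phi>_def)
  next
    case False
    then have "\<rho> i x = 0" for i using eP[of i] box_subset_cbox[of "fst (e i)" "snd (e i)"] by (intro \<rho>0) blast
    then show ?thesis using False by (simp add: \<phi>_def)
  qed
  ultimately show thesis using that[of \<phi>] by (simp add: \<phi>_def)
qed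

locale bounded_open_set =
  fixes \<Omega> :: "(real^3) set"
  assumes open_Omega: "open \<Omega>" and bounded_Omega: "bounded \<Omega>"
begin

lemma Omega_sets [simp]: "\<Omega> \<in> sets lebesgue"
  using open_Omega by auto

text \<open>Pairing with smooth approximations of indicators shows that the integral of \<open>g\<close> over every
  open subset vanishes, then over every \<open>G\<^sub>\<delta>\<close> set, and finally over the set where \<open>g > 0\<close>.\<close>

lemma fundamental_lemma_nonpos:
  assumes g: "integrable (lebesgue_on \<Omega>) g"
    and zero: "\<And>\<phi>. \<phi> \<in> test_functions \<Omega> \<Longrightarrow> (LINT x|lebesgue_on \<Omega>. g x * \<phi> x) = 0"
  shows "AE x in lebesgue_on \<Omega>. g x \<le> (0::real)"
proof -
  let ?M = "lebesgue_on \<Omega>"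
  have [measurable]: "g \<in> borel_measurable ?M" using g by auto
  have ind: "indicator A \<in> borel_measurable ?M" if "A \<in> sets lebesgue" for A :: "(real^3) set"
    using that by (intro measurable_restrict_space1) auto
  have dom: "(LINT x|?M. g x * h x) = 0"
    if h: "\<And>n. h' n \<in> borel_measurable ?M" "h \<in> borel_measurable ?M"
      "\<And>x. (\<lambda>n. h' n x) \<longlonglongrightarrow> h x" "\<And>n x. \<bar>h' n x\<bar> \<le> 1" "\<And>n. (LINT x|?M. g x * h' n x) = 0"
    for h' :: "nat \<Rightarrow> real^3 \<Rightarrow> real" and h
  proof -
    have "(\<lambda>n. LINT x|?M. g x * h' n x) \<longlonglongrightarrow> (LINT x|?M. g x * h x)"
    proof (rule integral_dominated_convergence[where w = "\<lambda>x. \<bar>g x\<bar>"])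
      show "(\<lambda>x. g x * h x) \<in> borel_measurable ?M" "(\<lambda>x. g x * h' n x) \<in> borel_measurable ?M" for n
        using h(1,2) by measurable
      show "integrable ?M (\<lambda>x. \<bar>g x\<bar>)" using g by simp
      show "AE x in ?M. (\<lambda>n. g x * h' n x) \<longlonglongrightarrow> g x * h x" using h(3) by (intro AE_I2 tendsto_mult_left)
      show "AE x in ?M. norm (g x * h' n x) \<le> \<bar>g x\<bar>" for n
        using h(4) by (intro AE_I2) (simp add: abs_mult mult_left_le)
    qed
    then show ?thesis using h(5) LIMSEQ_unique[OF _ tendsto_const] by fastforce
  qed
  have open_zero: "(LINT x|?M. g x * indicator U x) = 0" if U: "open U" "U \<subseteq> \<Omega>" for U
  proof -
    obtain \<phi> where \<phi>: "\<And>n::nat. \<phi> n \<in> test_functions U" "\<And>n x. 0 \<le> \<phi> n x" "\<And>n x. \<phi> n x \<le> (1::real)"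
      "\<And>x. (\<lambda>n. \<phi> n x) \<longlonglongrightarrow> indicator U x"
      using open_indicator_limit_of_test_functions[OF U(1)] by metis
    have t: "\<phi> n \<in> test_functions \<Omega>" for n by (rule test_functions_mono[OF \<phi>(1) U(2)])
    show ?thesis
    proof (rule dom[of \<phi>])
      show "\<phi> n \<in> borel_measurable ?M" for n by (rule L2_measurable[OF test_functions_L2[OF open_Omega t]])
      show "(LINT x|?M. g x * \<phi> n x) = 0" for n by (rule zero[OF t])
      show "indicator U \<in> borel_measurable ?M" using U by (intro ind) auto
    qed (use \<phi> in \<open>auto simp: abs_le_iff intro: order_trans[of _ 0]\<close>)
  qed
  define E where "E = {x \<in> \<Omega>. 0 < g x}"
  have "{x \<in> space ?M. 0 < g x} \<in> sets ?M" by measurable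
  then have EM: "E \<in> sets ?M" by (simp add: E_def)
  then have E: "E \<in> sets lebesgue" by (simp add: sets_restrict_space_iff)
  obtain C T where CT: "gdelta C" "T \<in> null_sets lebesgue" "E \<union> T = C" "disjnt E T"
    using lebesgue_set_almost_gdelta[OF E] by blast
  obtain F where F: "\<And>n::nat. open (F n)" "C = \<Inter>(F ` UNIV)" using CT(1) by (auto elim: gdelta.cases)
  have C: "C \<in> sets lebesgue" using F by auto
  have "(LINT x|?M. g x * indicator (\<Omega> \<inter> C) x) = 0"
  proof (rule dom[of "\<lambda>n. indicator (\<Omega> \<inter> (\<Inter>i\<le>n. F i))"])
    have op: "open (\<Omega> \<inter> (\<Inter>i\<le>n. F i))" for n using F(1) open_Omega by (intro open_Int open_INT) auto
    show "indicator (\<Omega> \<inter> (\<Inter>i\<le>n. F i)) \<in> borel_measurable ?M" for n using op by (intro ind) auto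
    show "(LINT x|?M. g x * indicator (\<Omega> \<inter> (\<Inter>i\<le>n. F i)) x) = 0" for n by (rule open_zero[OF op]) auto
    show "indicator (\<Omega> \<inter> C) \<in> borel_measurable ?M" using C by (intro ind) auto
    show "(\<lambda>n. indicator (\<Omega> \<inter> (\<Inter>i\<le>n. F i)) x :: real) \<longlonglongrightarrow> indicator (\<Omega> \<inter> C) x" for x
    proof (cases "x \<in> \<Omega> \<inter> C")
      case True
      then have "indicator (\<Omega> \<inter> (\<Inter>i\<le>n. F i)) x = (1::real)" for n using F(2) by auto
      then show ?thesis using True by simp
    next
      case False
      then consider "x \<notin> \<Omega>" | j where "x \<notin> F j" using F(2) by blast
      then have "\<exists>j. \<forall>n\<ge>j. x \<notin> \<Omega> \<inter> (\<Inter>i\<le>n. F i)" by cases auto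
      then obtain j where "\<And>n. n \<ge> j \<Longrightarrow> indicator (\<Omega> \<inter> (\<Inter>i\<le>n. F i)) x = (0::real)" by (auto simp: indicator_def)
      then have "\<forall>\<^sub>F n in sequentially. indicator (\<Omega> \<inter> (\<Inter>i\<le>n. F i)) x = (0::real)"
        by (intro eventually_sequentiallyI)
      then show ?thesis using False by (simp add: tendsto_eventually)
    qed
  qed (auto simp: indicator_def)
  moreover have "AE x in ?M. x \<notin> T"
    using AE_not_in[OF CT(2)] by (subst AE_restrict_space_iff) (auto elim: eventually_mono)
  then have "AE x in ?M. g x * indicator (\<Omega> \<inter> C) x = g x * indicator E x"
    by eventually_elim (use CT(3) in \<open>auto simp: indicator_def E_def\<close>)
  then have "(LINT x|?M. g x * indicator (\<Omega> \<inter> C) x) = (LINT x|?M. g x * indicator E x)"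
    using ind[OF E] ind[OF sets.Int[OF Omega_sets C]] by (intro integral_cong_AE borel_measurable_times) auto
  ultimately have "(LINT x|?M. g x * indicator E x) = 0" by simp
  moreover have "integrable ?M (\<lambda>x. g x * indicator E x)"
    using integrable_real_mult_indicator[OF EM g] .
  moreover have "AE x in ?M. 0 \<le> g x * indicator E x" by (intro AE_I2) (auto simp: E_def indicator_def)
  ultimately have "AE x in ?M. g x * indicator E x = 0"
    using integral_nonneg_eq_0_iff_AE by blast
  moreover have "AE x in ?M. x \<in> \<Omega>" by (intro AE_I2) simp
  ultimately show ?thesis by eventually_elim (auto simp: E_def indicator_def split: if_splits)
qed

lemma fundamental_lemma:
  assumes g: "integrable (lebesgue_on \<Omega>) g"
    and zero: "\<And>\<phi>. \<phi> \<in> test_functions \<Omega> \<Longrightarrow> (LINT x|lebesgue_on \<Omega>. g x * \<phi> x) = 0"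
  shows "AE x in lebesgue_on \<Omega>. g x = (0::real)"
proof -
  have "AE x in lebesgue_on \<Omega>. - g x \<le> 0"
    by (rule fundamental_lemma_nonpos) (use g zero in auto)
  moreover have "AE x in lebesgue_on \<Omega>. g x \<le> 0"
    by (rule fundamental_lemma_nonpos) (use g zero in auto)
  ultimately show ?thesis by eventually_elim simp
qed

lemma const_L2: "(\<lambda>x. c) \<in> L2 \<Omega>"
proof -
  have "\<Omega> \<in> lmeasurable" using bounded_Omega Omega_sets bounded_set_imp_lmeasurable by blast
  then show ?thesis
    by (auto simp: L2_def emeasure_restrict_space fmeasurable_def intro!: integrable_const_ivl finite_measure.integrable_const finite_measureI)
qed

lemma L2_integrable_real:
  fixes g :: "real^3 \<Rightarrow> real"
  shows "g \<in> L2 \<Omega> \<Longrightarrow> integrable (lebesgue_on \<Omega>) g"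
  using L2_inner_integrable[OF _ const_L2[of "1::real"], of g] by simp

lemma has_weak_grad_unique:
  assumes "has_weak_grad \<Omega> f g" "has_weak_grad \<Omega> f g'"
  shows "AE x in lebesgue_on \<Omega>. g x = g' x"
proof -
  have L: "g \<in> L2 \<Omega>" "g' \<in> L2 \<Omega>" using assms by (auto simp: has_weak_grad_def)
  have "AE x in lebesgue_on \<Omega>. g x $ j - g' x $ j = 0" for j
  proof (rule fundamental_lemma)
    show "integrable (lebesgue_on \<Omega>) (\<lambda>x. g x $ j - g' x $ j)"
      by (intro L2_integrable_real L2_diff L2_component L)
    fix \<phi> :: "real^3 \<Rightarrow> real" assume \<phi>: "\<phi> \<in> test_functions \<Omega>"
    have "integrable (lebesgue_on \<Omega>) (\<lambda>x. g x $ j * \<phi> x)" "integrable (lebesgue_on \<Omega>) (\<lambda>x. g' x $ j * \<phi> x)"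
      using L2_inner_integrable[OF L2_component test_functions_L2[OF open_Omega \<phi>]] L by auto
    moreover have "(LINT x|lebesgue_on \<Omega>. g x $ j * \<phi> x) = (LINT x|lebesgue_on \<Omega>. g' x $ j * \<phi> x)"
      using assms \<phi> unfolding has_weak_grad_def by force
    ultimately show "(LINT x|lebesgue_on \<Omega>. (g x $ j - g' x $ j) * \<phi> x) = 0"
      by (simp add: left_diff_distrib)
  qed
  then have "AE x in lebesgue_on \<Omega>. \<forall>j. g x $ j - g' x $ j = 0" by (simp add: AE_all_countable)
  then show ?thesis by eventually_elim (simp add: vec_eq_iff)
qed

lemma has_weak_jac_unique:
  assumes "has_weak_jac \<Omega> u G" "has_weak_jac \<Omega> u G'"
  shows "AE x in lebesgue_on \<Omega>. G x = G' x"
proof -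
  have "AE x in lebesgue_on \<Omega>. G x $ i = G' x $ i" for i
    using assms by (intro has_weak_grad_unique) (auto simp: has_weak_jac_def)
  then have "AE x in lebesgue_on \<Omega>. \<forall>i. G x $ i = G' x $ i" by (simp add: AE_all_countable)
  then show ?thesis by eventually_elim (simp add: vec_eq_iff)
qed

lemma has_weak_grad_linear:
  assumes "has_weak_grad \<Omega> f g" "has_weak_grad \<Omega> f' g'"
  shows "has_weak_grad \<Omega> (\<lambda>x. f x + c * f' x) (\<lambda>x. g x + c *\<^sub>R g' x)"
proof -
  have L: "f \<in> L2 \<Omega>" "f' \<in> L2 \<Omega>" "g \<in> L2 \<Omega>" "g' \<in> L2 \<Omega>" using assms by (auto simp: has_weak_grad_def)
  have "(LINT x|lebesgue_on \<Omega>. (f x + c * f' x) * grad \<phi> x $ j) =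
      - (LINT x|lebesgue_on \<Omega>. (g x + c *\<^sub>R g' x) $ j * \<phi> x)" if \<phi>: "\<phi> \<in> test_functions \<Omega>" for \<phi> j
  proof -
    note int = L2_inner_integrable[OF _ L2_component[OF grad_test_L2[OF open_Omega \<phi>], of j], simplified]
      L2_inner_integrable[OF L2_component test_functions_L2[OF open_Omega \<phi>], simplified]
    have "(LINT x|lebesgue_on \<Omega>. (f x + c * f' x) * grad \<phi> x $ j) =
        (LINT x|lebesgue_on \<Omega>. f x * grad \<phi> x $ j) + c * (LINT x|lebesgue_on \<Omega>. f' x * grad \<phi> x $ j)"
      using int(1)[OF L(1)] int(1)[OF L(2)] by (simp add: distrib_right mult.assoc)
    moreover have "(LINT x|lebesgue_on \<Omega>. (g x + c *\<^sub>R g' x) $ j * \<phi> x) =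
        (LINT x|lebesgue_on \<Omega>. g x $ j * \<phi> x) + c * (LINT x|lebesgue_on \<Omega>. g' x $ j * \<phi> x)"
      using int(2)[OF L(3), of j] int(2)[OF L(4), of j] by (simp add: distrib_right mult.assoc)
    ultimately show ?thesis using assms \<phi> by (simp add: has_weak_grad_def)
  qed
  then show ?thesis using L L2_add[OF L(1) L2_scaleR[OF L(2), of c]] L2_add[OF L(3) L2_scaleR[OF L(4), of c]]
    by (simp add: has_weak_grad_def)
qed

lemma has_weak_jac_linear:
  assumes "has_weak_jac \<Omega> u G" "has_weak_jac \<Omega> v G'"
  shows "has_weak_jac \<Omega> (\<lambda>x. u x + c *\<^sub>R v x) (\<lambda>x. G x + c *\<^sub>R G' x)"
  using assms has_weak_grad_linear[of "\<lambda>x. u x $ _" "\<lambda>x. G x $ _" "\<lambda>x. v x $ _" "\<lambda>x. G' x $ _" c]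
  by (auto simp: has_weak_jac_def intro: L2_add L2_scaleR)

end

section \<open>Ladyzhenskaya's inequality\<close>

lemma Basis_real3_axis: "(Basis :: (real^3) set) = {axis 1 1, axis 2 1, axis 3 1}"
  by (auto simp: Basis_vec_def UNIV_3)

lemma vector_3_axis: "vector [x, y, z] = x *\<^sub>R axis 1 1 + y *\<^sub>R axis 2 1 + z *\<^sub>R (axis 3 1 :: real^3)"
  by (simp add: vec_eq_iff forall_3 axis_def vector_3)

lemma measurable_vector_3 [measurable]:
  assumes [measurable]: "f \<in> borel_measurable M" "g \<in> borel_measurable M" "h \<in> borel_measurable M"
  shows "(\<lambda>w. vector [f w, g w, h w] :: real^3) \<in> borel_measurable M"
  unfolding vector_3_axis by measurable

lemma nn_integral_lborel_3:
  fixes F :: "real^3 \<Rightarrow> ennreal"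
  assumes [measurable]: "F \<in> borel_measurable borel"
  shows "(\<integral>\<^sup>+v. F v \<partial>lborel) = (\<integral>\<^sup>+x. \<integral>\<^sup>+y. \<integral>\<^sup>+z. F (vector [x, y, z]) \<partial>lborel \<partial>lborel \<partial>lborel)"
proof -
  interpret product_sigma_finite "\<lambda>b::real^3. lborel :: real measure"
    by (simp add: product_sigma_finite_def sigma_finite_lborel)
  let ?e = "\<lambda>i::3. axis i (1::real) :: real^3"
  have ne: "?e 1 \<noteq> ?e 2" "?e 1 \<noteq> ?e 3" "?e 2 \<noteq> ?e 3" by (simp_all add: axis_eq_axis)
  have comp: "(\<lambda>f. f b :: real) \<in> borel_measurable (Pi\<^sub>M I (\<lambda>b. lborel))" if "b \<in> I" for I and b :: "real^3"
    using measurable_component_singleton[OF that, of "\<lambda>b. lborel :: real measure"] by simp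
  note [measurable] = comp[of "?e 1"] comp[of "?e 2"] comp[of "?e 3"]
  have [measurable]: "(\<lambda>f. \<Sum>b\<in>Basis. f b *\<^sub>R b :: real^3) \<in> borel_measurable (Pi\<^sub>M Basis (\<lambda>b. lborel))"
    by (intro borel_measurable_sum borel_measurable_scaleR comp) auto
  have "(\<integral>\<^sup>+v. F v \<partial>lborel) = (\<integral>\<^sup>+f. F (\<Sum>b\<in>Basis. f b *\<^sub>R b) \<partial>Pi\<^sub>M Basis (\<lambda>b. lborel))"
    by (subst lborel_eq) (simp add: nn_integral_distr)
  also have "\<dots> = (\<integral>\<^sup>+f. F (vector [f (?e 1), f (?e 2), f (?e 3)]) \<partial>Pi\<^sub>M (insert (?e 1) {?e 2, ?e 3}) (\<lambda>b. lborel))"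
    unfolding Basis_real3_axis vector_3_axis using ne by (simp add: add.assoc)
  also have "\<dots> = (\<integral>\<^sup>+x. \<integral>\<^sup>+f. F (vector [x, f (?e 2), f (?e 3)]) \<partial>Pi\<^sub>M (insert (?e 2) {?e 3}) (\<lambda>b. lborel) \<partial>lborel)"
    using ne by (subst product_nn_integral_insert_rev) auto
  also have "\<dots> = (\<integral>\<^sup>+x. \<integral>\<^sup>+y. \<integral>\<^sup>+f. F (vector [x, y, f (?e 3)]) \<partial>Pi\<^sub>M {?e 3} (\<lambda>b. lborel) \<partial>lborel \<partial>lborel)"
    using ne by (subst product_nn_integral_insert_rev) auto
  also have "\<dots> = (\<integral>\<^sup>+x. \<integral>\<^sup>+y. \<integral>\<^sup>+z. F (vector [x, y, z]) \<partial>lborel \<partial>lborel \<partial>lborel)"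
    by (subst product_nn_integral_singleton) auto
  finally show ?thesis .
qed

lemma lborel_swap:
  fixes F :: "real \<Rightarrow> real \<Rightarrow> ennreal"
  assumes "case_prod F \<in> borel_measurable (lborel \<Otimes>\<^sub>M lborel)"
  shows "(\<integral>\<^sup>+x. \<integral>\<^sup>+y. F x y \<partial>lborel \<partial>lborel) = (\<integral>\<^sup>+y. \<integral>\<^sup>+x. F x y \<partial>lborel \<partial>lborel)"
  using lborel_pair.Fubini'[OF assms] by simp

text \<open>Here \<open>p = \<bar>\<phi>\<bar>\<close> and \<open>q = 2 \<bar>\<nabla>\<phi>\<bar>\<close> for a test function \<open>\<phi>\<close>. In a plane orthogonal to the
  first axis, \<open>p\<^sup>2\<close> is bounded by a function of the second and by a function of the third
  coordinate alone, so the integral of \<open>p\<^sup>4\<close> over that plane is at most the square of the integral of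
  \<open>p q\<close>. By Cauchy--Schwarz this square is controlled by the integral of \<open>p\<^sup>2\<close> over the plane,
  which is bounded uniformly by the bound along the first axis. As \<open>p\<close> vanishes for \<open>\<bar>x\<bar> > R\<close>, the same
  bound shows \<open>\<integral> p\<^sup>2 \<le> 2 R \<integral> p q\<close>, so that finally only \<open>q\<close> remains on the right.\<close>

lemma Ladyzhenskaya_axis_bounds:
  fixes p q :: "real^3 \<Rightarrow> ennreal" and R :: real
  assumes [measurable]: "p \<in> borel_measurable borel" "q \<in> borel_measurable borel"
    and b1: "\<And>x y z. (p (vector [x, y, z]))\<^sup>2 \<le> (\<integral>\<^sup>+s. p (vector [s, y, z]) * q (vector [s, y, z]) \<partial>lborel)"
    and b2: "\<And>x y z. (p (vector [x, y, z]))\<^sup>2 \<le> (\<integral>\<^sup>+s. p (vector [x, s, z]) * q (vector [x, s, z]) \<partial>lborel)"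
    and b3: "\<And>x y z. (p (vector [x, y, z]))\<^sup>2 \<le> (\<integral>\<^sup>+s. p (vector [x, y, s]) * q (vector [x, y, s]) \<partial>lborel)"
    and R: "0 \<le> R" and supp: "\<And>x y z. R < \<bar>x\<bar> \<Longrightarrow> p (vector [x, y, z]) = 0"
    and fin: "(\<integral>\<^sup>+v. p v * q v \<partial>lborel) < \<infinity>"
  shows "(\<integral>\<^sup>+v. p v ^ 4 \<partial>lborel) \<le> ennreal (2 * R) * (\<integral>\<^sup>+v. (q v)\<^sup>2 \<partial>lborel)\<^sup>2"
proof -
  let ?p = "\<lambda>x y z. p (vector [x, y, z])" and ?q = "\<lambda>x y z. q (vector [x, y, z])"
  define I where "I = (\<integral>\<^sup>+v. p v * q v \<partial>lborel)"
  define Q where "Q = (\<integral>\<^sup>+v. (q v)\<^sup>2 \<partial>lborel)"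
  define G where "G x = (\<integral>\<^sup>+y. \<integral>\<^sup>+z. (?p x y z)\<^sup>2 \<partial>lborel \<partial>lborel)" for x
  define H where "H x = (\<integral>\<^sup>+y. \<integral>\<^sup>+z. ?p x y z * ?q x y z \<partial>lborel \<partial>lborel)" for x
  define K where "K x = (\<integral>\<^sup>+y. \<integral>\<^sup>+z. (?q x y z)\<^sup>2 \<partial>lborel \<partial>lborel)" for x
  have I_eq: "I = (\<integral>\<^sup>+x. H x \<partial>lborel)" unfolding I_def H_def by (subst nn_integral_lborel_3) auto
  have Q_eq: "Q = (\<integral>\<^sup>+x. K x \<partial>lborel)" unfolding Q_def K_def by (subst nn_integral_lborel_3) auto
  have [measurable]: "K \<in> borel_measurable borel" unfolding K_def by measurable
  have GI: "G x \<le> I" for x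
  proof -
    have "G x \<le> (\<integral>\<^sup>+y. \<integral>\<^sup>+z. \<integral>\<^sup>+s. ?p s y z * ?q s y z \<partial>lborel \<partial>lborel \<partial>lborel)"
      unfolding G_def by (intro nn_integral_mono b1)
    also have "\<dots> = (\<integral>\<^sup>+y. \<integral>\<^sup>+s. \<integral>\<^sup>+z. ?p s y z * ?q s y z \<partial>lborel \<partial>lborel \<partial>lborel)"
      by (intro nn_integral_cong lborel_swap) measurable
    also have "\<dots> = (\<integral>\<^sup>+s. \<integral>\<^sup>+y. \<integral>\<^sup>+z. ?p s y z * ?q s y z \<partial>lborel \<partial>lborel \<partial>lborel)"
      by (intro lborel_swap) measurable
    finally show ?thesis by (simp add: I_eq H_def)
  qed
  have HGK: "(H x)\<^sup>2 \<le> G x * K x" for x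
  proof -
    have "(\<integral>\<^sup>+w. ?p x (fst w) (snd w) * ?q x (fst w) (snd w) \<partial>(lborel \<Otimes>\<^sub>M lborel))\<^sup>2
      \<le> (\<integral>\<^sup>+w. (?p x (fst w) (snd w))\<^sup>2 \<partial>(lborel \<Otimes>\<^sub>M lborel)) *
        (\<integral>\<^sup>+w. (?q x (fst w) (snd w))\<^sup>2 \<partial>(lborel \<Otimes>\<^sub>M lborel))"
      by (intro Cauchy_Schwarz_nn_integral; measurable)
    then show ?thesis
      unfolding G_def H_def K_def by (subst (asm) (1 2 3) lborel.nn_integral_fst[symmetric]) auto
  qed
  have slice: "(\<integral>\<^sup>+y. \<integral>\<^sup>+z. ?p x y z ^ 4 \<partial>lborel \<partial>lborel) \<le> I * K x" for x
  proof -
    let ?A = "\<lambda>y. \<integral>\<^sup>+s. ?p x y s * ?q x y s \<partial>lborel" and ?B = "\<lambda>z. \<integral>\<^sup>+s. ?p x s z * ?q x s z \<partial>lborel"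
    have "?p x y z ^ 4 \<le> ?A y * ?B z" for y z
    proof -
      have "?p x y z ^ 4 = (?p x y z)\<^sup>2 * (?p x y z)\<^sup>2" by (simp flip: power_add)
      also have "\<dots> \<le> ?A y * ?B z" by (intro mult_mono b2 b3) auto
      finally show ?thesis .
    qed
    then have "(\<integral>\<^sup>+y. \<integral>\<^sup>+z. ?p x y z ^ 4 \<partial>lborel \<partial>lborel) \<le> (\<integral>\<^sup>+y. \<integral>\<^sup>+z. ?A y * ?B z \<partial>lborel \<partial>lborel)"
      by (intro nn_integral_mono)
    also have "\<dots> = (\<integral>\<^sup>+y. ?A y * (\<integral>\<^sup>+z. ?B z \<partial>lborel) \<partial>lborel)"
      by (intro nn_integral_cong nn_integral_cmult) measurable
    also have "\<dots> = (\<integral>\<^sup>+y. ?A y \<partial>lborel) * (\<integral>\<^sup>+z. ?B z \<partial>lborel)"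
      by (intro nn_integral_multc) measurable
    also have "(\<integral>\<^sup>+z. ?B z \<partial>lborel) = (\<integral>\<^sup>+y. ?A y \<partial>lborel)"
      by (intro lborel_swap) measurable
    also have "(\<integral>\<^sup>+y. ?A y \<partial>lborel) * (\<integral>\<^sup>+y. ?A y \<partial>lborel) = (H x)\<^sup>2"
      by (simp add: H_def power2_eq_square)
    also have "\<dots> \<le> I * K x" using HGK GI by (meson mult_right_mono order_trans zero_le)
    finally show ?thesis .
  qed
  have "(\<integral>\<^sup>+v. p v ^ 4 \<partial>lborel) \<le> (\<integral>\<^sup>+x. I * K x \<partial>lborel)"
    by (subst nn_integral_lborel_3) (auto intro!: nn_integral_mono slice)
  also have "\<dots> = I * Q" by (simp add: Q_eq nn_integral_cmult)
  finally have p4: "(\<integral>\<^sup>+v. p v ^ 4 \<partial>lborel) \<le> I * Q" .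
  have "(\<integral>\<^sup>+v. (p v)\<^sup>2 \<partial>lborel) = (\<integral>\<^sup>+x. G x \<partial>lborel)" unfolding G_def by (subst nn_integral_lborel_3) auto
  also have "\<dots> \<le> (\<integral>\<^sup>+x. I * indicator {- R..R} x \<partial>lborel)"
  proof (rule nn_integral_mono)
    fix x show "G x \<le> I * indicator {- R..R} x"
      using GI[of x] supp[of x] by (cases "x \<in> {- R..R}") (auto simp: G_def not_le)
  qed
  also have "\<dots> = I * ennreal (2 * R)" using R by (simp add: nn_integral_cmult_indicator)
  finally have P: "(\<integral>\<^sup>+v. (p v)\<^sup>2 \<partial>lborel) \<le> I * ennreal (2 * R)" .
  have "I\<^sup>2 \<le> (\<integral>\<^sup>+v. (p v)\<^sup>2 \<partial>lborel) * Q"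
    unfolding I_def Q_def by (intro Cauchy_Schwarz_nn_integral) auto
  also have "\<dots> \<le> (I * ennreal (2 * R)) * Q" by (intro mult_right_mono P) simp
  finally have "I\<^sup>2 \<le> (I * ennreal (2 * R)) * Q" .
  then have "I * I \<le> I * (ennreal (2 * R) * Q)" by (simp add: power2_eq_square mult.assoc)
  moreover have "I \<noteq> \<infinity>" using fin by (simp add: I_def)
  ultimately have "I \<le> ennreal (2 * R) * Q"
    by (cases "I = 0") (auto simp: ennreal_mult_le_mult_iff)
  then have "I * Q \<le> ennreal (2 * R) * Q * Q" by (rule mult_right_mono) simp
  then show ?thesis using p4 by (simp add: Q_def power2_eq_square mult.assoc)
qed

lemma norm_derivative_axis_le_jac: "norm (frechet_derivative \<phi> (at x) (axis j 1)) \<le> norm (jac \<phi> x)"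
  for \<phi> :: vfield
proof -
  have "(norm (frechet_derivative \<phi> (at x) (axis j 1)))\<^sup>2 = (\<Sum>i\<in>UNIV. (jac \<phi> x $ i $ j)\<^sup>2)"
    by (simp add: jac_nth norm_vec_def L2_set_def sum_nonneg)
  also have "\<dots> \<le> (\<Sum>i\<in>UNIV. (norm (jac \<phi> x $ i))\<^sup>2)"
    by (intro sum_mono power2_le_iff_abs_le[THEN iffD2]) (auto simp: component_le_norm_cart)
  also have "\<dots> = (norm (jac \<phi> x))\<^sup>2" by (simp add: norm_vec_def[of "jac \<phi> x"] L2_set_def sum_nonneg)
  finally show ?thesis by (rule power2_le_imp_le) simp
qed

text \<open>The function \<open>\<bar>\<phi>\<bar>\<^sup>2\<close> vanishes far out on every line, and its derivative along the line is
  \<open>2 \<phi> \<bullet> \<partial>\<^sub>j\<phi>\<close>.\<close>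

lemma norm_sq_le_line_integral:
  fixes \<phi> :: vfield
  assumes \<phi>: "Cinf_on UNIV \<phi>" and supp: "\<And>v. r < norm v \<Longrightarrow> \<phi> v = 0"
  shows "(ennreal (norm (\<phi> v)))\<^sup>2 \<le> (\<integral>\<^sup>+s. ennreal (norm (\<phi> (v + (s - v $ j) *\<^sub>R axis j 1)))
      * ennreal (2 * norm (jac \<phi> (v + (s - v $ j) *\<^sub>R axis j 1))) \<partial>lborel)"
proof -
  define l where "l s = v + (s - v $ j) *\<^sub>R axis j 1" for s
  define d where "d s = frechet_derivative \<phi> (at (l s)) (axis j 1)" for s
  \<comment> \<open>a starting point on the line to the left of \<open>v\<close> and outside the support\<close>
  define a where "a = - \<bar>v $ j\<bar> - \<bar>r\<bar> - 1"
  have l_j: "l s $ j = s" for s by (simp add: l_def axis_def)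
  have a: "a \<le> v $ j" "\<phi> (l a) = 0"
    using supp[of "l a"] component_le_norm_cart[of "l a" j] by (auto simp: a_def l_j)
  have l: "(l has_vector_derivative axis j 1) (at s)" for s
    unfolding l_def by (auto intro!: derivative_eq_intros)
  have "((\<lambda>s. \<phi> (l s)) has_vector_derivative d s) (at s)" for s
    using vector_derivative_diff_chain_within[OF l, of \<phi> "frechet_derivative \<phi> (at (l s))" s]
      Cinf_on_has_derivative[OF \<phi>, of "l s"] by (simp add: d_def o_def has_derivative_at_withinI)
  then have "((\<lambda>s. \<phi> (l s) \<bullet> \<phi> (l s)) has_vector_derivative (\<phi> (l s) \<bullet> d s + d s \<bullet> \<phi> (l s))) (at s)" for s
    by (intro bounded_bilinear.has_vector_derivative[OF bounded_bilinear_inner])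
  then have der: "((\<lambda>s. \<phi> (l s) \<bullet> \<phi> (l s)) has_real_derivative 2 * (\<phi> (l s) \<bullet> d s)) (at s)" for s
    by (simp add: has_real_derivative_iff_has_vector_derivative inner_commute)
  have lc: "continuous_on UNIV l" unfolding l_def by (intro continuous_intros)
  have "continuous_on UNIV (\<lambda>s. 2 * (\<phi> (l s) \<bullet> d s))"
    unfolding d_def using Cinf_on_continuous[OF \<phi>] Cinf_on_continuous_deriv[OF \<phi>, of "axis j 1"]
    by (intro continuous_intros continuous_on_compose2[OF _ lc]) (auto simp: axis_in_Basis_iff)
  then have cont: "isCont (\<lambda>s. 2 * (\<phi> (l s) \<bullet> d s)) s" for s
    by (simp add: continuous_on_eq_continuous_at)
  have int: "integrable lborel (\<lambda>s. 2 * (\<phi> (l s) \<bullet> d s) * indicator {a..v $ j} s)"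
    by (rule borel_integrable_atLeastAtMost) (rule cont)
  have "ennreal ((norm (\<phi> v))\<^sup>2) = ennreal (\<phi> (l (v $ j)) \<bullet> \<phi> (l (v $ j)) - \<phi> (l a) \<bullet> \<phi> (l a))"
    using a by (simp add: power2_norm_eq_inner) (simp add: l_def)
  also have "\<dots> = ennreal (\<integral>s. 2 * (\<phi> (l s) \<bullet> d s) * indicator {a..v $ j} s \<partial>lborel)"
    by (subst integral_FTC_Icc_real[OF a(1) der cont]) simp
  also have "\<dots> \<le> (\<integral>\<^sup>+s. ennreal (norm (2 * (\<phi> (l s) \<bullet> d s) * indicator {a..v $ j} s)) \<partial>lborel)"
    by (rule order_trans[OF ennreal_leI integral_norm_bound_ennreal[OF int]]) simp
  also have "\<dots> \<le> (\<integral>\<^sup>+s. ennreal (norm (\<phi> (l s))) * ennreal (2 * norm (jac \<phi> (l s))) \<partial>lborel)"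
  proof (rule nn_integral_mono)
    fix s
    have "\<bar>\<phi> (l s) \<bullet> d s\<bar> \<le> norm (\<phi> (l s)) * norm (d s)" by (rule Cauchy_Schwarz_ineq2)
    also have "\<dots> \<le> norm (\<phi> (l s)) * norm (jac \<phi> (l s))"
      unfolding d_def by (intro mult_left_mono norm_derivative_axis_le_jac) simp
    finally have "norm (2 * (\<phi> (l s) \<bullet> d s) * indicator {a..v $ j} s) \<le> norm (\<phi> (l s)) * (2 * norm (jac \<phi> (l s)))"
      by (auto simp: indicator_def abs_mult)
    then show "ennreal (norm (2 * (\<phi> (l s) \<bullet> d s) * indicator {a..v $ j} s))
        \<le> ennreal (norm (\<phi> (l s))) * ennreal (2 * norm (jac \<phi> (l s)))"
      by (simp add: ennreal_mult[symmetric] ennreal_leI)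
  qed
  finally show ?thesis by (simp add: l_def ennreal_power)
qed

context bounded_open_set
begin

lemma nn_integral_lebesgue_on_eq_lborel:
  fixes f :: "real^3 \<Rightarrow> ennreal"
  assumes "f \<in> borel_measurable borel" "\<And>x. x \<notin> \<Omega> \<Longrightarrow> f x = 0"
  shows "(\<integral>\<^sup>+x. f x \<partial>lebesgue_on \<Omega>) = (\<integral>\<^sup>+x. f x \<partial>lborel)"
proof -
  have "(\<integral>\<^sup>+x. f x \<partial>lebesgue_on \<Omega>) = (\<integral>\<^sup>+x. f x * indicator \<Omega> x \<partial>lebesgue)"
    by (subst nn_integral_restrict_space) auto
  also have "\<dots> = (\<integral>\<^sup>+x. f x \<partial>lebesgue)"
    using assms(2) by (intro nn_integral_cong) (auto simp: indicator_def)
  finally show ?thesis by (simp add: nn_integral_completion)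
qed

text \<open>With \<open>q = 2 \<bar>\<nabla>\<phi>\<bar>\<close> and \<open>\<bar>x\<bar> \<le> R\<close> on \<open>\<Omega>\<close>, the right-hand side \<open>2 R (\<integral> q\<^sup>2)\<^sup>2\<close> of the previous bound is
  \<open>32 R \<parallel>\<nabla>\<phi>\<parallel>\<^sup>4\<close>, which explains the constant.\<close>

lemma Ladyzhenskaya_test_functions:
  obtains K where "0 \<le> K" 
    "\<And>\<phi>::vfield. \<phi> \<in> test_functions \<Omega> \<Longrightarrow> L2_norm \<Omega> (\<lambda>x. (norm (\<phi> x))\<^sup>2) \<le> K * (L2_norm \<Omega> (jac \<phi>))\<^sup>2"
proof -
  obtain R where R: "0 < R" "\<And>x. x \<in> \<Omega> \<Longrightarrow> norm x \<le> R" using bounded_Omega bounded_pos by blast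
  have "L2_norm \<Omega> (\<lambda>x. (norm (\<phi> x))\<^sup>2) \<le> sqrt (32 * R) * (L2_norm \<Omega> (jac \<phi>))\<^sup>2"
    if \<phi>: "\<phi> \<in> test_functions \<Omega>" for \<phi> :: vfield
  proof -
    have Cinf: "Cinf_on UNIV \<phi>" by (rule test_functions_Cinf[OF \<phi>])
    have m[measurable]: "\<phi> \<in> borel_measurable borel" "jac \<phi> \<in> borel_measurable borel"
      using Cinf_on_continuous[OF Cinf] continuous_on_jac[OF Cinf] by (auto intro: borel_measurable_continuous_onI)
    have out: "\<phi> x = 0" "jac \<phi> x = 0" if "x \<notin> \<Omega>" for x
    proof -
      obtain K where K: "compact K" "K \<subseteq> \<Omega>" "\<And>x. x \<notin> K \<Longrightarrow> \<phi> x = 0"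
        using \<phi> unfolding test_functions_def by blast
      show "\<phi> x = 0" using K that by blast
      show "jac \<phi> x = 0" using K that by (intro jac_outside_support[OF compact_imp_closed[OF K(1)]]) auto
    qed
    let ?p = "\<lambda>v. ennreal (norm (\<phi> v))" and ?q = "\<lambda>v. ennreal (2 * norm (jac \<phi> v))"
    note line = norm_sq_le_line_integral[OF Cinf, of R]
    have far: "\<phi> v = 0" if "R < norm v" for v using R(2)[of v] that out(1) by force
    have ints: "(\<integral>\<^sup>+v. (?q v)\<^sup>2 \<partial>lborel) = ennreal (4 * (L2_norm \<Omega> (jac \<phi>))\<^sup>2)"
    proof -
      have "(\<integral>\<^sup>+v. (?q v)\<^sup>2 \<partial>lborel) = (\<integral>\<^sup>+v. (?q v)\<^sup>2 \<partial>lebesgue_on \<Omega>)"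
        using out(2) by (intro nn_integral_lebesgue_on_eq_lborel[symmetric]) auto
      also have "\<dots> = (\<integral>\<^sup>+v. 4 * ennreal ((norm (jac \<phi> v))\<^sup>2) \<partial>lebesgue_on \<Omega>)"
        by (intro nn_integral_cong) (simp add: ennreal_power power_mult_distrib ennreal_mult')
      also have "\<dots> = 4 * ennreal ((L2_norm \<Omega> (jac \<phi>))\<^sup>2)"
        using jac_test_L2[OF open_Omega \<phi>] L2_measurable[OF jac_test_L2[OF open_Omega \<phi>]]
        by (subst nn_integral_cmult) (simp_all add: L2_norm_sq_nn_integral)
      finally show ?thesis by (simp add: ennreal_mult')
    qed
    have fin: "(\<integral>\<^sup>+v. ?p v * ?q v \<partial>lborel) < \<infinity>"
    proof -
      have "(\<integral>\<^sup>+v. ?p v * ?q v \<partial>lborel) = (\<integral>\<^sup>+v. ?p v * ?q v \<partial>lebesgue_on \<Omega>)"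
        using out by (intro nn_integral_lebesgue_on_eq_lborel[symmetric]) auto
      also have "\<dots> = (\<integral>\<^sup>+v. ennreal (2 * (norm (\<phi> v) * norm (jac \<phi> v))) \<partial>lebesgue_on \<Omega>)"
        by (intro nn_integral_cong) (simp add: ennreal_mult[symmetric] mult_ac)
      also have "\<dots> < \<infinity>"
        using L2_Cauchy_Schwarz_norms(1)[OF test_functions_L2[OF open_Omega \<phi>] jac_test_L2[OF open_Omega \<phi>]]
        by (subst nn_integral_eq_integral) auto
      finally show ?thesis .
    qed
    have upd: "vector [x, y, z] + (s - (vector [x, y, z] :: real^3) $ 1) *\<^sub>R axis 1 1 = (vector [s, y, z] :: real^3)"
      "vector [x, y, z] + (s - (vector [x, y, z] :: real^3) $ 2) *\<^sub>R axis 2 1 = (vector [x, s, z] :: real^3)"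
      "vector [x, y, z] + (s - (vector [x, y, z] :: real^3) $ 3) *\<^sub>R axis 3 1 = (vector [x, y, s] :: real^3)" for x y z s :: real
      by (simp_all add: vec_eq_iff forall_3 axis_def vector_3)
    have "(\<integral>\<^sup>+v. ?p v ^ 4 \<partial>lborel) \<le> ennreal (2 * R) * (\<integral>\<^sup>+v. (?q v)\<^sup>2 \<partial>lborel)\<^sup>2"
    proof (rule Ladyzhenskaya_axis_bounds[OF _ _ _ _ _ _ _ fin])
      fix x y z :: real
      show "(?p (vector [x, y, z]))\<^sup>2 \<le> (\<integral>\<^sup>+s. ?p (vector [s, y, z]) * ?q (vector [s, y, z]) \<partial>lborel)"
        "(?p (vector [x, y, z]))\<^sup>2 \<le> (\<integral>\<^sup>+s. ?p (vector [x, s, z]) * ?q (vector [x, s, z]) \<partial>lborel)"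
        "(?p (vector [x, y, z]))\<^sup>2 \<le> (\<integral>\<^sup>+s. ?p (vector [x, y, s]) * ?q (vector [x, y, s]) \<partial>lborel)"
        using line[of "vector [x, y, z]" 1] line[of "vector [x, y, z]" 2] line[of "vector [x, y, z]" 3] far
        by (simp_all only: upd)
    next
      fix x y z :: real assume "R < \<bar>x\<bar>"
      then have "R < norm (vector [x, y, z] :: real^3)"
        using component_le_norm_cart[of "vector [x, y, z] :: real^3" 1] by simp
      then show "?p (vector [x, y, z]) = 0" using far by simp
    qed (use R in auto)
    also have "\<dots> = ennreal ((sqrt (32 * R) * (L2_norm \<Omega> (jac \<phi>))\<^sup>2)\<^sup>2)"
      unfolding ints using R(1)
      by (simp add: ennreal_power ennreal_mult[symmetric] power_mult_distrib mult_ac)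
    also have "(\<integral>\<^sup>+v. ?p v ^ 4 \<partial>lborel) = (\<integral>\<^sup>+x. ennreal ((norm ((norm (\<phi> x))\<^sup>2))\<^sup>2) \<partial>lebesgue_on \<Omega>)"
      using out by (subst nn_integral_lebesgue_on_eq_lborel) (auto simp: ennreal_power power_mult[symmetric])
    finally show ?thesis
      using R(1) L2_measurable[OF test_functions_L2[OF open_Omega \<phi>]]
      by (intro L2_norm_le_nn_integral(2)) auto
  qed
  then show thesis using R(1) by (intro that[of "sqrt (32 * R)"]) auto
qed

end

section \<open>Fields with zero boundary values and the trilinear form\<close>

lemma norm_matrix_vector_mult_le: "norm (A *v x) \<le> norm A * norm x"
  for A :: "real^'n^'m" and x :: "real^'n"
proof (rule power2_le_imp_le)
  have "(norm (A *v x))\<^sup>2 = (\<Sum>i\<in>UNIV. (A $ i \<bullet> x)\<^sup>2)"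
    by (simp add: norm_vec_def L2_set_def sum_nonneg matrix_vector_mul_component)
  also have "\<dots> \<le> (\<Sum>i\<in>UNIV. (norm (A $ i))\<^sup>2 * (norm x)\<^sup>2)"
    by (intro sum_mono) (metis Cauchy_Schwarz_ineq2 abs_ge_zero power2_abs power_mono power_mult_distrib)
  also have "\<dots> = (norm A * norm x)\<^sup>2"
    by (simp add: norm_vec_def[of A] L2_set_def sum_nonneg power_mult_distrib sum_distrib_right)
  finally show "(norm (A *v x))\<^sup>2 \<le> (norm A * norm x)\<^sup>2" .
qed simp

text \<open>The trilinear form with the gradient as a separate argument: smooth approximations enter with
  their classical Jacobian instead of the chosen weak gradient.\<close>

definition convection :: "(real^3) set \<Rightarrow> vfield \<Rightarrow> (real^3 \<Rightarrow> real^3^3) \<Rightarrow> vfield \<Rightarrow> real" where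
  "convection \<Omega> u A w = (LINT x|lebesgue_on \<Omega>. (A x *v u x) \<bullet> w x)"

lemma B_pairing_convection: "B_pairing \<Omega> u v w = convection \<Omega> u (weak_jac \<Omega> v) w"
  by (simp add: B_pairing_def convection_def)

text \<open>The membership in \<open>L\<^sup>4\<close> is expressed by \<open>\<bar>u\<bar>\<^sup>2 \<in> L\<^sup>2\<close>; Hoelder's inequality with exponents
  2, 4, 4 is then Cauchy--Schwarz applied twice.\<close>

definition L4 :: "(real^3) set \<Rightarrow> vfield set" where
  "L4 \<Omega> = {u. u \<in> L2 \<Omega> \<and> (\<lambda>x. (norm (u x))\<^sup>2) \<in> L2 \<Omega>}"

definition L4_norm :: "(real^3) set \<Rightarrow> vfield \<Rightarrow> real" where
  "L4_norm \<Omega> u = sqrt (L2_norm \<Omega> (\<lambda>x. (norm (u x))\<^sup>2))"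

lemma L4_norm_nonneg [simp]: "0 \<le> L4_norm \<Omega> u"
  by (simp add: L4_norm_def)

lemma measurable_vec_nth:
  fixes f :: "real^3 \<Rightarrow> 'b::euclidean_space^'n"
  assumes "f \<in> borel_measurable M" shows "(\<lambda>x. f x $ i) \<in> borel_measurable M"
  using assms by (rule borel_measurable_continuous_on[rotated]) (intro continuous_intros)

lemma convection_integrable_bound:
  assumes "u \<in> L4 \<Omega>" "A \<in> L2 \<Omega>" "w \<in> L4 \<Omega>"
  shows "integrable (lebesgue_on \<Omega>) (\<lambda>x. (A x *v u x) \<bullet> w x)"
    and "\<bar>convection \<Omega> u A w\<bar> \<le> L2_norm \<Omega> A * L4_norm \<Omega> u * L4_norm \<Omega> w"
proof -
  let ?M = "lebesgue_on \<Omega>"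
  have m: "u \<in> borel_measurable ?M" "w \<in> borel_measurable ?M" "A \<in> borel_measurable ?M"
    using assms by (auto simp: L4_def L2_measurable)
  have u2: "(\<lambda>x. (norm (u x))\<^sup>2) \<in> L2 \<Omega>" and w2: "(\<lambda>x. (norm (w x))\<^sup>2) \<in> L2 \<Omega>"
    using assms by (auto simp: L4_def)
  note CS = L2_Cauchy_Schwarz_norms[OF u2 w2, simplified]
  have uw: "(\<lambda>x. norm (u x) * norm (w x)) \<in> L2 \<Omega>"
    using m CS(1) by (auto simp: L2_def power_mult_distrib)
  have "(L2_norm \<Omega> (\<lambda>x. norm (u x) * norm (w x)))\<^sup>2 \<le> (L4_norm \<Omega> u * L4_norm \<Omega> w)\<^sup>2"
    using CS(2) by (simp add: L2_norm_sq_integral power_mult_distrib L4_norm_def)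
  then have uw_norm: "L2_norm \<Omega> (\<lambda>x. norm (u x) * norm (w x)) \<le> L4_norm \<Omega> u * L4_norm \<Omega> w"
    by (rule power2_le_imp_le) simp
  have "(\<lambda>x. \<Sum>i\<in>UNIV. (\<Sum>j\<in>UNIV. A x $ i $ j * u x $ j) * w x $ i) \<in> borel_measurable ?M"
    by (intro borel_measurable_sum borel_measurable_times measurable_vec_nth m)
  then have meas: "(\<lambda>x. (A x *v u x) \<bullet> w x) \<in> borel_measurable ?M"
    by (simp add: inner_vec_def matrix_vector_mult_def)
  note CSA = L2_Cauchy_Schwarz_norms[OF assms(2) uw, simplified]
  have le: "\<bar>(A x *v u x) \<bullet> w x\<bar> \<le> norm (A x) * (norm (u x) * norm (w x))" for x
  proof -
    have "\<bar>(A x *v u x) \<bullet> w x\<bar> \<le> norm (A x *v u x) * norm (w x)" by (rule Cauchy_Schwarz_ineq2)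
    also have "\<dots> \<le> (norm (A x) * norm (u x)) * norm (w x)"
      by (intro mult_right_mono norm_matrix_vector_mult_le) simp
    finally show ?thesis by (simp add: mult.assoc)
  qed
  show int: "integrable ?M (\<lambda>x. (A x *v u x) \<bullet> w x)"
    by (rule Bochner_Integration.integrable_bound[OF CSA(1) meas]) (use le in \<open>auto simp: abs_mult\<close>)
  have "\<bar>convection \<Omega> u A w\<bar> \<le> (LINT x|?M. \<bar>(A x *v u x) \<bullet> w x\<bar>)"
    using integral_norm_bound[of ?M "\<lambda>x. (A x *v u x) \<bullet> w x"] by (simp add: convection_def)
  also have "\<dots> \<le> (LINT x|?M. norm (A x) * (norm (u x) * norm (w x)))"
    using int CSA(1) le by (intro integral_mono) auto
  also have "\<dots> \<le> L2_norm \<Omega> A * L2_norm \<Omega> (\<lambda>x. norm (u x) * norm (w x))" by (rule CSA(2))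
  also have "\<dots> \<le> L2_norm \<Omega> A * (L4_norm \<Omega> u * L4_norm \<Omega> w)"
    by (intro mult_left_mono uw_norm) simp
  finally show "\<bar>convection \<Omega> u A w\<bar> \<le> L2_norm \<Omega> A * L4_norm \<Omega> u * L4_norm \<Omega> w"
    by (simp add: mult.assoc)
qed

lemma convection_linear:
  assumes "u \<in> L4 \<Omega>" "u' \<in> L4 \<Omega>" "A \<in> L2 \<Omega>" "A' \<in> L2 \<Omega>" "w \<in> L4 \<Omega>" "w' \<in> L4 \<Omega>"
  shows "convection \<Omega> (\<lambda>x. u x + c *\<^sub>R u' x) A w = convection \<Omega> u A w + c * convection \<Omega> u' A w"
    and "convection \<Omega> u (\<lambda>x. A x + c *\<^sub>R A' x) w = convection \<Omega> u A w + c * convection \<Omega> u A' w"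
    and "convection \<Omega> u A (\<lambda>x. w x + c *\<^sub>R w' x) = convection \<Omega> u A w + c * convection \<Omega> u A w'"
  using convection_integrable_bound(1)[OF assms(1,3,5)] convection_integrable_bound(1)[OF assms(2,3,5)]
    convection_integrable_bound(1)[OF assms(1,4,5)] convection_integrable_bound(1)[OF assms(1,3,6)]
  by (simp_all add: convection_def matrix_vector_right_distrib matrix_vector_mult_add_rdistrib
      matrix_vector_mult_scaleR scaleR_matrix_vector_assoc[symmetric] inner_add_left inner_add_right)

context bounded_open_set
begin

lemma has_weak_jac_weak_jac: "has_weak_jac \<Omega> u G \<Longrightarrow> has_weak_jac \<Omega> u (weak_jac \<Omega> u)"
  unfolding weak_jac_def using someI[of "has_weak_jac \<Omega> u" G] by simp

text \<open>The gradient \<^const>\<open>weak_jac\<close> is an arbitrary choice among almost everywhere equal fields, so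
  its algebraic rules hold almost everywhere only.\<close>

lemma weak_jac_AE_eq: "has_weak_jac \<Omega> u G \<Longrightarrow> AE x in lebesgue_on \<Omega>. weak_jac \<Omega> u x = G x"
  using has_weak_jac_unique[OF has_weak_jac_weak_jac] by blast

lemma H10_approx:
  assumes "u \<in> H10 \<Omega>"
  obtains \<phi> where "\<And>n::nat. \<phi> n \<in> test_functions \<Omega>"
    "(\<lambda>n. L2_norm \<Omega> (\<lambda>x. \<phi> n x - u x)) \<longlonglongrightarrow> 0"
    "(\<lambda>n. L2_norm \<Omega> (\<lambda>x. jac (\<phi> n) x - weak_jac \<Omega> u x)) \<longlonglongrightarrow> 0"
proof -
  obtain G \<phi> where *: "has_weak_jac \<Omega> u G" "\<And>n::nat. \<phi> n \<in> test_functions \<Omega>"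
    "(\<lambda>n. L2_norm \<Omega> (\<lambda>x. \<phi> n x - u x)) \<longlonglongrightarrow> 0" "(\<lambda>n. L2_norm \<Omega> (\<lambda>x. jac (\<phi> n) x - G x)) \<longlonglongrightarrow> 0"
    using assms by (auto simp: H10_def)
  have L: "G \<in> L2 \<Omega>" "weak_jac \<Omega> u \<in> L2 \<Omega>"
    using *(1) has_weak_jac_weak_jac[OF *(1)] by (auto simp: has_weak_jac_def)
  have "L2_norm \<Omega> (\<lambda>x. jac (\<phi> n) x - G x) = L2_norm \<Omega> (\<lambda>x. jac (\<phi> n) x - weak_jac \<Omega> u x)" for n
    using weak_jac_AE_eq[OF *(1)] jac_test_L2[OF open_Omega *(2)[of n]] L
    by (intro L2_norm_cong_AE L2_diff) auto
  then show thesis using *(4) by (intro that[OF *(2,3)]) simp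
qed

lemma H10_has_weak_jac: "u \<in> H10 \<Omega> \<Longrightarrow> has_weak_jac \<Omega> u (weak_jac \<Omega> u)"
  by (auto simp: H10_def intro: has_weak_jac_weak_jac)

lemma H10_L2: "u \<in> H10 \<Omega> \<Longrightarrow> u \<in> L2 \<Omega>"
  by (auto simp: H10_def has_weak_jac_def)

lemma weak_jac_L2: "u \<in> H10 \<Omega> \<Longrightarrow> weak_jac \<Omega> u \<in> L2 \<Omega>"
  using H10_has_weak_jac by (auto simp: has_weak_jac_def)

lemma H10_linear:
  assumes u: "u \<in> H10 \<Omega>" and v: "v \<in> H10 \<Omega>"
  shows "(\<lambda>x. u x + c *\<^sub>R v x) \<in> H10 \<Omega>"
    and "AE x in lebesgue_on \<Omega>. weak_jac \<Omega> (\<lambda>x. u x + c *\<^sub>R v x) x = weak_jac \<Omega> u x + c *\<^sub>R weak_jac \<Omega> v x"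
proof -
  let ?G = "\<lambda>x. weak_jac \<Omega> u x + c *\<^sub>R weak_jac \<Omega> v x"
  have wj: "has_weak_jac \<Omega> (\<lambda>x. u x + c *\<^sub>R v x) ?G"
    by (intro has_weak_jac_linear H10_has_weak_jac u v)
  then show "AE x in lebesgue_on \<Omega>. weak_jac \<Omega> (\<lambda>x. u x + c *\<^sub>R v x) x = ?G x" by (rule weak_jac_AE_eq)
  obtain \<phi> where \<phi>: "\<And>n::nat. \<phi> n \<in> test_functions \<Omega>"
    "(\<lambda>n. L2_norm \<Omega> (\<lambda>x. \<phi> n x - u x)) \<longlonglongrightarrow> 0"
    "(\<lambda>n. L2_norm \<Omega> (\<lambda>x. jac (\<phi> n) x - weak_jac \<Omega> u x)) \<longlonglongrightarrow> 0"
    using H10_approx[OF u] by blast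
  obtain \<psi> where \<psi>: "\<And>n::nat. \<psi> n \<in> test_functions \<Omega>"
    "(\<lambda>n. L2_norm \<Omega> (\<lambda>x. \<psi> n x - v x)) \<longlonglongrightarrow> 0"
    "(\<lambda>n. L2_norm \<Omega> (\<lambda>x. jac (\<psi> n) x - weak_jac \<Omega> v x)) \<longlonglongrightarrow> 0"
    using H10_approx[OF v] by blast
  have comb: "(\<lambda>n. L2_norm \<Omega> (\<lambda>x. (F n x + c *\<^sub>R G n x) - (f x + c *\<^sub>R g x))) \<longlonglongrightarrow> 0"
    if L: "\<And>n. F n \<in> L2 \<Omega>" "\<And>n. G n \<in> L2 \<Omega>" "f \<in> L2 \<Omega>" "g \<in> L2 \<Omega>" and
     l: "(\<lambda>n. L2_norm \<Omega> (\<lambda>x. F n x - f x)) \<longlonglongrightarrow> 0" "(\<lambda>n. L2_norm \<Omega> (\<lambda>x. G n x - g x)) \<longlonglongrightarrow> 0"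
   for F G :: "nat \<Rightarrow> real^3 \<Rightarrow> 'b::euclidean_space" and f g
  proof (rule Lim_null_comparison)
    show "(\<lambda>n. L2_norm \<Omega> (\<lambda>x. F n x - f x) + \<bar>c\<bar> * L2_norm \<Omega> (\<lambda>x. G n x - g x)) \<longlonglongrightarrow> 0"
      using tendsto_add[OF l(1) tendsto_mult_right[OF l(2), of "\<bar>c\<bar>"]] by (simp add: mult.commute)
    have "L2_norm \<Omega> (\<lambda>x. (F n x + c *\<^sub>R G n x) - (f x + c *\<^sub>R g x)) \<le>
      L2_norm \<Omega> (\<lambda>x. F n x - f x) + \<bar>c\<bar> * L2_norm \<Omega> (\<lambda>x. G n x - g x)" for n
    proof -
      have eq: "(\<lambda>x. (F n x + c *\<^sub>R G n x) - (f x + c *\<^sub>R g x)) = (\<lambda>x. (F n x - f x) + c *\<^sub>R (G n x - g x))"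
        by (simp add: algebra_simps)
      show ?thesis unfolding eq L2_norm_scaleR[symmetric] by (intro L2_triangle L2_diff L2_scaleR L)
    qed
    then show "\<forall>\<^sub>F n in sequentially. norm (L2_norm \<Omega> (\<lambda>x. (F n x + c *\<^sub>R G n x) - (f x + c *\<^sub>R g x))) \<le>
      L2_norm \<Omega> (\<lambda>x. F n x - f x) + \<bar>c\<bar> * L2_norm \<Omega> (\<lambda>x. G n x - g x)" by simp
  qed
  have t: "(\<lambda>x. \<phi> n x + c *\<^sub>R \<psi> n x) \<in> test_functions \<Omega>" for n
    by (intro test_functions_add test_functions_scaleR \<phi> \<psi>)
  have j: "jac (\<lambda>x. \<phi> n x + c *\<^sub>R \<psi> n x) x = jac (\<phi> n) x + c *\<^sub>R jac (\<psi> n) x" for n x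
    using test_functions_Cinf[OF \<phi>(1)] test_functions_Cinf[OF \<psi>(1)] test_functions_Cinf[OF test_functions_scaleR[OF \<psi>(1)]]
    by (simp add: jac_add jac_scaleR)
  have "(\<lambda>n. L2_norm \<Omega> (\<lambda>x. (\<phi> n x + c *\<^sub>R \<psi> n x) - (u x + c *\<^sub>R v x))) \<longlonglongrightarrow> 0"
    by (intro comb test_functions_L2 open_Omega \<phi> \<psi> H10_L2 u v)
  moreover have "(\<lambda>n. L2_norm \<Omega> (\<lambda>x. jac (\<lambda>x. \<phi> n x + c *\<^sub>R \<psi> n x) x - ?G x)) \<longlonglongrightarrow> 0"
    unfolding j by (intro comb jac_test_L2 open_Omega \<phi> \<psi> weak_jac_L2 u v)
  ultimately show "(\<lambda>x. u x + c *\<^sub>R v x) \<in> H10 \<Omega>"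
    unfolding H10_def mem_Collect_eq using wj t
    by (intro exI[of _ ?G] conjI exI[of _ "\<lambda>n x. \<phi> n x + c *\<^sub>R \<psi> n x"] allI)
qed

lemma H10_zero: "(\<lambda>x. 0) \<in> H10 \<Omega>" "AE x in lebesgue_on \<Omega>. weak_jac \<Omega> (\<lambda>x. 0) x = 0"
proof -
  have wj: "has_weak_jac \<Omega> (\<lambda>x. 0) (\<lambda>x. 0)"
    by (simp add: has_weak_jac_def has_weak_grad_def L2_zero)
  then show "AE x in lebesgue_on \<Omega>. weak_jac \<Omega> (\<lambda>x. 0) x = 0" by (rule weak_jac_AE_eq)
  have "jac (\<lambda>x. 0) x = 0" for x by (rule jac_outside_support[of "{}"]) auto
  then show "(\<lambda>x. 0) \<in> H10 \<Omega>"
    unfolding H10_def using wj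
    by (auto intro!: exI[of _ "\<lambda>x. 0"] exI[of _ "\<lambda>n x. 0"] test_functions_zero simp: L2_norm_def L2_inner_def)
qed

lemma div_free_linear:
  assumes "div_free \<Omega> u" "div_free \<Omega> v" "u \<in> L2 \<Omega>" "v \<in> L2 \<Omega>"
  shows "div_free \<Omega> (\<lambda>x. u x + c *\<^sub>R v x)"
  unfolding div_free_def
proof
  fix \<phi> :: "real^3 \<Rightarrow> real" assume \<phi>: "\<phi> \<in> test_functions \<Omega>"
  note g = grad_test_L2[OF open_Omega \<phi>]
  have "(LINT x|lebesgue_on \<Omega>. u x \<bullet> grad \<phi> x) = 0" "(LINT x|lebesgue_on \<Omega>. v x \<bullet> grad \<phi> x) = 0"
    using assms(1,2) \<phi> by (auto simp: div_free_def)
  then show "(LINT x|lebesgue_on \<Omega>. (u x + c *\<^sub>R v x) \<bullet> grad \<phi> x) = 0"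
    using L2_inner_integrable[OF assms(3) g] L2_inner_integrable[OF assms(4) g] by (simp add: inner_add_left)
qed

lemma V_H10: "u \<in> V_space \<Omega> \<Longrightarrow> u \<in> H10 \<Omega>"
  by (simp add: V_space_def)

lemma V_linear:
  "u \<in> V_space \<Omega> \<Longrightarrow> v \<in> V_space \<Omega> \<Longrightarrow> (\<lambda>x. u x + c *\<^sub>R v x) \<in> V_space \<Omega>"
  by (simp add: V_space_def H10_linear div_free_linear H10_L2)

lemma V_diff: "u \<in> V_space \<Omega> \<Longrightarrow> v \<in> V_space \<Omega> \<Longrightarrow> (\<lambda>x. u x - v x) \<in> V_space \<Omega>"
  using V_linear[of u v "-1"] by simp

lemma weak_jac_diff_AE:
  "u \<in> H10 \<Omega> \<Longrightarrow> v \<in> H10 \<Omega> \<Longrightarrow>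
    AE x in lebesgue_on \<Omega>. weak_jac \<Omega> (\<lambda>x. u x - v x) x = weak_jac \<Omega> u x - weak_jac \<Omega> v x"
  using H10_linear(2)[of u v "-1"] by simp

lemma V_sum:
  assumes "finite A" "\<And>k. k \<in> A \<Longrightarrow> w k \<in> V_space \<Omega>"
  shows "(\<lambda>x. \<Sum>k\<in>A. c k *\<^sub>R w k x) \<in> V_space \<Omega> \<and>
    (AE x in lebesgue_on \<Omega>. weak_jac \<Omega> (\<lambda>x. \<Sum>k\<in>A. c k *\<^sub>R w k x) x = (\<Sum>k\<in>A. c k *\<^sub>R weak_jac \<Omega> (w k) x))"
  using assms
proof (induction A rule: finite_induct)
  case empty
  then show ?case using H10_zero by (simp add: V_space_def div_free_def)
next
  case (insert a A)
  then have IH: "(\<lambda>x. \<Sum>k\<in>A. c k *\<^sub>R w k x) \<in> V_space \<Omega>"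
    "AE x in lebesgue_on \<Omega>. weak_jac \<Omega> (\<lambda>x. \<Sum>k\<in>A. c k *\<^sub>R w k x) x = (\<Sum>k\<in>A. c k *\<^sub>R weak_jac \<Omega> (w k) x)"
    and a: "w a \<in> V_space \<Omega>" by auto
  have eq: "(\<lambda>x. \<Sum>k\<in>insert a A. c k *\<^sub>R w k x) = (\<lambda>x. (\<Sum>k\<in>A. c k *\<^sub>R w k x) + c a *\<^sub>R w a x)"
    using insert by (simp add: add.commute)
  have "AE x in lebesgue_on \<Omega>. weak_jac \<Omega> (\<lambda>x. (\<Sum>k\<in>A. c k *\<^sub>R w k x) + c a *\<^sub>R w a x) x
      = (\<Sum>k\<in>insert a A. c k *\<^sub>R weak_jac \<Omega> (w k) x)"
    using H10_linear(2)[OF V_H10[OF IH(1)] V_H10[OF a], of "c a"] IH(2)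
    by eventually_elim (use insert in \<open>simp add: add.commute\<close>)
  then show ?case unfolding eq using V_linear[OF IH(1) a] by blast
qed

subsection \<open>Ladyzhenskaya's inequality for fields with zero boundary values\<close>

definition "ladyzhenskaya_const = (SOME K. 0 \<le> K \<and> (\<forall>\<phi>\<in>test_functions \<Omega>.
   L2_norm \<Omega> (\<lambda>x. (norm (\<phi> x :: real^3))\<^sup>2) \<le> K * (L2_norm \<Omega> (jac \<phi>))\<^sup>2))"

lemma ladyzhenskaya_const:
  "0 \<le> ladyzhenskaya_const"
  "\<phi> \<in> test_functions \<Omega> \<Longrightarrow> L2_norm \<Omega> (\<lambda>x. (norm (\<phi> x))\<^sup>2) \<le> ladyzhenskaya_const * (L2_norm \<Omega> (jac \<phi>))\<^sup>2"
proof -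
  obtain K where K: "0 \<le> K" "\<And>\<phi>::vfield. \<phi> \<in> test_functions \<Omega> \<Longrightarrow> L2_norm \<Omega> (\<lambda>x. (norm (\<phi> x))\<^sup>2) \<le> K * (L2_norm \<Omega> (jac \<phi>))\<^sup>2"
    using Ladyzhenskaya_test_functions by blast
  then have "\<exists>K. 0 \<le> K \<and> (\<forall>\<phi>\<in>test_functions \<Omega>. L2_norm \<Omega> (\<lambda>x. (norm (\<phi> x :: real^3))\<^sup>2) \<le> K * (L2_norm \<Omega> (jac \<phi>))\<^sup>2)"
    by blast
  from someI_ex[OF this, folded ladyzhenskaya_const_def]
  show "0 \<le> ladyzhenskaya_const"
    "\<phi> \<in> test_functions \<Omega> \<Longrightarrow> L2_norm \<Omega> (\<lambda>x. (norm (\<phi> x))\<^sup>2) \<le> ladyzhenskaya_const * (L2_norm \<Omega> (jac \<phi>))\<^sup>2"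
    by auto
qed

lemma test_functions_norm_sq_L2:
  fixes \<phi> :: vfield
  assumes "\<phi> \<in> test_functions \<Omega>" shows "(\<lambda>x. (norm (\<phi> x))\<^sup>2) \<in> L2 \<Omega>"
proof -
  obtain K where K: "Cinf_on UNIV \<phi>" "compact K" "K \<subseteq> \<Omega>" "\<And>x. x \<notin> K \<Longrightarrow> \<phi> x = 0"
    using assms unfolding test_functions_def by blast
  show ?thesis
    by (rule continuous_compact_support_L2[OF open_Omega _ K(2,3)])
      (use K(4) Cinf_on_continuous[OF K(1)] in \<open>auto intro!: continuous_intros\<close>)
qed

text \<open>Fatou along an almost everywhere convergent subsequence. Stated for a general limit, it applies
  both to a field in \<open>H\<^sup>1\<^sub>0\<close> and to its difference from a fixed approximating test function; the
  latter gives convergence in \<open>L\<^sup>4\<close>.\<close>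

lemma L4_limit_of_test_functions:
  fixes v :: vfield
  assumes t: "\<And>n. \<phi> n \<in> test_functions \<Omega>" and L: "v \<in> L2 \<Omega>" "G \<in> L2 \<Omega>"
    and l: "(\<lambda>n. L2_norm \<Omega> (\<lambda>x. \<phi> n x - v x)) \<longlonglongrightarrow> 0" "(\<lambda>n. L2_norm \<Omega> (\<lambda>x. jac (\<phi> n) x - G x)) \<longlonglongrightarrow> 0"
  shows "v \<in> L4 \<Omega>" "L4_norm \<Omega> v \<le> sqrt ladyzhenskaya_const * L2_norm \<Omega> G"
proof -
  obtain r :: "nat \<Rightarrow> nat" where r: "strict_mono r" "AE x in lebesgue_on \<Omega>. (\<lambda>n. \<phi> (r n) x) \<longlonglongrightarrow> v x"
    using L2_convergent_AE_subseq[OF test_functions_L2[OF open_Omega t] L(1) l(1)] by blast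
  have "(\<lambda>n. L2_norm \<Omega> (jac (\<phi> n))) \<longlonglongrightarrow> L2_norm \<Omega> G"
    by (rule L2_norm_tendsto[OF jac_test_L2[OF open_Omega t] L(2) l(2)])
  then have lim: "(\<lambda>n. ladyzhenskaya_const * (L2_norm \<Omega> (jac (\<phi> (r n))))\<^sup>2) \<longlonglongrightarrow> ladyzhenskaya_const * (L2_norm \<Omega> G)\<^sup>2"
    using LIMSEQ_subseq_LIMSEQ[OF _ r(1)] by (intro tendsto_intros) (force simp: o_def)
  have "AE x in lebesgue_on \<Omega>. (\<lambda>n. (norm (\<phi> (r n) x))\<^sup>2) \<longlonglongrightarrow> (norm (v x))\<^sup>2"
    using r(2) by eventually_elim (intro tendsto_intros)
  note F = L2_Fatou[OF test_functions_norm_sq_L2[OF t] _ this ladyzhenskaya_const(2)[OF t] lim]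
  have "(\<lambda>x. (norm (v x))\<^sup>2) \<in> borel_measurable (lebesgue_on \<Omega>)" using L2_measurable[OF L(1)] by measurable
  note F = F[OF this]
  show "v \<in> L4 \<Omega>" using F(1) L(1) by (simp add: L4_def)
  show "L4_norm \<Omega> v \<le> sqrt ladyzhenskaya_const * L2_norm \<Omega> G"
    unfolding L4_norm_def using real_sqrt_le_mono[OF F(2)] by (simp add: real_sqrt_mult)
qed

lemma H10_L4:
  assumes "u \<in> H10 \<Omega>"
  shows "u \<in> L4 \<Omega>" "L4_norm \<Omega> u \<le> sqrt ladyzhenskaya_const * V_norm \<Omega> u"
proof -
  obtain \<phi> where "\<And>n::nat. \<phi> n \<in> test_functions \<Omega>"
    "(\<lambda>n. L2_norm \<Omega> (\<lambda>x. \<phi> n x - u x)) \<longlonglongrightarrow> 0"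
    "(\<lambda>n. L2_norm \<Omega> (\<lambda>x. jac (\<phi> n) x - weak_jac \<Omega> u x)) \<longlonglongrightarrow> 0"
    using H10_approx[OF assms] by blast
  from L4_limit_of_test_functions[OF this(1) H10_L2[OF assms] weak_jac_L2[OF assms] this(2,3)]
  show "u \<in> L4 \<Omega>" "L4_norm \<Omega> u \<le> sqrt ladyzhenskaya_const * V_norm \<Omega> u" by (auto simp: V_norm_def)
qed

lemma test_functions_L4: 
  assumes "\<phi> \<in> test_functions \<Omega>"
  shows "\<phi> \<in> L4 \<Omega>" "L4_norm \<Omega> \<phi> \<le> sqrt ladyzhenskaya_const * L2_norm \<Omega> (jac \<phi>)"
  using L4_limit_of_test_functions[of "\<lambda>n. \<phi>" \<phi> "jac \<phi>"] assms test_functions_L2[OF open_Omega assms]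
    jac_test_L2[OF open_Omega assms] by (auto simp: L2_norm_def L2_inner_def)

lemma H10_approx_L4:
  assumes t: "\<And>n. \<phi> n \<in> test_functions \<Omega>" and u: "u \<in> H10 \<Omega>"
    and l: "(\<lambda>n. L2_norm \<Omega> (\<lambda>x. \<phi> n x - u x)) \<longlonglongrightarrow> 0" "(\<lambda>n. L2_norm \<Omega> (\<lambda>x. jac (\<phi> n) x - weak_jac \<Omega> u x)) \<longlonglongrightarrow> 0"
  shows "(\<lambda>x. u x - \<phi> n x) \<in> L4 \<Omega>"
    "L4_norm \<Omega> (\<lambda>x. u x - \<phi> n x) \<le> sqrt ladyzhenskaya_const * L2_norm \<Omega> (\<lambda>x. weak_jac \<Omega> u x - jac (\<phi> n) x)"
proof -
  have 1: "(\<lambda>x. \<phi> k x - \<phi> n x) \<in> test_functions \<Omega>" for k by (intro test_functions_diff t)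
  have j: "jac (\<lambda>x. \<phi> k x - \<phi> n x) x = jac (\<phi> k) x - jac (\<phi> n) x" for k x
    using test_functions_Cinf[OF t] by (simp add: jac_diff)
  have L: "(\<lambda>x. u x - \<phi> n x) \<in> L2 \<Omega>" "(\<lambda>x. weak_jac \<Omega> u x - jac (\<phi> n) x) \<in> L2 \<Omega>"
    by (rule L2_diff[OF H10_L2[OF u] test_functions_L2[OF open_Omega t]],
        rule L2_diff[OF weak_jac_L2[OF u] jac_test_L2[OF open_Omega t]])
  show "(\<lambda>x. u x - \<phi> n x) \<in> L4 \<Omega>"
    "L4_norm \<Omega> (\<lambda>x. u x - \<phi> n x) \<le> sqrt ladyzhenskaya_const * L2_norm \<Omega> (\<lambda>x. weak_jac \<Omega> u x - jac (\<phi> n) x)"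
    using L4_limit_of_test_functions[OF 1 L] l by (simp_all add: j)
qed

lemma V_L4: "u \<in> V_space \<Omega> \<Longrightarrow> u \<in> L4 \<Omega>"
  by (simp add: H10_L4 V_H10)

lemma weak_jac_V_L2: "u \<in> V_space \<Omega> \<Longrightarrow> weak_jac \<Omega> u \<in> L2 \<Omega>"
  by (simp add: weak_jac_L2 V_H10)

subsection \<open>The trilinear form\<close>

lemma B_pairing_bound:
  assumes "u \<in> V_space \<Omega>" "v \<in> V_space \<Omega>" "w \<in> V_space \<Omega>"
  shows "\<bar>B_pairing \<Omega> u v w\<bar> \<le> ladyzhenskaya_const * V_norm \<Omega> u * V_norm \<Omega> v * V_norm \<Omega> w"
proof -
  have "\<bar>B_pairing \<Omega> u v w\<bar> \<le> V_norm \<Omega> v * L4_norm \<Omega> u * L4_norm \<Omega> w"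
    unfolding B_pairing_convection V_norm_def
    by (intro convection_integrable_bound(2) V_L4 weak_jac_V_L2 assms)
  also have "\<dots> \<le> V_norm \<Omega> v * (sqrt ladyzhenskaya_const * V_norm \<Omega> u) * (sqrt ladyzhenskaya_const * V_norm \<Omega> w)"
    using assms ladyzhenskaya_const(1) by (intro mult_mono H10_L4 V_H10) (auto simp: V_norm_def)
  also have "\<dots> = (sqrt ladyzhenskaya_const * sqrt ladyzhenskaya_const) * V_norm \<Omega> u * V_norm \<Omega> v * V_norm \<Omega> w"
    by (simp add: mult_ac)
  finally show ?thesis using ladyzhenskaya_const(1) by simp
qed

lemma convection_cong_AE:
  assumes "u \<in> L4 \<Omega>" "A \<in> L2 \<Omega>" "A' \<in> L2 \<Omega>" "w \<in> L4 \<Omega>" "AE x in lebesgue_on \<Omega>. A x = A' x"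
  shows "convection \<Omega> u A w = convection \<Omega> u A' w"
  unfolding convection_def
proof (rule integral_cong_AE)
  show "AE x in lebesgue_on \<Omega>. (A x *v u x) \<bullet> w x = (A' x *v u x) \<bullet> w x" using assms(5) by eventually_elim simp
qed (use convection_integrable_bound(1) assms in auto)

lemma B_pairing_diff:
  assumes "u \<in> V_space \<Omega>" "u' \<in> V_space \<Omega>" "v \<in> V_space \<Omega>" "v' \<in> V_space \<Omega>" "w \<in> V_space \<Omega>"
  shows "B_pairing \<Omega> (\<lambda>x. u x - u' x) v w = B_pairing \<Omega> u v w - B_pairing \<Omega> u' v w"
    and "B_pairing \<Omega> u (\<lambda>x. v x - v' x) w = B_pairing \<Omega> u v w - B_pairing \<Omega> u v' w"
proof -
  show "B_pairing \<Omega> (\<lambda>x. u x - u' x) v w = B_pairing \<Omega> u v w - B_pairing \<Omega> u' v w"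
    using convection_linear(1)[of u \<Omega> u' "weak_jac \<Omega> v" "weak_jac \<Omega> v" w w "-1"] assms
    by (simp add: B_pairing_convection V_L4 weak_jac_V_L2)
  have "convection \<Omega> u (weak_jac \<Omega> (\<lambda>x. v x - v' x)) w = convection \<Omega> u (\<lambda>x. weak_jac \<Omega> v x - weak_jac \<Omega> v' x) w"
    by (intro convection_cong_AE weak_jac_diff_AE V_H10 weak_jac_V_L2 V_L4 V_diff L2_diff assms)
  then show "B_pairing \<Omega> u (\<lambda>x. v x - v' x) w = B_pairing \<Omega> u v w - B_pairing \<Omega> u v' w"
    using convection_linear(2)[of u \<Omega> u "weak_jac \<Omega> v" "weak_jac \<Omega> v'" w w "-1"] assms
    by (simp add: B_pairing_convection V_L4 weak_jac_V_L2)
qed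

lemma B_pairing_sum_right:
  assumes "u \<in> V_space \<Omega>" "v \<in> V_space \<Omega>" "\<And>k. k \<in> A \<Longrightarrow> w k \<in> V_space \<Omega>"
  shows "B_pairing \<Omega> u v (\<lambda>x. \<Sum>k\<in>A. c k *\<^sub>R w k x) = (\<Sum>k\<in>A. c k * B_pairing \<Omega> u v (w k))"
  using convection_integrable_bound(1)[OF V_L4[OF assms(1)] weak_jac_V_L2[OF assms(2)] V_L4[OF assms(3)]]
  by (simp add: B_pairing_def inner_sum_right)

text \<open>The integrand is \<open>u \<bullet> \<nabla>(\<phi> \<bullet> \<psi>)\<close>, and \<open>u\<close> is divergence free.\<close>

lemma convection_test_functions_antisymmetric:
  fixes \<phi> \<psi> :: vfield
  assumes u: "div_free \<Omega> u" "u \<in> L4 \<Omega>" and t: "\<phi> \<in> test_functions \<Omega>" "\<psi> \<in> test_functions \<Omega>"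
  shows "convection \<Omega> u (jac \<phi>) \<psi> + convection \<Omega> u (jac \<psi>) \<phi> = 0"
proof -
  have prod: "(\<lambda>x. \<phi> x $ i * \<psi> x $ i) \<in> test_functions \<Omega>" for i
    using test_functions_mult[OF test_functions_bounded_linear[OF bounded_linear_vec_nth t(1)]
        test_functions_Cinf[OF test_functions_bounded_linear[OF bounded_linear_vec_nth t(2)]]] by simp
  have "(\<lambda>x. \<Sum>i\<in>(UNIV::3 set). \<phi> x $ i * \<psi> x $ i) \<in> test_functions \<Omega>"
    by (simp add: sum_3 test_functions_add prod)
  then have inner: "(\<lambda>x. \<phi> x \<bullet> \<psi> x) \<in> test_functions \<Omega>" by (simp add: inner_vec_def)
  have "u x \<bullet> grad (\<lambda>x. \<phi> x \<bullet> \<psi> x) x = (jac \<phi> x *v u x) \<bullet> \<psi> x + (jac \<psi> x *v u x) \<bullet> \<phi> x" for x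
  proof -
    have "((\<lambda>x. \<phi> x \<bullet> \<psi> x) has_derivative
        (\<lambda>e. \<phi> x \<bullet> frechet_derivative \<psi> (at x) e + frechet_derivative \<phi> (at x) e \<bullet> \<psi> x)) (at x)"
      by (intro has_derivative_inner Cinf_on_has_derivative test_functions_Cinf[OF t(1)] test_functions_Cinf[OF t(2)])
    from frechet_derivative_at[OF this, symmetric]
    have "grad (\<lambda>x. \<phi> x \<bullet> \<psi> x) x $ j = (\<Sum>i\<in>UNIV. \<phi> x $ i * jac \<psi> x $ i $ j + jac \<phi> x $ i $ j * \<psi> x $ i)" for j
      by (simp add: grad_def jac_nth inner_vec_def sum.distrib)
    then show ?thesis
      by (simp add: inner_vec_def matrix_vector_mult_def sum_3 algebra_simps)
  qed
  moreover have "(LINT x|lebesgue_on \<Omega>. u x \<bullet> grad (\<lambda>x. \<phi> x \<bullet> \<psi> x) x) = 0"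
    using u(1) inner by (simp add: div_free_def)
  ultimately show ?thesis
    using convection_integrable_bound(1)[OF u(2) jac_test_L2[OF open_Omega t(1)] test_functions_L4(1)[OF t(2)]]
      convection_integrable_bound(1)[OF u(2) jac_test_L2[OF open_Omega t(2)] test_functions_L4(1)[OF t(1)]]
    by (simp add: convection_def)
qed

lemma convection_tendsto:
  assumes t: "\<And>n. \<phi> n \<in> test_functions \<Omega>" "\<And>n. \<psi> n \<in> test_functions \<Omega>" and uvw: "u \<in> L4 \<Omega>" "v \<in> H10 \<Omega>" "w \<in> H10 \<Omega>"
    and l: "(\<lambda>n. L2_norm \<Omega> (\<lambda>x. jac (\<phi> n) x - weak_jac \<Omega> v x)) \<longlonglongrightarrow> 0"
      "(\<lambda>n. L2_norm \<Omega> (\<lambda>x. \<psi> n x - w x)) \<longlonglongrightarrow> 0" "(\<lambda>n. L2_norm \<Omega> (\<lambda>x. jac (\<psi> n) x - weak_jac \<Omega> w x)) \<longlonglongrightarrow> 0"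
  shows "(\<lambda>n. convection \<Omega> u (jac (\<phi> n)) (\<psi> n)) \<longlonglongrightarrow> convection \<Omega> u (weak_jac \<Omega> v) w"
proof -
  let ?V = "weak_jac \<Omega> v" and ?W = "weak_jac \<Omega> w" and ?s = "sqrt ladyzhenskaya_const"
  note L = jac_test_L2[OF open_Omega t(1)] weak_jac_L2[OF uvw(2)] weak_jac_L2[OF uvw(3)]
  note M = test_functions_L4(1)[OF t(2)] H10_L4(1)[OF uvw(3)]
  note D = H10_approx_L4[OF t(2) uvw(3) l(2,3)]
  have s: "0 \<le> ?s" using ladyzhenskaya_const(1) by simp
  define b where "b n = L2_norm \<Omega> (\<lambda>x. jac (\<phi> n) x - ?V x) * L4_norm \<Omega> u * (?s * L2_norm \<Omega> (jac (\<psi> n)))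
     + L2_norm \<Omega> ?V * L4_norm \<Omega> u * (?s * L2_norm \<Omega> (\<lambda>x. jac (\<psi> n) x - ?W x))" for n
  have bound: "\<bar>convection \<Omega> u (jac (\<phi> n)) (\<psi> n) - convection \<Omega> u ?V w\<bar> \<le> b n" for n
  proof -
    have "convection \<Omega> u (\<lambda>x. jac (\<phi> n) x - ?V x) (\<psi> n) = convection \<Omega> u (jac (\<phi> n)) (\<psi> n) - convection \<Omega> u ?V (\<psi> n)"
      using convection_linear(2)[OF uvw(1) uvw(1) L(1)[of n] L(2) M(1)[of n] M(1)[of n], of "-1"] by simp
    moreover have "convection \<Omega> u ?V (\<lambda>x. w x - \<psi> n x) = convection \<Omega> u ?V w - convection \<Omega> u ?V (\<psi> n)"
      using convection_linear(3)[OF uvw(1) uvw(1) L(2) L(2) M(2) M(1)[of n], of "-1"] by simp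
    moreover have "\<bar>convection \<Omega> u (\<lambda>x. jac (\<phi> n) x - ?V x) (\<psi> n)\<bar>
        \<le> L2_norm \<Omega> (\<lambda>x. jac (\<phi> n) x - ?V x) * L4_norm \<Omega> u * (?s * L2_norm \<Omega> (jac (\<psi> n)))"
      by (rule order_trans[OF convection_integrable_bound(2)[OF uvw(1) L2_diff[OF L(1)[of n] L(2)] M(1)[of n]]
          mult_left_mono[OF test_functions_L4(2)[OF t(2)]]]) simp
    moreover have "\<bar>convection \<Omega> u ?V (\<lambda>x. w x - \<psi> n x)\<bar> 
        \<le> L2_norm \<Omega> ?V * L4_norm \<Omega> u * (?s * L2_norm \<Omega> (\<lambda>x. jac (\<psi> n) x - ?W x))"
      unfolding L2_norm_minus_commute[of \<Omega> "jac (\<psi> n)" ?W]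
      by (rule order_trans[OF convection_integrable_bound(2)[OF uvw(1) L(2) D(1)[of n]]
          mult_left_mono[OF D(2)[of n]]]) simp
    ultimately show ?thesis unfolding b_def by linarith
  qed
  have "b \<longlonglongrightarrow> 0 * L4_norm \<Omega> u * (?s * L2_norm \<Omega> ?W) + L2_norm \<Omega> ?V * L4_norm \<Omega> u * (?s * 0)"
    unfolding b_def
    by (intro tendsto_intros l L2_norm_tendsto[OF jac_test_L2[OF open_Omega t(2)] L(3) l(3)])
  then have b0: "b \<longlonglongrightarrow> 0" by simp
  have "(\<lambda>n. convection \<Omega> u (jac (\<phi> n)) (\<psi> n) - convection \<Omega> u ?V w) \<longlonglongrightarrow> 0"
    by (rule Lim_null_comparison[OF _ b0]) (simp add: bound)
  then show ?thesis by (simp add: LIM_zero_iff)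
qed

text \<open>For smooth fields the antisymmetry is the product rule for \<open>\<phi> \<bullet> \<psi>\<close>. Ladyzhenskaya's
  inequality makes the trilinear form continuous, so it survives the passage to \<open>H\<^sup>1\<^sub>0\<close>.\<close>

lemma B_pairing_antisymmetric:
  assumes u: "u \<in> V_space \<Omega>" and v: "v \<in> V_space \<Omega>" and w: "w \<in> V_space \<Omega>"
  shows "B_pairing \<Omega> u v w = - B_pairing \<Omega> u w v"
proof -
  obtain \<phi> where \<phi>: "\<And>n::nat. \<phi> n \<in> test_functions \<Omega>"
    "(\<lambda>n. L2_norm \<Omega> (\<lambda>x. \<phi> n x - v x)) \<longlonglongrightarrow> 0"
    "(\<lambda>n. L2_norm \<Omega> (\<lambda>x. jac (\<phi> n) x - weak_jac \<Omega> v x)) \<longlonglongrightarrow> 0"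
    using H10_approx[OF V_H10[OF v]] by blast
  obtain \<psi> where \<psi>: "\<And>n::nat. \<psi> n \<in> test_functions \<Omega>"
    "(\<lambda>n. L2_norm \<Omega> (\<lambda>x. \<psi> n x - w x)) \<longlonglongrightarrow> 0"
    "(\<lambda>n. L2_norm \<Omega> (\<lambda>x. jac (\<psi> n) x - weak_jac \<Omega> w x)) \<longlonglongrightarrow> 0"
    using H10_approx[OF V_H10[OF w]] by blast
  have "(\<lambda>n. convection \<Omega> u (jac (\<phi> n)) (\<psi> n) + convection \<Omega> u (jac (\<psi> n)) (\<phi> n))
      \<longlonglongrightarrow> B_pairing \<Omega> u v w + B_pairing \<Omega> u w v"
    unfolding B_pairing_convection
    by (intro tendsto_add convection_tendsto V_L4 V_H10 u v w \<phi> \<psi>)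
  moreover have "convection \<Omega> u (jac (\<phi> n)) (\<psi> n) + convection \<Omega> u (jac (\<psi> n)) (\<phi> n) = 0" for n
    using u by (intro convection_test_functions_antisymmetric \<phi> \<psi> V_L4) (simp_all add: V_space_def)
  ultimately have "B_pairing \<Omega> u v w + B_pairing \<Omega> u w v = 0"
    using LIMSEQ_unique[OF _ tendsto_const] by fastforce
  then show ?thesis by linarith
qed

text \<open>Of the four terms in the expansion of \<open>B(y + z, y + z)\<close>, those with \<open>y\<close> in the second place vanish
  against \<open>y\<close>; in \<open>(B(y, z), y)\<close> the last two arguments are exchanged.\<close>

lemma B_pairing_splitting:
  assumes u: "u \<in> V_space \<Omega>" and y: "y \<in> V_space \<Omega>"
  defines "z \<equiv> \<lambda>x. u x - y x"
  shows "B_pairing \<Omega> u u y = - B_pairing \<Omega> y y z + B_pairing \<Omega> z z y"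
proof -
  have z: "z \<in> V_space \<Omega>" unfolding z_def by (rule V_diff[OF u y])
  have y_eq: "y = (\<lambda>x. u x - z x)" by (simp add: z_def)
  have "B_pairing \<Omega> u y y = 0" using B_pairing_antisymmetric[OF u y y] by simp
  then have "B_pairing \<Omega> u u y = B_pairing \<Omega> u z y"
    using B_pairing_diff(2)[OF u u u y y] by (simp add: z_def)
  also have "\<dots> = B_pairing \<Omega> y z y + B_pairing \<Omega> z z y"
    using B_pairing_diff(1)[OF u y z z y] by (simp add: z_def)
  finally show ?thesis using B_pairing_antisymmetric[OF y z y] by simp
qed

end

section \<open>The Hilbert space H\<close>

context bounded_open_set
begin

lemma L2_norm_L1_bound:
  fixes f :: "real^3 \<Rightarrow> 'b::euclidean_space"
  assumes "f \<in> L2 \<Omega>"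
  shows "(\<integral>\<^sup>+x. ennreal (norm (f x)) \<partial>lebesgue_on \<Omega>) \<le> ennreal (L2_norm \<Omega> f * L2_norm \<Omega> (\<lambda>x. 1::real))"
proof -
  note CS = L2_Cauchy_Schwarz_norms[OF assms const_L2[of "1::real"], simplified]
  show ?thesis using CS by (subst nn_integral_eq_integral) (auto intro: ennreal_leI)
qed

text \<open>A subsequence with summable increments converges almost everywhere; Fatou's lemma turns the
  pointwise limit into a limit in norm.\<close>

lemma L2_complete:
  fixes f :: "nat \<Rightarrow> real^3 \<Rightarrow> 'b::euclidean_space"
  assumes f: "\<And>n. f n \<in> L2 \<Omega>"
    and Cauchy: "\<And>e. 0 < e \<Longrightarrow> \<exists>N. \<forall>m\<ge>N. \<forall>n\<ge>N. L2_norm \<Omega> (\<lambda>x. f m x - f n x) \<le> e"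
  obtains g where "g \<in> L2 \<Omega>" "(\<lambda>n. L2_norm \<Omega> (\<lambda>x. f n x - g x)) \<longlonglongrightarrow> 0"
proof -
  have "\<exists>N. \<forall>m\<ge>N. \<forall>n\<ge>N. L2_norm \<Omega> (\<lambda>x. f m x - f n x) \<le> (1/2)^k" for k :: nat
    by (rule Cauchy) simp
  then obtain N where N: "\<And>k m n. m \<ge> N k \<Longrightarrow> n \<ge> N k \<Longrightarrow> L2_norm \<Omega> (\<lambda>x. f m x - f n x) \<le> (1/2)^k"
    by metis
  \<comment> \<open>monotone, above both \<open>k\<close> and \<open>N k\<close>\<close>
  define r where "r k = k + (\<Sum>i\<le>k. N i)" for k
  have rN: "r k \<ge> N k" for k unfolding r_def by (rule trans_le_add2) (rule member_le_sum, auto)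
  have rS: "r (Suc k) \<ge> r k" and rk: "r k \<ge> k" for k by (auto simp: r_def)
  define d where "d k x = f (r (Suc k)) x - f (r k) x" for k x
  have d: "d k \<in> L2 \<Omega>" "L2_norm \<Omega> (d k) \<le> (1/2)^k" for k
    unfolding d_def using rN[of k] rS[of k] by (auto intro!: L2_diff f N)
  have [measurable]: "d k \<in> borel_measurable (lebesgue_on \<Omega>)" "f k \<in> borel_measurable (lebesgue_on \<Omega>)" for k
    using d f by (auto intro: L2_measurable)
  define c where "c = L2_norm \<Omega> (\<lambda>x. 1::real)"
  have "(\<integral>\<^sup>+x. (\<Sum>k. ennreal (norm (d k x))) \<partial>lebesgue_on \<Omega>) = (\<Sum>k. \<integral>\<^sup>+x. ennreal (norm (d k x)) \<partial>lebesgue_on \<Omega>)"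
    by (rule nn_integral_suminf) measurable
  also have "\<dots> \<le> (\<Sum>k. ennreal ((1/2)^k * c))"
  proof (rule suminf_le)
    fix k
    have "L2_norm \<Omega> (d k) * c \<le> (1/2)^k * c" using d(2) by (intro mult_right_mono) (simp_all add: c_def)
    then show "(\<integral>\<^sup>+x. ennreal (norm (d k x)) \<partial>lebesgue_on \<Omega>) \<le> ennreal ((1/2)^k * c)"
      using order_trans[OF L2_norm_L1_bound[OF d(1)] ennreal_leI] by (simp add: c_def)
  qed simp_all
  also have "\<dots> < \<infinity>"
  proof -
    have "summable (\<lambda>k. (1/2::real)^k * c)" by (intro summable_mult2 summable_geometric) simp
    then have "(\<Sum>k. ennreal ((1/2)^k * c)) = ennreal (\<Sum>k. (1/2)^k * c)"
      by (rule suminf_ennreal2[rotated]) (simp add: c_def)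
    then show ?thesis by (simp only: ennreal_less_top infinity_ennreal_def)
  qed
  finally have "AE x in lebesgue_on \<Omega>. (\<Sum>k. ennreal (norm (d k x))) \<noteq> \<infinity>"
    by (intro nn_integral_PInf_AE) auto
  then have conv: "AE x in lebesgue_on \<Omega>. (\<lambda>k. f (r k) x) \<longlonglongrightarrow> lim (\<lambda>k. f (r k) x)"
  proof eventually_elim
    case (elim x)
    then have "summable (\<lambda>k. norm (d k x))" by (intro summable_suminf_not_top) auto
    then have "summable (\<lambda>k. d k x)" by (rule summable_norm_cancel)
    then have "convergent (\<lambda>n. \<Sum>k<n. d k x)" by (simp add: summable_iff_convergent)
    moreover have "(\<Sum>k<n. d k x) = f (r n) x - f (r 0) x" for n
      by (induction n) (simp_all add: d_def)
    ultimately have "convergent (\<lambda>n. (f (r n) x - f (r 0) x) + f (r 0) x)"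
      by (intro convergent_add) (auto intro: convergent_const)
    then show ?case by (simp add: convergent_LIMSEQ_iff)
  qed
  define g where "g x = lim (\<lambda>k. f (r k) x)" for x
  have [measurable]: "g \<in> borel_measurable (lebesgue_on \<Omega>)"
    unfolding g_def by (rule borel_measurable_lim_metric) measurable
  have key: "(\<lambda>x. g x - f n x) \<in> L2 \<Omega>" "L2_norm \<Omega> (\<lambda>x. g x - f n x) \<le> e"
    if e: "\<And>m. m \<ge> M \<Longrightarrow> L2_norm \<Omega> (\<lambda>x. f m x - f n x) \<le> e" for M n e
  proof -
    have lim: "AE x in lebesgue_on \<Omega>. (\<lambda>k. f (r (k + M)) x - f n x) \<longlonglongrightarrow> g x - f n x"
      using conv unfolding g_def
      by eventually_elim (intro tendsto_diff tendsto_const LIMSEQ_ignore_initial_segment)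
    have "L2_norm \<Omega> (\<lambda>x. f (r (k + M)) x - f n x) \<le> e" for k
      using rk[of "k + M"] by (intro e) simp
    from L2_Fatou[OF L2_diff[OF f f] _ lim this tendsto_const]
    show "(\<lambda>x. g x - f n x) \<in> L2 \<Omega>" "L2_norm \<Omega> (\<lambda>x. g x - f n x) \<le> e" by auto
  qed
  have "(\<lambda>x. g x - f (N 0) x) \<in> L2 \<Omega>" by (rule key(1)[of "N 0"]) (rule N, auto)
  from L2_add[OF this f[of "N 0"]] have g: "g \<in> L2 \<Omega>" by simp
  have "(\<lambda>n. L2_norm \<Omega> (\<lambda>x. f n x - g x)) \<longlonglongrightarrow> 0"
  proof (rule LIMSEQ_I)
    fix e :: real assume "0 < e"
    then obtain M where M: "\<And>m n. m \<ge> M \<Longrightarrow> n \<ge> M \<Longrightarrow> L2_norm \<Omega> (\<lambda>x. f m x - f n x) \<le> e / 2"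
      using Cauchy[of "e / 2"] by auto
    have "L2_norm \<Omega> (\<lambda>x. f n x - g x) < e" if "n \<ge> M" for n
    proof -
      have "L2_norm \<Omega> (\<lambda>x. g x - f n x) \<le> e / 2" by (rule key(2)[of M]) (rule M[OF _ that])
      then show ?thesis using \<open>0 < e\<close> unfolding L2_norm_minus_commute[of \<Omega> "f n" g] by linarith
    qed
    then show "\<exists>M. \<forall>n\<ge>M. norm (L2_norm \<Omega> (\<lambda>x. f n x - g x) - 0) < e" by (intro exI[of _ M]) simp
  qed
  then show thesis using that g by blast
qed

lemma H_L2: "u \<in> H_space \<Omega> \<Longrightarrow> u \<in> L2 \<Omega>"
  by (simp add: H_space_def)

lemma H_linear:
  assumes "u \<in> H_space \<Omega>" "v \<in> H_space \<Omega>"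
  shows "(\<lambda>x. u x + c *\<^sub>R v x) \<in> H_space \<Omega>"
proof -
  have L: "u \<in> L2 \<Omega>" "v \<in> L2 \<Omega>" using assms by (auto simp: H_space_def)
  have "(LINT x|lebesgue_on \<Omega>. (u x + c *\<^sub>R v x) \<bullet> g x) = 0" if q: "has_weak_grad \<Omega> q g" for q g
  proof -
    have g: "g \<in> L2 \<Omega>" using q by (simp add: has_weak_grad_def)
    have "(LINT x|lebesgue_on \<Omega>. u x \<bullet> g x) = 0" "(LINT x|lebesgue_on \<Omega>. v x \<bullet> g x) = 0"
      using assms q by (auto simp: H_space_def normal_trace_zero_def)
    then show ?thesis
      using L2_inner_integrable[OF L(1) g] L2_inner_integrable[OF L(2) g] by (simp add: inner_add_left)
  qed
  then show ?thesis
    using assms L by (simp add: H_space_def L2_add L2_scaleR div_free_linear normal_trace_zero_def)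
qed

lemma H_zero: "(\<lambda>x. 0) \<in> H_space \<Omega>"
  by (simp add: H_space_def L2_zero div_free_def normal_trace_zero_def)

lemma H_diff: "u \<in> H_space \<Omega> \<Longrightarrow> v \<in> H_space \<Omega> \<Longrightarrow> (\<lambda>x. u x - v x) \<in> H_space \<Omega>"
  using H_linear[of u v "-1"] by simp

lemma H_scaleR: "u \<in> H_space \<Omega> \<Longrightarrow> (\<lambda>x. c *\<^sub>R u x) \<in> H_space \<Omega>"
  using H_linear[OF H_zero, of u c] by simp

lemma H_sum: "(\<And>k. k \<in> A \<Longrightarrow> v k \<in> H_space \<Omega>) \<Longrightarrow> (\<lambda>x. \<Sum>k\<in>A. c k *\<^sub>R v k x) \<in> H_space \<Omega>"
proof (induction A rule: infinite_finite_induct)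
  case (insert a A)
  have "(\<lambda>x. (\<Sum>k\<in>A. c k *\<^sub>R v k x) + c a *\<^sub>R v a x) \<in> H_space \<Omega>"
    by (rule H_linear) (use insert in auto)
  then show ?case using insert by (simp add: add.commute)
qed (simp_all add: H_zero)

lemma H_closed:
  assumes v: "\<And>n. v n \<in> H_space \<Omega>" and a: "a \<in> L2 \<Omega>" and l: "(\<lambda>n. L2_norm \<Omega> (\<lambda>x. v n x - a x)) \<longlonglongrightarrow> 0"
  shows "a \<in> H_space \<Omega>"
proof -
  have zero: "L2_inner \<Omega> a h = 0" if "h \<in> L2 \<Omega>" "\<And>n. L2_inner \<Omega> (v n) h = 0" for h
    using L2_inner_tendsto[OF H_L2[OF v] a that(1) l] by (simp add: that(2) LIMSEQ_const_iff)
  have "div_free \<Omega> a"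
    unfolding div_free_def L2_inner_def[symmetric]
  proof
    fix \<phi> :: "real^3 \<Rightarrow> real" assume \<phi>: "\<phi> \<in> test_functions \<Omega>"
    have "L2_inner \<Omega> (v n) (grad \<phi>) = 0" for n
      using v[of n] \<phi> by (simp add: H_space_def div_free_def L2_inner_def)
    then show "L2_inner \<Omega> a (grad \<phi>) = 0" by (intro zero grad_test_L2[OF open_Omega \<phi>])
  qed
  moreover have "normal_trace_zero \<Omega> a"
    unfolding normal_trace_zero_def L2_inner_def[symmetric]
  proof (intro allI impI)
    fix q g assume q: "has_weak_grad \<Omega> q g"
    have "L2_inner \<Omega> (v n) g = 0" for n
      using v[of n] q by (simp add: H_space_def normal_trace_zero_def L2_inner_def)
    then show "L2_inner \<Omega> a g = 0" using q by (intro zero) (simp_all add: has_weak_grad_def)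
  qed
  ultimately show ?thesis using a by (simp add: H_space_def)
qed

end

locale orthonormal_basis = bounded_open_set +
  fixes w :: "nat \<Rightarrow> vfield"
  assumes basis: "orthonormal_basis_H \<Omega> w"
begin

lemma w_H: "w k \<in> H_space \<Omega>"
  using basis by (simp add: orthonormal_basis_H_def)

lemma w_L2: "w k \<in> L2 \<Omega>"
  by (rule H_L2[OF w_H])

lemma w_orthonormal: "L2_inner \<Omega> (w i) (w j) = (if i = j then 1 else 0)"
  using basis by (simp add: orthonormal_basis_H_def)

text \<open>Partial expansions with respect to the basis; arbitrary finite index sets also cover the
  differences of two partial expansions.\<close>

definition comb :: "(nat \<Rightarrow> real) \<Rightarrow> nat set \<Rightarrow> vfield" where
  "comb c A = (\<lambda>x. \<Sum>k\<in>A. c k *\<^sub>R w k x)"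

abbreviation coef :: "vfield \<Rightarrow> nat \<Rightarrow> real" where
  "coef v k \<equiv> L2_inner \<Omega> v (w k)"

lemma comb_H: "comb c A \<in> H_space \<Omega>"
  unfolding comb_def by (intro H_sum w_H)

lemma comb_L2: "comb c A \<in> L2 \<Omega>"
  by (rule H_L2[OF comb_H])

lemma inner_comb: "v \<in> L2 \<Omega> \<Longrightarrow> L2_inner \<Omega> v (comb c A) = (\<Sum>k\<in>A. c k * coef v k)"
  unfolding comb_def by (simp add: L2_inner_sum_right L2_scaleR w_L2 L2_inner_scaleR_right)

lemma coef_comb: "finite A \<Longrightarrow> coef (comb c A) k = (if k \<in> A then c k else 0)"
  using inner_comb[OF w_L2, of k c A] by (simp add: L2_inner_commute[of \<Omega> "comb c A"] w_orthonormal if_distrib[of "\<lambda>x. _ * x"] cong: if_cong)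

lemma norm_comb_sq: "finite A \<Longrightarrow> (L2_norm \<Omega> (comb c A))\<^sup>2 = (\<Sum>k\<in>A. (c k)\<^sup>2)"
  unfolding L2_norm_sq by (simp add: inner_comb comb_L2 coef_comb power2_eq_square)

lemma norm_diff_comb_sq:
  assumes "v \<in> L2 \<Omega>" "finite A"
  shows "(L2_norm \<Omega> (\<lambda>x. v x - comb (coef v) A x))\<^sup>2 = (L2_norm \<Omega> v)\<^sup>2 - (\<Sum>k\<in>A. (coef v k)\<^sup>2)"
  using assms unfolding L2_norm_sq
  by (simp add: L2_inner_diff_left L2_inner_diff_right L2_diff comb_L2 inner_comb
      L2_inner_commute[of \<Omega> "comb (coef v) A" v] coef_comb power2_eq_square)

lemma Bessel: "v \<in> L2 \<Omega> \<Longrightarrow> finite A \<Longrightarrow> (\<Sum>k\<in>A. (coef v k)\<^sup>2) \<le> (L2_norm \<Omega> v)\<^sup>2"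
  using norm_diff_comb_sq[of v A] by (smt (verit) zero_le_power2)

lemma comb_tendsto: "v \<in> H_space \<Omega> \<Longrightarrow> (\<lambda>n. L2_norm \<Omega> (\<lambda>x. comb (coef v) {..<n} x - v x)) \<longlonglongrightarrow> 0"
  using basis unfolding orthonormal_basis_H_def comb_def L2_norm_minus_commute[of \<Omega> _ v] by blast

lemma Parseval:
  assumes v: "v \<in> H_space \<Omega>"
  shows "(\<lambda>n. \<Sum>k<n. (coef v k)\<^sup>2) \<longlonglongrightarrow> (L2_norm \<Omega> v)\<^sup>2"
proof -
  have "(\<lambda>n. L2_norm \<Omega> (comb (coef v) {..<n})) \<longlonglongrightarrow> L2_norm \<Omega> v"
    by (rule L2_norm_tendsto[OF comb_L2 H_L2[OF v] comb_tendsto[OF v]])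
  from tendsto_power[OF this, of 2] show ?thesis by (simp add: norm_comb_sq)
qed

lemma inner_series:
  assumes v: "v \<in> H_space \<Omega>" and \<phi>: "\<phi> \<in> L2 \<Omega>"
  shows "(\<lambda>n. \<Sum>k<n. coef v k * coef \<phi> k) \<longlonglongrightarrow> L2_inner \<Omega> v \<phi>"
proof -
  have "(\<lambda>n. L2_inner \<Omega> (comb (coef v) {..<n}) \<phi>) \<longlonglongrightarrow> L2_inner \<Omega> v \<phi>"
    by (rule L2_inner_tendsto[OF comb_L2 H_L2[OF v] \<phi> comb_tendsto[OF v]])
  then show ?thesis unfolding L2_inner_commute[of \<Omega> _ \<phi>] by (simp add: inner_comb \<phi>)
qed

text \<open>Testing the functional on its own partial expansions bounds the sum of the squares of its
  values on the basis by \<open>M\<^sup>2\<close>; completeness provides the field with these coefficients.\<close>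

lemma Riesz_representation:
  assumes lin: "\<And>\<phi> \<psi> c. \<phi> \<in> H_space \<Omega> \<Longrightarrow> \<psi> \<in> H_space \<Omega> \<Longrightarrow> F (\<lambda>x. \<phi> x + c *\<^sub>R \<psi> x) = F \<phi> + c * F \<psi>"
    and bound: "\<And>\<phi>. \<phi> \<in> H_space \<Omega> \<Longrightarrow> \<bar>F \<phi>\<bar> \<le> M * L2_norm \<Omega> \<phi>"
  obtains a where "a \<in> H_space \<Omega>" "\<And>\<phi>. \<phi> \<in> H_space \<Omega> \<Longrightarrow> F \<phi> = L2_inner \<Omega> a \<phi>"
proof -
  have F0: "F (\<lambda>x. 0) = 0" using bound[OF H_zero] by (simp add: L2_norm_def L2_inner_def)
  have F_comb: "F (comb c A) = (\<Sum>k\<in>A. c k * F (w k))" if "finite A" for c A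
    using that
  proof (induction A rule: finite_induct)
    case (insert a A)
    have "comb c (insert a A) = (\<lambda>x. comb c A x + c a *\<^sub>R w a x)"
      using insert by (simp add: comb_def add.commute)
    then show ?case using insert lin[OF comb_H w_H, of c A "c a" a] by (simp add: add.commute)
  qed (simp add: comb_def F0)
  define b where "b k = F (w k)" for k
  have S: "(\<Sum>k\<in>A. (b k)\<^sup>2) \<le> M\<^sup>2" if A: "finite A" for A
  proof -
    define S where "S = (\<Sum>k\<in>A. (b k)\<^sup>2)"
    have "S = F (comb b A)" using A by (simp add: S_def F_comb b_def power2_eq_square)
    also have "\<dots> \<le> M * L2_norm \<Omega> (comb b A)" using bound[OF comb_H, of b A] by linarith
    finally have "L2_norm \<Omega> (comb b A) * L2_norm \<Omega> (comb b A) \<le> M * L2_norm \<Omega> (comb b A)"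
      using norm_comb_sq[OF A, of b] by (simp add: S_def power2_eq_square)
    then have "L2_norm \<Omega> (comb b A) = 0 \<or> L2_norm \<Omega> (comb b A) \<le> M"
      by (metis L2_norm_nonneg less_eq_real_def mult_right_le_imp_le)
    then have "(L2_norm \<Omega> (comb b A))\<^sup>2 \<le> M\<^sup>2"
      by (auto intro: power_mono)
    then show ?thesis using norm_comb_sq[OF A, of b] by simp
  qed
  have "summable (\<lambda>k. (b k)\<^sup>2)"
    by (rule bounded_imp_summable[of _ "M\<^sup>2"]) (auto intro: S)
  then have Cauchy_sum: "Cauchy (\<lambda>n. \<Sum>k<n. (b k)\<^sup>2)"
    by (simp add: summable_iff_convergent convergent_Cauchy)
  have diff: "(L2_norm \<Omega> (\<lambda>x. comb b {..<m} x - comb b {..<n} x))\<^sup>2 = (\<Sum>k<m. (b k)\<^sup>2) - (\<Sum>k<n. (b k)\<^sup>2)"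
    if "n \<le> m" for m n
  proof -
    have un: "{..<m} = {..<n} \<union> {n..<m}" "{..<n} \<inter> {n..<m} = {}" using that by auto
    have "(\<lambda>x. comb b {..<m} x - comb b {..<n} x) = comb b {n..<m}"
      unfolding comb_def un(1) by (subst sum.union_disjoint) auto
    then show ?thesis unfolding un(1) by (subst sum.union_disjoint) (auto simp: norm_comb_sq)
  qed
  have Cauchy_comb: "\<exists>N. \<forall>m\<ge>N. \<forall>n\<ge>N. L2_norm \<Omega> (\<lambda>x. comb b {..<m} x - comb b {..<n} x) \<le> e"
    if "0 < e" for e :: real
  proof -
    obtain N where N: "\<And>m n. m \<ge> N \<Longrightarrow> n \<ge> N \<Longrightarrow> norm ((\<Sum>k<m. (b k)\<^sup>2) - (\<Sum>k<n. (b k)\<^sup>2)) < e\<^sup>2"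
      using CauchyD[OF Cauchy_sum, of "e\<^sup>2"] \<open>0 < e\<close> by auto
    have le: "L2_norm \<Omega> (\<lambda>x. comb b {..<m} x - comb b {..<n} x) \<le> e" if "m \<ge> N" "n \<ge> N" "n \<le> m" for m n
    proof (rule power2_le_imp_le)
      show "(L2_norm \<Omega> (\<lambda>x. comb b {..<m} x - comb b {..<n} x))\<^sup>2 \<le> e\<^sup>2"
        using N[OF that(1,2)] unfolding diff[OF that(3)] by simp
    qed (use \<open>0 < e\<close> in simp)
    have "L2_norm \<Omega> (\<lambda>x. comb b {..<m} x - comb b {..<n} x) \<le> e" if "m \<ge> N" "n \<ge> N" for m n
    proof (cases "n \<le> m")
      case False
      then show ?thesis
        using le[of n m] that unfolding L2_norm_minus_commute[of \<Omega> "comb b {..<m}" "comb b {..<n}"] by simp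
    qed (use le that in blast)
    then show "\<exists>N. \<forall>m\<ge>N. \<forall>n\<ge>N. L2_norm \<Omega> (\<lambda>x. comb b {..<m} x - comb b {..<n} x) \<le> e" by blast
  qed
  obtain a where a: "a \<in> L2 \<Omega>" "(\<lambda>n. L2_norm \<Omega> (\<lambda>x. comb b {..<n} x - a x)) \<longlonglongrightarrow> 0"
    by (rule L2_complete[OF comb_L2 Cauchy_comb])
  have aH: "a \<in> H_space \<Omega>" by (rule H_closed[OF comb_H a])
  have a_coef: "coef a k = b k" for k
  proof -
    have "(\<lambda>n. coef (comb b {..<n}) k) \<longlonglongrightarrow> coef a k" by (rule L2_inner_tendsto[OF comb_L2 a(1) w_L2 a(2)])
    moreover have "\<forall>\<^sub>F n in sequentially. coef (comb b {..<n}) k = b k"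
      by (rule eventually_sequentiallyI[of "Suc k"]) (simp add: coef_comb)
    ultimately show ?thesis using tendsto_eventually LIMSEQ_unique by metis
  qed
  have "F \<phi> = L2_inner \<Omega> a \<phi>" if \<phi>: "\<phi> \<in> H_space \<Omega>" for \<phi>
  proof -
    have "(\<lambda>n. F (comb (coef \<phi>) {..<n}) - F \<phi>) \<longlonglongrightarrow> 0"
    proof (rule Lim_null_comparison)
      show "(\<lambda>n. M * L2_norm \<Omega> (\<lambda>x. comb (coef \<phi>) {..<n} x - \<phi> x)) \<longlonglongrightarrow> 0"
        using tendsto_mult_left[OF comb_tendsto[OF \<phi>], of M] by simp
      show "\<forall>\<^sub>F n in sequentially. norm (F (comb (coef \<phi>) {..<n}) - F \<phi>) \<le> M * L2_norm \<Omega> (\<lambda>x. comb (coef \<phi>) {..<n} x - \<phi> x)"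
        using bound[OF H_diff[OF comb_H \<phi>]] lin[OF comb_H \<phi>, where c = "-1"] by simp
    qed
    moreover have "F (comb (coef \<phi>) {..<n}) = (\<Sum>k<n. coef \<phi> k * coef a k)" for n
      by (simp add: F_comb a_coef b_def)
    ultimately have "(\<lambda>n. \<Sum>k<n. coef \<phi> k * coef a k) \<longlonglongrightarrow> F \<phi>" by (simp add: LIM_zero_iff)
    then show ?thesis
      using inner_series[OF \<phi> a(1)] LIMSEQ_unique L2_inner_commute by metis
  qed
  then show thesis using that aH by blast
qed

text \<open>Along a diagonal subsequence all coefficients converge. By density and boundedness all
  pairings then converge, and the limit is represented by a field of \<open>H\<close>.\<close>

lemma weak_compactness:
  assumes v: "\<And>n::nat. v n \<in> H_space \<Omega>" "\<And>n. L2_norm \<Omega> (v n) \<le> C"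
  obtains r :: "nat \<Rightarrow> nat" and a where "strict_mono r" "a \<in> H_space \<Omega>" "weakly_converges_H \<Omega> (\<lambda>n. v (r n)) a"
proof -
  have C0: "0 \<le> C" using v(2)[of 0] L2_norm_nonneg[of \<Omega> "v 0"] by linarith
  have vb: "\<bar>L2_inner \<Omega> (v n) \<phi>\<bar> \<le> C * L2_norm \<Omega> \<phi>" if "\<phi> \<in> H_space \<Omega>" for n \<phi>
    using L2_Cauchy_Schwarz[OF H_L2[OF v(1)[of n]] H_L2[OF that]] mult_right_mono[OF v(2)[of n] L2_norm_nonneg[of \<Omega> \<phi>]]
    by linarith
  interpret subseqs "\<lambda>k s. convergent (\<lambda>n. coef (v (s n)) k)"
  proof
    fix k and s :: "nat \<Rightarrow> nat" assume "strict_mono s"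
    have "bounded (range (\<lambda>n. coef (v (s n)) k))"
      using vb[OF w_H] by (intro boundedI[of _ "C * L2_norm \<Omega> (w k)"]) auto
    from bounded_imp_convergent_subsequence[OF this]
    show "\<exists>r. strict_mono r \<and> convergent (\<lambda>n. coef (v ((s \<circ> r) n)) k)"
      by (auto simp: o_def convergent_def)
  qed
  define r where "r = diagseq"
  have r: "strict_mono r" unfolding r_def by (rule subseq_diagseq)
  have conv_coef: "convergent (\<lambda>n. coef (v (r n)) k)" for k
  proof -
    have "convergent (\<lambda>n. coef (v ((diagseq \<circ> (+) (Suc k)) n)) k)"
    proof (rule diagseq_holds)
      fix n and s t :: "nat \<Rightarrow> nat"
      assume "strict_mono t" "convergent (\<lambda>i. coef (v (s i)) n)"
      then show "convergent (\<lambda>i. coef (v ((s \<circ> t) i)) n)"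
        using convergent_subseq_convergent[of "\<lambda>i. coef (v (s i)) n" t] by (simp add: o_def)
    qed
    then have "convergent (\<lambda>n. coef (v (r (n + Suc k))) k)" by (simp add: r_def o_def add.commute)
    then show ?thesis using convergent_ignore_initial_segment[of "\<lambda>n. coef (v (r n)) k" "Suc k"] by blast
  qed
  have conv: "convergent (\<lambda>n. L2_inner \<Omega> (v (r n)) \<phi>)" if \<phi>: "\<phi> \<in> H_space \<Omega>" for \<phi>
  proof (rule Cauchy_convergent, rule metric_CauchyI)
    fix e :: real assume e: "0 < e"
    \<comment> \<open>\<open>C\<close> may be 0\<close>
    define \<eta> where "\<eta> = e / (4 * (C + 1))"
    have "0 < \<eta>" using e C0 by (simp add: \<eta>_def)
    then obtain N where N: "L2_norm \<Omega> (\<lambda>x. comb (coef \<phi>) {..<N} x - \<phi> x) < \<eta>"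
      using order_tendstoD(2)[OF comb_tendsto[OF \<phi>], of \<eta>] by (auto simp: eventually_sequentially)
    let ?p = "comb (coef \<phi>) {..<N}"
    have close: "\<bar>L2_inner \<Omega> (v n) ?p - L2_inner \<Omega> (v n) \<phi>\<bar> \<le> e / 4" for n
    proof -
      have "\<bar>L2_inner \<Omega> (v n) ?p - L2_inner \<Omega> (v n) \<phi>\<bar> \<le> C * L2_norm \<Omega> (\<lambda>x. ?p x - \<phi> x)"
        using vb[OF H_diff[OF comb_H \<phi>]] by (simp add: L2_inner_diff_right comb_L2 H_L2 \<phi> v)
      also have "\<dots> \<le> (C + 1) * \<eta>" using N C0 \<open>0 < \<eta>\<close> by (intro mult_mono) auto
      also have "\<dots> = e / 4" using C0 by (simp add: \<eta>_def field_simps)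
      finally show ?thesis .
    qed
    have "convergent (\<lambda>n. \<Sum>k<N. coef \<phi> k * coef (v (r n)) k)"
      by (intro convergent_sum convergent_mult convergent_const conv_coef)
    then have "Cauchy (\<lambda>n. L2_inner \<Omega> (v (r n)) ?p)"
      by (simp add: inner_comb H_L2 v convergent_Cauchy)
    then obtain M where M: "\<And>m n. m \<ge> M \<Longrightarrow> n \<ge> M \<Longrightarrow> \<bar>L2_inner \<Omega> (v (r m)) ?p - L2_inner \<Omega> (v (r n)) ?p\<bar> < e / 4"
      using CauchyD[of _ "e / 4"] e by fastforce
    have "dist (L2_inner \<Omega> (v (r m)) \<phi>) (L2_inner \<Omega> (v (r n)) \<phi>) < e" if "m \<ge> M" "n \<ge> M" for m n
      using M[OF that] close[of "r m"] close[of "r n"] e unfolding dist_real_def by linarith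
    then show "\<exists>M. \<forall>m\<ge>M. \<forall>n\<ge>M. dist (L2_inner \<Omega> (v (r m)) \<phi>) (L2_inner \<Omega> (v (r n)) \<phi>) < e" by blast
  qed
  define F where "F \<phi> = lim (\<lambda>n. L2_inner \<Omega> (v (r n)) \<phi>)" for \<phi>
  have F: "(\<lambda>n. L2_inner \<Omega> (v (r n)) \<phi>) \<longlonglongrightarrow> F \<phi>" if "\<phi> \<in> H_space \<Omega>" for \<phi>
    using conv[OF that] by (simp add: F_def convergent_LIMSEQ_iff)
  have lin: "F (\<lambda>x. \<phi> x + c *\<^sub>R \<psi> x) = F \<phi> + c * F \<psi>" if "\<phi> \<in> H_space \<Omega>" "\<psi> \<in> H_space \<Omega>" for \<phi> \<psi> c
  proof (rule LIMSEQ_unique[OF F[OF H_linear[OF that]]])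
    have "L2_inner \<Omega> (v n) (\<lambda>x. \<phi> x + c *\<^sub>R \<psi> x) = L2_inner \<Omega> (v n) \<phi> + c * L2_inner \<Omega> (v n) \<psi>" for n
      using that v(1) by (simp add: L2_inner_add_right L2_inner_scaleR_right H_L2 L2_scaleR)
    then show "(\<lambda>n. L2_inner \<Omega> (v (r n)) (\<lambda>x. \<phi> x + c *\<^sub>R \<psi> x)) \<longlonglongrightarrow> F \<phi> + c * F \<psi>"
      using that by (auto intro!: tendsto_intros F)
  qed
  have bnd: "\<bar>F \<phi>\<bar> \<le> C * L2_norm \<Omega> \<phi>" if "\<phi> \<in> H_space \<Omega>" for \<phi>
    using tendsto_rabs[OF F[OF that]] vb[OF that] by (intro LIMSEQ_le_const2) auto
  obtain a where "a \<in> H_space \<Omega>" "\<And>\<phi>. \<phi> \<in> H_space \<Omega> \<Longrightarrow> F \<phi> = L2_inner \<Omega> a \<phi>"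
    using Riesz_representation[of F, OF lin bnd] by blast
  then show thesis using that[OF r] F by (auto simp: weakly_converges_H_def)
qed

text \<open>The projection is defined by a definite description over functions, not classes; it denotes since
  orthogonality to the \<open>w\<^sub>k\<close> determines the coefficients, and these determine the function.\<close>

lemma P_proj_eq:
  assumes v: "v \<in> L2 \<Omega>"
  shows "P_proj \<Omega> w m v = comb (coef v) {..<m}"
  unfolding P_proj_def
proof (rule the_equality)
  have "L2_inner \<Omega> (\<lambda>x. v x - comb (coef v) {..<m} x) (comb c {..<m}) = 0" for c
    using v by (simp add: L2_inner_diff_left comb_L2 inner_comb coef_comb)
  then show "comb (coef v) {..<m} \<in> span_first w m \<and>
      (\<forall>q\<in>span_first w m. L2_inner \<Omega> (\<lambda>x. v x - comb (coef v) {..<m} x) q = 0)"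
    by (auto simp: span_first_def comb_def)
next
  fix p assume p: "p \<in> span_first w m \<and> (\<forall>q\<in>span_first w m. L2_inner \<Omega> (\<lambda>x. v x - p x) q = 0)"
  then obtain c where c: "p = comb c {..<m}" by (auto simp: span_first_def comb_def)
  have "c k = coef v k" if k: "k < m" for k
  proof -
    have "comb (\<lambda>i. if i = k then 1 else 0) {..<m} = w k"
      using k by (simp add: comb_def fun_eq_iff if_distrib[of "\<lambda>x. x *\<^sub>R _"] cong: if_cong)
    moreover have "comb (\<lambda>i. if i = k then 1 else 0) {..<m} \<in> span_first w m"
      by (auto simp: span_first_def comb_def)
    ultimately have "coef (\<lambda>x. v x - comb c {..<m} x) k = 0" using p c by auto
    then show ?thesis using v k by (simp add: L2_inner_diff_left comb_L2 w_L2 coef_comb)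
  qed
  then show "p = comb (coef v) {..<m}" by (simp add: c comb_def)
qed

lemma Q_proj_H: "v \<in> H_space \<Omega> \<Longrightarrow> Q_proj \<Omega> w m v \<in> H_space \<Omega>"
  by (simp add: Q_proj_def P_proj_eq H_L2 H_diff comb_H)

lemma coef_Q_proj: "v \<in> L2 \<Omega> \<Longrightarrow> coef (Q_proj \<Omega> w m v) k = (if k < m then 0 else coef v k)"
  by (simp add: Q_proj_def P_proj_eq L2_inner_diff_left comb_L2 w_L2 coef_comb)

lemma norm_Q_proj_le:
  assumes v: "v \<in> L2 \<Omega>"
  shows "L2_norm \<Omega> (Q_proj \<Omega> w m v) \<le> L2_norm \<Omega> v"
proof (rule power2_le_imp_le)
  show "(L2_norm \<Omega> (Q_proj \<Omega> w m v))\<^sup>2 \<le> (L2_norm \<Omega> v)\<^sup>2"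
    unfolding Q_proj_def P_proj_eq[OF v] norm_diff_comb_sq[OF v finite_lessThan] by (simp add: sum_nonneg)
qed simp

end

section \<open>Functions of time\<close>

lemma simple_in_measurable:
  fixes F :: "vfield \<Rightarrow> real"
  assumes "simple_in X I s" "I \<in> sets lebesgue"
  shows "(\<lambda>t. F (s t)) \<in> borel_measurable (lebesgue_on I)"
proof -
  have "simple_function (lebesgue_on I) s"
    unfolding simple_function_def
  proof (intro conjI ballI)
    fix v assume "v \<in> s ` space (lebesgue_on I)"
    have "s -` {v} \<inter> space (lebesgue_on I) = {t \<in> I. s t = v}" by auto
    then show "s -` {v} \<inter> space (lebesgue_on I) \<in> sets (lebesgue_on I)"
      using assms by (simp add: simple_in_def sets_restrict_space_iff)
  qed (use assms in \<open>simp add: simple_in_def\<close>)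
  then have "simple_function (lebesgue_on I) (\<lambda>t. F (s t))" by (rule simple_function_compose1)
  then show ?thesis by (rule borel_measurable_simple_function)
qed

lemma simple_in_integral:
  fixes F :: "vfield \<Rightarrow> real"
  assumes s: "simple_in X I s" and I: "I \<in> lmeasurable"
  shows "integrable (lebesgue_on I) (\<lambda>t. F (s t))"
    and "(LINT t|lebesgue_on I. F (s t)) = (\<Sum>v\<in>s ` I. measure lebesgue {t \<in> I. s t = v} * F v)"
proof -
  let ?L = "\<lambda>v. {t \<in> I. s t = v}"
  have fin: "finite (s ` I)" and L: "?L v \<in> sets lebesgue" for v using s by (auto simp: simple_in_def)
  have Is: "I \<in> sets lebesgue" using I by (simp add: fmeasurable_def)
  have LI: "?L v \<in> sets (lebesgue_on I)" for v using L Is by (simp add: sets_restrict_space_iff)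
  have fm: "emeasure (lebesgue_on I) (?L v) < \<infinity>" for v
  proof -
    have "emeasure (lebesgue_on I) (?L v) = emeasure lebesgue (?L v)"
      using Is by (intro emeasure_restrict_space) auto
    also have "\<dots> \<le> emeasure lebesgue I" using Is by (intro emeasure_mono) auto
    also have "\<dots> < \<infinity>" using I unfolding fmeasurable_def infinity_ennreal_def by blast
    finally show ?thesis .
  qed
  have int: "integrable (lebesgue_on I) (\<lambda>t. F v * indicator (?L v) t)" for v
    using LI fm by (intro integrable_mult_right integrable_real_indicator)
  have eq: "F (s t) = (\<Sum>v\<in>s ` I. F v * indicator (?L v) t)" if "t \<in> I" for t
    using that fin by (simp add: indicator_def if_distrib[of "\<lambda>x. _ * x"] cong: if_cong)
  have "integrable (lebesgue_on I) (\<lambda>t. \<Sum>v\<in>s ` I. F v * indicator (?L v) t)"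
    by (intro Bochner_Integration.integrable_sum int)
  then show "integrable (lebesgue_on I) (\<lambda>t. F (s t))"
    by (rule Bochner_Integration.integrable_cong[THEN iffD1, rotated -1]) (auto simp: eq)
  have "(LINT t|lebesgue_on I. F (s t)) = (LINT t|lebesgue_on I. (\<Sum>v\<in>s ` I. F v * indicator (?L v) t))"
    by (rule Bochner_Integration.integral_cong) (auto simp: eq)
  also have "\<dots> = (\<Sum>v\<in>s ` I. (LINT t|lebesgue_on I. F v * indicator (?L v) t))"
    by (rule Bochner_Integration.integral_sum) (rule int)
  also have "\<dots> = (\<Sum>v\<in>s ` I. measure lebesgue (?L v) * F v)"
  proof (rule sum.cong)
    fix v
    have "measure (lebesgue_on I) (?L v) = measure lebesgue (?L v)"
      using Is by (intro measure_restrict_space) auto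
    moreover have "?L v \<inter> I = ?L v" by auto
    ultimately show "(LINT t|lebesgue_on I. F v * indicator (?L v) t) = measure lebesgue (?L v) * F v"
      by simp
  qed simp
  finally show "(LINT t|lebesgue_on I. F (s t)) = (\<Sum>v\<in>s ` I. measure lebesgue (?L v) * F v)" .
qed

lemma AE_limit_measurable:
  fixes g :: "real \<Rightarrow> real"
  assumes f: "\<And>n::nat. f n \<in> borel_measurable (lebesgue_on I)" and I: "I \<in> sets lebesgue"
    and lim: "AE t in lebesgue_on I. (\<lambda>n. f n t) \<longlonglongrightarrow> g t"
  shows "g \<in> borel_measurable (lebesgue_on I)"
proof -
  have "(\<lambda>t. lim (\<lambda>n. f n t)) \<in> borel_measurable (lebesgue_on I)"
    by (rule borel_measurable_lim_metric[OF f])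
  then have "(\<lambda>t. if t \<in> I then lim (\<lambda>n. f n t) else 0) \<in> borel_measurable lebesgue"
    using I by (simp add: borel_measurable_if)
  moreover have "AE t in lebesgue. t \<in> I \<longrightarrow> (\<lambda>n. f n t) \<longlonglongrightarrow> g t"
    using lim I by (simp add: AE_restrict_space_iff)
  then have "AE t in lebesgue. (if t \<in> I then lim (\<lambda>n. f n t) else 0) = (if t \<in> I then g t else 0)"
    by eventually_elim (auto dest: limI)
  ultimately have "(\<lambda>t. if t \<in> I then g t else 0) \<in> borel_measurable lebesgue"
    by (rule borel_measurable_AE)
  then show ?thesis using I by (simp add: borel_measurable_if)
qed

context orthonormal_basis
begin

subsection \<open>Bochner integrals of weakly continuous functions\<close>

text \<open>Continuity against the basis fields suffices, because pairings with other fields of \<open>H\<close> are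
  pointwise limits of combinations of the coefficients. The bound is only assumed almost everywhere,
  as for a solution in \<open>L\<^sup>\<infinity>(H)\<close>.\<close>

definition weakly_continuous_path :: "real \<Rightarrow> real \<Rightarrow> (real \<Rightarrow> vfield) \<Rightarrow> bool" where
  "weakly_continuous_path T C \<psi> \<longleftrightarrow> 0 < T \<and> (\<forall>t\<in>{0..T}. \<psi> t \<in> H_space \<Omega>) \<and>
     (\<forall>k. continuous_on {0..T} (\<lambda>t. coef (\<psi> t) k)) \<and>
     (AE t in lebesgue_on {0..T}. L2_norm \<Omega> (\<psi> t) \<le> C)"

lemma simple_time_integral_inner:
  assumes s: "simple_in (H_space \<Omega>) I s" and I: "I \<in> lmeasurable" and \<phi>: "\<phi> \<in> H_space \<Omega>"
  shows "simple_time_integral I s \<in> H_space \<Omega>"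
    and "L2_inner \<Omega> (simple_time_integral I s) \<phi> = (LINT t|lebesgue_on I. L2_inner \<Omega> (s t) \<phi>)"
proof -
  have sH: "v \<in> H_space \<Omega>" if "v \<in> s ` I" for v using s that by (auto simp: simple_in_def)
  show "simple_time_integral I s \<in> H_space \<Omega>"
    unfolding simple_time_integral_def by (rule H_sum) (rule sH)
  show "L2_inner \<Omega> (simple_time_integral I s) \<phi> = (LINT t|lebesgue_on I. L2_inner \<Omega> (s t) \<phi>)"
    unfolding simple_time_integral_def simple_in_integral(2)[OF s I, of "\<lambda>v. L2_inner \<Omega> v \<phi>"]
    by (subst L2_inner_sum_left) (simp_all add: L2_inner_scaleR_left L2_scaleR H_L2 sH \<phi>)
qed

context
  fixes T C :: real and \<psi> :: "real \<Rightarrow> vfield"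
  assumes path: "weakly_continuous_path T C \<psi>"
begin

lemma path_T: "0 < T" and path_H: "t \<in> {0..T} \<Longrightarrow> \<psi> t \<in> H_space \<Omega>"
  and path_bound: "AE t in lebesgue_on {0..T}. L2_norm \<Omega> (\<psi> t) \<le> C"
  using path by (auto simp: weakly_continuous_path_def)

lemma path_coef_measurable: "(\<lambda>t. coef (\<psi> t) k) \<in> borel_measurable (lebesgue_on {0..T})"
  using path by (intro continuous_imp_measurable_on_sets_lebesgue) (auto simp: weakly_continuous_path_def)

lemma path_inner_measurable:
  assumes "\<phi> \<in> H_space \<Omega>"
  shows "(\<lambda>t. L2_inner \<Omega> (\<psi> t) \<phi>) \<in> borel_measurable (lebesgue_on {0..T})"
proof (rule borel_measurable_LIMSEQ_real)
  show "(\<lambda>t. \<Sum>k<n. coef (\<psi> t) k * coef \<phi> k) \<in> borel_measurable (lebesgue_on {0..T})" for n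
    by (intro borel_measurable_sum borel_measurable_times path_coef_measurable borel_measurable_const)
  show "(\<lambda>n. \<Sum>k<n. coef (\<psi> t) k * coef \<phi> k) \<longlonglongrightarrow> L2_inner \<Omega> (\<psi> t) \<phi>"
    if "t \<in> space (lebesgue_on {0..T})" for t
    using that by (intro inner_series path_H H_L2 assms) simp
qed

text \<open>Parseval's identity makes the distance to a simple function measurable in time.\<close>

lemma path_distance_measurable:
  assumes s: "simple_in (H_space \<Omega>) {0..T} s"
  shows "(\<lambda>t. L2_norm \<Omega> (\<lambda>x. s t x - \<psi> t x)) \<in> borel_measurable (lebesgue_on {0..T})"
proof -
  have "(\<lambda>t. (L2_norm \<Omega> (\<lambda>x. s t x - \<psi> t x))\<^sup>2) \<in> borel_measurable (lebesgue_on {0..T})"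
  proof (rule borel_measurable_LIMSEQ_real)
    show "(\<lambda>t. \<Sum>k<n. (coef (s t) k - coef (\<psi> t) k)\<^sup>2) \<in> borel_measurable (lebesgue_on {0..T})" for n
      by (intro borel_measurable_sum borel_measurable_power borel_measurable_diff path_coef_measurable
          simple_in_measurable[OF s]) auto
    fix t assume t: "t \<in> space (lebesgue_on {0..T})"
    have sH: "s t \<in> H_space \<Omega>" using s t by (auto simp: simple_in_def)
    have "coef (\<lambda>x. s t x - \<psi> t x) k = coef (s t) k - coef (\<psi> t) k" for k
      using t by (intro L2_inner_diff_left H_L2 sH path_H w_H) simp
    then show "(\<lambda>n. \<Sum>k<n. (coef (s t) k - coef (\<psi> t) k)\<^sup>2) \<longlonglongrightarrow> (L2_norm \<Omega> (\<lambda>x. s t x - \<psi> t x))\<^sup>2"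
      using Parseval[OF H_diff[OF sH path_H[of t]]] t by simp
  qed
  then have "(\<lambda>t. sqrt ((L2_norm \<Omega> (\<lambda>x. s t x - \<psi> t x))\<^sup>2)) \<in> borel_measurable (lebesgue_on {0..T})"
    by measurable
  then show ?thesis by simp
qed

lemma path_inner_integrable:
  assumes \<phi>: "\<phi> \<in> H_space \<Omega>"
  shows "integrable (lebesgue_on {0..T}) (\<lambda>t. L2_inner \<Omega> (\<psi> t) \<phi>)"
    and "\<bar>LINT t|lebesgue_on {0..T}. L2_inner \<Omega> (\<psi> t) \<phi>\<bar> \<le> T * C * L2_norm \<Omega> \<phi>"
proof -
  have fm: "finite_measure (lebesgue_on {0..T})"
    by (rule finite_measure_lebesgue_on) simp
  have "AE t in lebesgue_on {0..T}. t \<in> {0..T}" by (intro AE_I2) simp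
  then have bnd: "AE t in lebesgue_on {0..T}. norm (L2_inner \<Omega> (\<psi> t) \<phi>) \<le> C * L2_norm \<Omega> \<phi>"
    using path_bound
  proof eventually_elim
    case (elim t)
    have "\<bar>L2_inner \<Omega> (\<psi> t) \<phi>\<bar> \<le> L2_norm \<Omega> (\<psi> t) * L2_norm \<Omega> \<phi>"
      using elim(1) by (intro L2_Cauchy_Schwarz H_L2 path_H \<phi>)
    also have "\<dots> \<le> C * L2_norm \<Omega> \<phi>" using elim(2) by (intro mult_right_mono) auto
    finally show ?case by simp
  qed
  show int: "integrable (lebesgue_on {0..T}) (\<lambda>t. L2_inner \<Omega> (\<psi> t) \<phi>)"
    by (rule finite_measure.integrable_const_bound[OF fm bnd path_inner_measurable[OF \<phi>]])
  have "\<bar>LINT t|lebesgue_on {0..T}. L2_inner \<Omega> (\<psi> t) \<phi>\<bar> \<le> (LINT t|lebesgue_on {0..T}. norm (L2_inner \<Omega> (\<psi> t) \<phi>))"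
    using integral_norm_bound[of "lebesgue_on {0..T}" "\<lambda>t. L2_inner \<Omega> (\<psi> t) \<phi>"] by simp
  also have "\<dots> \<le> (LINT t|lebesgue_on {0..T}. C * L2_norm \<Omega> \<phi>)"
    using int bnd finite_measure.integrable_const[OF fm] by (intro integral_mono_AE) auto
  also have "\<dots> = T * C * L2_norm \<Omega> \<phi>"
    using path_T by (simp add: measure_restrict_space)
  finally show "\<bar>LINT t|lebesgue_on {0..T}. L2_inner \<Omega> (\<psi> t) \<phi>\<bar> \<le> T * C * L2_norm \<Omega> \<phi>" .
qed

lemma simple_time_integral_close:
  assumes s: "simple_in (H_space \<Omega>) {0..T} s"
    and int: "integrable (lebesgue_on {0..T}) (\<lambda>t. L2_norm \<Omega> (\<lambda>x. s t x - \<psi> t x))"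
    and \<phi>: "\<phi> \<in> H_space \<Omega>"
  shows "\<bar>L2_inner \<Omega> (simple_time_integral {0..T} s) \<phi> - (LINT t|lebesgue_on {0..T}. L2_inner \<Omega> (\<psi> t) \<phi>)\<bar>
    \<le> (LINT t|lebesgue_on {0..T}. L2_norm \<Omega> (\<lambda>x. s t x - \<psi> t x)) * L2_norm \<Omega> \<phi>"
proof -
  let ?M = "lebesgue_on {0..T}"
  have I: "{0..T} \<in> lmeasurable" by simp
  note si = simple_in_integral(1)[OF s I, of "\<lambda>v. L2_inner \<Omega> v \<phi>"]
  have "L2_inner \<Omega> (simple_time_integral {0..T} s) \<phi> - (LINT t|?M. L2_inner \<Omega> (\<psi> t) \<phi>)
      = (LINT t|?M. L2_inner \<Omega> (s t) \<phi> - L2_inner \<Omega> (\<psi> t) \<phi>)"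
    unfolding simple_time_integral_inner(2)[OF s I \<phi>]
    by (rule Bochner_Integration.integral_diff[symmetric, OF si path_inner_integrable(1)[OF \<phi>]])
  also have "\<bar>\<dots>\<bar> \<le> (LINT t|?M. norm (L2_inner \<Omega> (s t) \<phi> - L2_inner \<Omega> (\<psi> t) \<phi>))"
    using integral_norm_bound[of ?M "\<lambda>t. L2_inner \<Omega> (s t) \<phi> - L2_inner \<Omega> (\<psi> t) \<phi>"] by simp
  also have "\<dots> \<le> (LINT t|?M. L2_norm \<Omega> (\<lambda>x. s t x - \<psi> t x) * L2_norm \<Omega> \<phi>)"
  proof (rule integral_mono)
    show "integrable ?M (\<lambda>t. norm (L2_inner \<Omega> (s t) \<phi> - L2_inner \<Omega> (\<psi> t) \<phi>))"
      by (intro integrable_norm Bochner_Integration.integrable_diff si path_inner_integrable(1)[OF \<phi>])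
    show "integrable ?M (\<lambda>t. L2_norm \<Omega> (\<lambda>x. s t x - \<psi> t x) * L2_norm \<Omega> \<phi>)" using int by simp
    fix t assume "t \<in> space ?M"
    then have "s t \<in> H_space \<Omega>" "\<psi> t \<in> H_space \<Omega>" using s path_H by (auto simp: simple_in_def)
    then show "norm (L2_inner \<Omega> (s t) \<phi> - L2_inner \<Omega> (\<psi> t) \<phi>) \<le> L2_norm \<Omega> (\<lambda>x. s t x - \<psi> t x) * L2_norm \<Omega> \<phi>"
      using L2_Cauchy_Schwarz[of "\<lambda>x. s t x - \<psi> t x" \<Omega> \<phi>] \<phi> by (simp add: L2_inner_diff_left H_L2 L2_diff)
  qed
  also have "\<dots> = (LINT t|?M. L2_norm \<Omega> (\<lambda>x. s t x - \<psi> t x)) * L2_norm \<Omega> \<phi>" by simp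
  finally show ?thesis .
qed

lemma has_H_integral_inner:
  assumes a: "has_H_integral \<Omega> {0..T} \<psi> a" and \<phi>: "\<phi> \<in> H_space \<Omega>"
  shows "L2_inner \<Omega> a \<phi> = (LINT t|lebesgue_on {0..T}. L2_inner \<Omega> (\<psi> t) \<phi>)"
proof -
  obtain s where aH: "a \<in> H_space \<Omega>" and s: "\<And>n::nat. simple_in (H_space \<Omega>) {0..T} (s n)"
    "\<And>n. integrable (lebesgue_on {0..T}) (\<lambda>t. L2_norm \<Omega> (\<lambda>x. s n t x - \<psi> t x))"
    "(\<lambda>n. LINT t|lebesgue_on {0..T}. L2_norm \<Omega> (\<lambda>x. s n t x - \<psi> t x)) \<longlonglongrightarrow> 0"
    "(\<lambda>n. L2_norm \<Omega> (\<lambda>x. simple_time_integral {0..T} (s n) x - a x)) \<longlonglongrightarrow> 0"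
    using a by (auto simp: has_H_integral_def)
  have I: "{0..T} \<in> lmeasurable" by simp
  have "(\<lambda>n. L2_inner \<Omega> (simple_time_integral {0..T} (s n)) \<phi> - (LINT t|lebesgue_on {0..T}. L2_inner \<Omega> (\<psi> t) \<phi>)) \<longlonglongrightarrow> 0"
  proof (rule Lim_null_comparison)
    show "(\<lambda>n. (LINT t|lebesgue_on {0..T}. L2_norm \<Omega> (\<lambda>x. s n t x - \<psi> t x)) * L2_norm \<Omega> \<phi>) \<longlonglongrightarrow> 0"
      using tendsto_mult_right[OF s(3)] by simp
  qed (use simple_time_integral_close[OF s(1,2) \<phi>] in simp)
  moreover have "(\<lambda>n. L2_inner \<Omega> (simple_time_integral {0..T} (s n)) \<phi>) \<longlonglongrightarrow> L2_inner \<Omega> a \<phi>"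
    by (rule L2_inner_tendsto[OF H_L2[OF simple_time_integral_inner(1)[OF s(1) I \<phi>]] H_L2[OF aH] H_L2[OF \<phi>] s(4)])
  ultimately show ?thesis by (simp add: LIM_zero_iff LIMSEQ_unique)
qed

text \<open>Freezing the first \<open>n\<close> coefficients on a sufficiently fine grid of times gives a simple
  function uniformly close to the \<open>n\<close>-th partial expansion.\<close>

lemma path_step_approximation:
  obtains s where "simple_in (H_space \<Omega>) {0..T} s"
    "\<And>t. t \<in> {0..T} \<Longrightarrow> L2_norm \<Omega> (\<lambda>x. s t x - comb (coef (\<psi> t)) {..<n} x) \<le> 1 / real (Suc n)"
proof -
  \<comment> \<open>the squares of at most \<open>n\<close> errors below \<open>\<epsilon> \<le> 1\<close> sum up to at most \<open>n \<epsilon> \<le> 1 / (n + 1)\<^sup>2\<close>\<close>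
  define \<epsilon> where "\<epsilon> = 1 / real (Suc n) ^ 3"
  have \<epsilon>: "0 < \<epsilon>" by (simp add: \<epsilon>_def)
  have "\<exists>\<delta>>0. \<forall>t\<in>{0..T}. \<forall>t'\<in>{0..T}. \<bar>t' - t\<bar> < \<delta> \<longrightarrow> \<bar>coef (\<psi> t') k - coef (\<psi> t) k\<bar> < \<epsilon>" for k
  proof -
    have "uniformly_continuous_on {0..T} (\<lambda>t. coef (\<psi> t) k)"
      using path by (intro compact_uniformly_continuous) (auto simp: weakly_continuous_path_def)
    then show ?thesis using \<epsilon> unfolding uniformly_continuous_on_def dist_real_def by blast
  qed
  then obtain \<delta> where \<delta>: "\<And>k. 0 < \<delta> k" "\<And>k t t'. t \<in> {0..T} \<Longrightarrow> t' \<in> {0..T} \<Longrightarrow> \<bar>t' - t\<bar> < \<delta> k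
      \<Longrightarrow> \<bar>coef (\<psi> t') k - coef (\<psi> t) k\<bar> < \<epsilon>" by metis
  \<comment> \<open>the element 1 only serves to make the set nonempty when \<open>n = 0\<close>\<close>
  define \<delta>' where "\<delta>' = Min (insert 1 (\<delta> ` {..<n}))"
  have \<delta>': "0 < \<delta>'" "\<And>k. k < n \<Longrightarrow> \<delta>' \<le> \<delta> k" using \<delta>(1) by (auto simp: \<delta>'_def)
  obtain q :: nat where q: "1 / real (Suc q) < \<delta>'" using \<delta>'(1) nat_approx_posE by metis
  define Q where "Q = real (Suc q)"
  have Q: "0 < Q" "1 / Q < \<delta>'" using q by (simp_all add: Q_def)
  define \<tau> where "\<tau> j = real_of_int j / Q" for j
  have \<tau>: "\<tau> \<lfloor>t * Q\<rfloor> \<in> {0..T}" "\<bar>\<tau> \<lfloor>t * Q\<rfloor> - t\<bar> < \<delta>'" if t: "t \<in> {0..T}" for t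
  proof -
    have "real_of_int \<lfloor>t * Q\<rfloor> \<le> t * Q" "t * Q < real_of_int \<lfloor>t * Q\<rfloor> + 1" by linarith+
    then have *: "\<tau> \<lfloor>t * Q\<rfloor> \<le> t" "t < \<tau> \<lfloor>t * Q\<rfloor> + 1 / Q" using Q(1) by (auto simp: \<tau>_def field_simps)
    have "0 \<le> \<tau> \<lfloor>t * Q\<rfloor>" using t Q(1) by (simp add: \<tau>_def)
    with * t show "\<tau> \<lfloor>t * Q\<rfloor> \<in> {0..T}" by auto
    from * Q(2) show "\<bar>\<tau> \<lfloor>t * Q\<rfloor> - t\<bar> < \<delta>'" by linarith
  qed
  define S where "S j = comb (coef (\<psi> (\<tau> j))) {..<n}" for j :: int
  define s where "s t = S \<lfloor>t * Q\<rfloor>" for t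
  have "simple_in (H_space \<Omega>) {0..T} s"
    unfolding simple_in_def
  proof (intro conjI allI)
    have "s ` {0..T} \<subseteq> S ` {0..\<lfloor>T * Q\<rfloor>}"
      using Q(1) by (auto simp: s_def intro!: imageI floor_mono mult_right_mono)
    then show "finite (s ` {0..T})" by (rule finite_subset) simp
    show "s ` {0..T} \<subseteq> H_space \<Omega>" by (auto simp: s_def S_def comb_H)
    fix v
    have "(\<lambda>t::real. \<lfloor>t * Q\<rfloor>) \<in> borel \<rightarrow>\<^sub>M count_space UNIV" by measurable
    then have "(\<lambda>t. \<lfloor>t * Q\<rfloor>) -` {j. S j = v} \<inter> space borel \<in> sets borel"
      by (rule measurable_sets) simp
    then have "(\<lambda>t. \<lfloor>t * Q\<rfloor>) -` {j. S j = v} \<in> sets lebesgue" by simp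
    then have "{0..T} \<inter> (\<lambda>t. \<lfloor>t * Q\<rfloor>) -` {j. S j = v} \<in> sets lebesgue" by (intro sets.Int) auto
    moreover have "{t \<in> {0..T}. s t = v} = {0..T} \<inter> (\<lambda>t. \<lfloor>t * Q\<rfloor>) -` {j. S j = v}"
      by (auto simp: s_def)
    ultimately show "{t \<in> {0..T}. s t = v} \<in> sets lebesgue" by simp
  qed
  moreover have "L2_norm \<Omega> (\<lambda>x. s t x - comb (coef (\<psi> t)) {..<n} x) \<le> 1 / real (Suc n)"
    if t: "t \<in> {0..T}" for t
  proof (rule power2_le_imp_le)
    let ?c = "\<lambda>k. coef (\<psi> (\<tau> \<lfloor>t * Q\<rfloor>)) k - coef (\<psi> t) k"
    have "(\<lambda>x. s t x - comb (coef (\<psi> t)) {..<n} x) = comb ?c {..<n}"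
      by (simp add: s_def S_def comb_def fun_eq_iff sum_subtractf scaleR_diff_left)
    then have "(L2_norm \<Omega> (\<lambda>x. s t x - comb (coef (\<psi> t)) {..<n} x))\<^sup>2 = (\<Sum>k<n. (?c k)\<^sup>2)"
      by (simp add: norm_comb_sq)
    also have "\<dots> \<le> (\<Sum>k<n. \<epsilon>)"
    proof (rule sum_mono)
      fix k assume "k \<in> {..<n}"
      then have "\<bar>?c k\<bar> < \<epsilon>" using \<tau>[OF t] \<delta>'(2)[of k] by (intro \<delta>(2)[OF t]) auto
      moreover have "\<epsilon> \<le> 1" by (simp add: \<epsilon>_def)
      ultimately have "\<bar>?c k\<bar> * \<bar>?c k\<bar> \<le> \<epsilon> * 1" by (intro mult_mono) auto
      then show "(?c k)\<^sup>2 \<le> \<epsilon>" by (simp add: power2_eq_square)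
    qed
    also have "\<dots> = real n * (1 / real (Suc n) ^ 3)" by (simp add: \<epsilon>_def)
    also have "\<dots> \<le> real (Suc n) * (1 / real (Suc n) ^ 3)" by (intro mult_right_mono) auto
    also have "\<dots> = (1 / real (Suc n))\<^sup>2" by (simp add: power2_eq_square power3_eq_cube del: of_nat_Suc)
    finally show "(L2_norm \<Omega> (\<lambda>x. s t x - comb (coef (\<psi> t)) {..<n} x))\<^sup>2 \<le> (1 / real (Suc n))\<^sup>2" .
  qed simp
  ultimately show thesis by (rule that)
qed

text \<open>The candidate for the integral is the Riesz representative of \<open>\<phi> \<mapsto> \<integral> (\<psi> t, \<phi>) dt\<close>. Testing
  the difference to the integral of a simple function with the difference itself shows that the
  integrals of the approximating step functions converge to it in norm.\<close>

lemma has_H_integral_exists: "\<exists>a. has_H_integral \<Omega> {0..T} \<psi> a"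
proof -
  let ?M = "lebesgue_on {0..T}"
  have I: "{0..T} \<in> lmeasurable" by simp
  have fm: "finite_measure ?M" by (rule finite_measure_lebesgue_on) simp
  define F where "F \<phi> = (LINT t|?M. L2_inner \<Omega> (\<psi> t) \<phi>)" for \<phi>
  have lin: "F (\<lambda>x. \<phi> x + c *\<^sub>R \<phi>' x) = F \<phi> + c * F \<phi>'" if "\<phi> \<in> H_space \<Omega>" "\<phi>' \<in> H_space \<Omega>" for \<phi> \<phi>' c
  proof -
    have "F (\<lambda>x. \<phi> x + c *\<^sub>R \<phi>' x) = (LINT t|?M. L2_inner \<Omega> (\<psi> t) \<phi> + c * L2_inner \<Omega> (\<psi> t) \<phi>')"
      unfolding F_def using that path_H
      by (intro Bochner_Integration.integral_cong)
        (auto simp: L2_inner_add_right L2_inner_scaleR_right H_L2 L2_scaleR)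
    then show ?thesis using path_inner_integrable(1)[OF that(1)] path_inner_integrable(1)[OF that(2)]
      by (simp add: F_def)
  qed
  have bnd: "\<bar>F \<phi>\<bar> \<le> (T * C) * L2_norm \<Omega> \<phi>" if "\<phi> \<in> H_space \<Omega>" for \<phi>
    unfolding F_def by (rule path_inner_integrable(2)[OF that])
  obtain a where aH: "a \<in> H_space \<Omega>" and a: "\<And>\<phi>. \<phi> \<in> H_space \<Omega> \<Longrightarrow> F \<phi> = L2_inner \<Omega> a \<phi>"
    using Riesz_representation[OF lin bnd] by blast
  have "\<exists>s. simple_in (H_space \<Omega>) {0..T} s \<and>
    (\<forall>t\<in>{0..T}. L2_norm \<Omega> (\<lambda>x. s t x - comb (coef (\<psi> t)) {..<n} x) \<le> 1 / real (Suc n))" for n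
    by (rule path_step_approximation[of n]) blast
  then obtain s where s: "\<And>n. simple_in (H_space \<Omega>) {0..T} (s n)"
    and close: "\<And>n t. t \<in> {0..T} \<Longrightarrow> L2_norm \<Omega> (\<lambda>x. s n t x - comb (coef (\<psi> t)) {..<n} x) \<le> 1 / real (Suc n)"
    by metis
  define D where "D n t = L2_norm \<Omega> (\<lambda>x. s n t x - \<psi> t x)" for n t
  have Dm: "D n \<in> borel_measurable ?M" for n unfolding D_def by (rule path_distance_measurable[OF s])
  have D: "D n t \<le> 1 / real (Suc n) + L2_norm \<Omega> (\<lambda>x. comb (coef (\<psi> t)) {..<n} x - \<psi> t x)" if t: "t \<in> {0..T}" for n t
  proof -
    have "s n t \<in> H_space \<Omega>" using s[of n] t by (auto simp: simple_in_def)
    then have "D n t \<le> L2_norm \<Omega> (\<lambda>x. s n t x - comb (coef (\<psi> t)) {..<n} x) + L2_norm \<Omega> (\<lambda>x. comb (coef (\<psi> t)) {..<n} x - \<psi> t x)"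
      unfolding D_def by (intro L2_triangle_diff comb_L2 H_L2 path_H t)
    then show ?thesis using close[OF t, of n] by linarith
  qed
  have tail: "L2_norm \<Omega> (\<lambda>x. comb (coef v) {..<n} x - v x) \<le> L2_norm \<Omega> v" if "v \<in> L2 \<Omega>" for v n
    using norm_Q_proj_le[OF that, of n] unfolding Q_proj_def P_proj_eq[OF that] L2_norm_minus_commute[of \<Omega> v] .
  have AE_I: "AE t in ?M. t \<in> {0..T}" by (intro AE_I2) simp
  have dom: "AE t in ?M. norm (D n t) \<le> 1 + C" for n
    using path_bound AE_I
  proof eventually_elim
    case (elim t)
    have "1 / real (Suc n) \<le> 1" by simp
    then have "D n t \<le> 1 + C"
      using D[OF elim(2), of n] tail[OF H_L2[OF path_H[OF elim(2)]], of n] elim(1) by linarith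
    then show ?case by (simp add: D_def)
  qed
  have "(\<lambda>n. LINT t|?M. D n t) \<longlonglongrightarrow> (LINT t|?M. 0)"
  proof (rule integral_dominated_convergence[where w = "\<lambda>t. 1 + C"])
    show "AE t in ?M. (\<lambda>n. D n t) \<longlonglongrightarrow> 0"
      using AE_I
    proof eventually_elim
      case (elim t)
      show ?case
      proof (rule Lim_null_comparison)
        show "\<forall>\<^sub>F n in sequentially. norm (D n t) \<le> 1 / real (Suc n) + L2_norm \<Omega> (\<lambda>x. comb (coef (\<psi> t)) {..<n} x - \<psi> t x)"
          using D[OF elim] by (simp add: D_def)
        show "(\<lambda>n. 1 / real (Suc n) + L2_norm \<Omega> (\<lambda>x. comb (coef (\<psi> t)) {..<n} x - \<psi> t x)) \<longlonglongrightarrow> 0"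
          using tendsto_add[OF LIMSEQ_Suc[OF lim_1_over_n] comb_tendsto[OF path_H[OF elim]]] by simp
      qed
    qed
    show "integrable ?M (\<lambda>t. 1 + C)" by (rule finite_measure.integrable_const[OF fm])
  qed (use Dm dom in auto)
  then have D0: "(\<lambda>n. LINT t|?M. D n t) \<longlonglongrightarrow> 0" by simp
  have Dint: "integrable ?M (D n)" for n
    by (rule finite_measure.integrable_const_bound[OF fm dom Dm])
  have "(\<lambda>n. L2_norm \<Omega> (\<lambda>x. simple_time_integral {0..T} (s n) x - a x)) \<longlonglongrightarrow> 0"
  proof (rule Lim_null_comparison[OF _ D0], intro always_eventually allI)
    fix n
    define d where "d x = simple_time_integral {0..T} (s n) x - a x" for x
    have SH: "simple_time_integral {0..T} (s n) \<in> H_space \<Omega>"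
      by (rule simple_time_integral_inner(1)[OF s I aH])
    have dH: "d \<in> H_space \<Omega>" unfolding d_def by (rule H_diff[OF SH aH])
    have "L2_norm \<Omega> d * L2_norm \<Omega> d = L2_inner \<Omega> (simple_time_integral {0..T} (s n)) d - F d"
      using L2_inner_diff_left[OF H_L2[OF SH] H_L2[OF aH] H_L2[OF dH]] a[OF dH] L2_norm_sq[of \<Omega> d]
      by (simp add: d_def[abs_def] power2_eq_square)
    also have "\<dots> \<le> (LINT t|?M. D n t) * L2_norm \<Omega> d"
      using simple_time_integral_close[OF s[of n] Dint[unfolded D_def] dH] unfolding F_def D_def by linarith
    finally have "L2_norm \<Omega> d * L2_norm \<Omega> d \<le> (LINT t|?M. D n t) * L2_norm \<Omega> d" .
    moreover have "0 \<le> (LINT t|?M. D n t)" by (rule Bochner_Integration.integral_nonneg) (simp add: D_def)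
    ultimately have "L2_norm \<Omega> d \<le> (LINT t|?M. D n t)"
      by (metis L2_norm_nonneg less_eq_real_def mult_right_le_imp_le)
    then show "norm (L2_norm \<Omega> (\<lambda>x. simple_time_integral {0..T} (s n) x - a x)) \<le> (LINT t|?M. D n t)"
      by (simp add: d_def[abs_def])
  qed
  then have "has_H_integral \<Omega> {0..T} \<psi> a"
    unfolding has_H_integral_def using aH s Dint D0 unfolding D_def by blast
  then show ?thesis by (rule exI[of _ a])
qed

text \<open>The bound comes from pairing the integral with itself.\<close>

lemma field_mean_H: "field_mean \<Omega> T \<psi> \<in> H_space \<Omega>"
  and field_mean_norm_le: "L2_norm \<Omega> (field_mean \<Omega> T \<psi>) \<le> C"
proof -
  define a where "a = (SOME a. has_H_integral \<Omega> {0..T} \<psi> a)"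
  have a: "has_H_integral \<Omega> {0..T} \<psi> a" 
    using someI_ex[of "has_H_integral \<Omega> {0..T} \<psi>"] has_H_integral_exists unfolding a_def by blast
  have aH: "a \<in> H_space \<Omega>" using a by (simp add: has_H_integral_def)
  have mean: "field_mean \<Omega> T \<psi> = (\<lambda>x. (1 / T) *\<^sub>R a x)" by (simp add: field_mean_def a_def)
  show "field_mean \<Omega> T \<psi> \<in> H_space \<Omega>" unfolding mean by (rule H_scaleR[OF aH])
  have "L2_norm \<Omega> a * L2_norm \<Omega> a = (LINT t|lebesgue_on {0..T}. L2_inner \<Omega> (\<psi> t) a)"
    using has_H_integral_inner[OF a aH] L2_norm_sq[of \<Omega> a] by (simp add: power2_eq_square)
  also have "\<dots> \<le> T * C * L2_norm \<Omega> a" using path_inner_integrable(2)[OF aH] by linarith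
  finally have *: "L2_norm \<Omega> a * L2_norm \<Omega> a \<le> T * C * L2_norm \<Omega> a" .
  have "0 \<le> C"
  proof (rule ccontr)
    assume "\<not> 0 \<le> C"
    then have "AE t in lebesgue_on {0..T}. False"
      using path_bound by (auto elim!: eventually_mono dest: order_trans[OF L2_norm_nonneg])
    then have "emeasure (lebesgue_on {0..T}) (space (lebesgue_on {0..T})) = 0"
      by (simp add: eventually_False ae_filter_eq_bot_iff)
    then show False using path_T by (simp add: emeasure_restrict_space)
  qed
  then have "L2_norm \<Omega> a \<le> T * C" using * path_T
    by (metis L2_norm_nonneg less_eq_real_def mult_nonneg_nonneg mult_right_le_imp_le)
  then show "L2_norm \<Omega> (field_mean \<Omega> T \<psi>) \<le> C"
    unfolding mean L2_norm_scaleR using path_T by (simp add: field_simps)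
qed

end

end

subsection \<open>Measurability in time of functionals of the solution\<close>

context bounded_open_set
begin

lemma V_norm_diff_tendsto:
  assumes "\<And>n. v n \<in> V_space \<Omega>" "v' \<in> V_space \<Omega>" "(\<lambda>n. V_norm \<Omega> (\<lambda>x. v n x - v' x)) \<longlonglongrightarrow> 0"
  shows "(\<lambda>n. L2_norm \<Omega> (\<lambda>x. weak_jac \<Omega> (v n) x - weak_jac \<Omega> v' x)) \<longlonglongrightarrow> 0"
proof -
  have "V_norm \<Omega> (\<lambda>x. v n x - v' x) = L2_norm \<Omega> (\<lambda>x. weak_jac \<Omega> (v n) x - weak_jac \<Omega> v' x)" for n
    unfolding V_norm_def
    by (intro L2_norm_cong_AE weak_jac_diff_AE V_H10 weak_jac_V_L2 V_diff L2_diff assms)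
  then show ?thesis using assms(3) by simp
qed

text \<open>The solution is a limit of simple functions in the norm of \<open>V\<close>; a functional that is continuous in
  this norm turns them into simple real functions.\<close>

lemma V_path_measurable:
  fixes F :: "vfield \<Rightarrow> real"
  assumes u: "strongly_measurable (V_norm \<Omega>) (V_space \<Omega>) {0..} u" "AE t in lebesgue_on {0..}. u t \<in> V_space \<Omega>"
    and F: "\<And>v v'. (\<And>n::nat. v n \<in> V_space \<Omega>) \<Longrightarrow> v' \<in> V_space \<Omega> \<Longrightarrow>
      (\<lambda>n. V_norm \<Omega> (\<lambda>x. v n x - v' x)) \<longlonglongrightarrow> 0 \<Longrightarrow> (\<lambda>n. F (v n)) \<longlonglongrightarrow> F v'"
  shows "(\<lambda>t. F (u t)) \<in> borel_measurable (lebesgue_on {0..})"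
proof -
  obtain s where s: "\<And>n::nat. simple_in (V_space \<Omega>) {0..} (s n)"
    "AE t in lebesgue_on {0..}. (\<lambda>n. V_norm \<Omega> (\<lambda>x. s n t x - u t x)) \<longlonglongrightarrow> 0"
    using u(1) by (auto simp: strongly_measurable_def)
  have "AE t in lebesgue_on {0..}. t \<in> {0..}" by (intro AE_I2) simp
  then have lim: "AE t in lebesgue_on {0..}. (\<lambda>n. F (s n t)) \<longlonglongrightarrow> F (u t)"
    using s(2) u(2)
  proof eventually_elim
    case (elim t)
    have "s n t \<in> V_space \<Omega>" for n using s(1)[of n] elim(1) by (auto simp: simple_in_def)
    then show ?case using elim by (intro F)
  qed
  show ?thesis
    by (rule AE_limit_measurable[OF simple_in_measurable[OF s(1)] _ lim]) auto
qed

lemma grad_inner_path_measurable: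
  assumes "L2loc_V \<Omega> u" and \<phi>: "\<phi> \<in> V_space \<Omega>"
  shows "(\<lambda>t. L2_inner \<Omega> (weak_jac \<Omega> (u t)) (weak_jac \<Omega> \<phi>)) \<in> borel_measurable (lebesgue_on {0..})"
proof (rule V_path_measurable)
  fix v v' assume v: "\<And>n::nat. v n \<in> V_space \<Omega>" "v' \<in> V_space \<Omega>"
    "(\<lambda>n. V_norm \<Omega> (\<lambda>x. v n x - v' x)) \<longlonglongrightarrow> 0"
  show "(\<lambda>n. L2_inner \<Omega> (weak_jac \<Omega> (v n)) (weak_jac \<Omega> \<phi>)) \<longlonglongrightarrow> L2_inner \<Omega> (weak_jac \<Omega> v') (weak_jac \<Omega> \<phi>)"
    by (rule L2_inner_tendsto[OF weak_jac_V_L2[OF v(1)] weak_jac_V_L2[OF v(2)] weak_jac_V_L2[OF \<phi>]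
        V_norm_diff_tendsto[OF v]])
qed (use assms in \<open>auto simp: L2loc_V_def\<close>)

lemma B_pairing_path_measurable:
  assumes "L2loc_V \<Omega> u" and \<phi>: "\<phi> \<in> V_space \<Omega>"
  shows "(\<lambda>t. B_pairing \<Omega> (u t) (u t) \<phi>) \<in> borel_measurable (lebesgue_on {0..})"
proof (rule V_path_measurable)
  fix v v' assume v: "\<And>n::nat. v n \<in> V_space \<Omega>" "v' \<in> V_space \<Omega>"
    "(\<lambda>n. V_norm \<Omega> (\<lambda>x. v n x - v' x)) \<longlonglongrightarrow> 0"
  let ?K = ladyzhenskaya_const and ?d = "\<lambda>n. V_norm \<Omega> (\<lambda>x. v n x - v' x)"
  have Vn: "(\<lambda>n. V_norm \<Omega> (v n)) \<longlonglongrightarrow> V_norm \<Omega> v'"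
    unfolding V_norm_def
    by (rule L2_norm_tendsto[OF weak_jac_V_L2[OF v(1)] weak_jac_V_L2[OF v(2)] V_norm_diff_tendsto[OF v]])
  define b where "b n = ?K * ?d n * V_norm \<Omega> (v n) * V_norm \<Omega> \<phi> + ?K * V_norm \<Omega> v' * ?d n * V_norm \<Omega> \<phi>" for n
  have "b \<longlonglongrightarrow> ?K * 0 * V_norm \<Omega> v' * V_norm \<Omega> \<phi> + ?K * V_norm \<Omega> v' * 0 * V_norm \<Omega> \<phi>"
    unfolding b_def by (intro tendsto_intros v(3) Vn)
  then have b0: "b \<longlonglongrightarrow> 0" by simp
  have "\<bar>B_pairing \<Omega> (v n) (v n) \<phi> - B_pairing \<Omega> v' v' \<phi>\<bar> \<le> b n" for n
    using B_pairing_bound[OF V_diff[OF v(1)[of n] v(2)] v(1)[of n] \<phi>]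
      B_pairing_bound[OF v(2) V_diff[OF v(1)[of n] v(2)] \<phi>]
    unfolding b_def B_pairing_diff(1)[OF v(1)[of n] v(2) v(1)[of n] v(1)[of n] \<phi>]
      B_pairing_diff(2)[OF v(2) v(2) v(1)[of n] v(2) \<phi>] by linarith
  then have "(\<lambda>n. B_pairing \<Omega> (v n) (v n) \<phi> - B_pairing \<Omega> v' v' \<phi>) \<longlonglongrightarrow> 0"
    by (intro Lim_null_comparison[OF _ b0]) simp
  then show "(\<lambda>n. B_pairing \<Omega> (v n) (v n) \<phi>) \<longlonglongrightarrow> B_pairing \<Omega> v' v' \<phi>" by (simp add: LIM_zero_iff)
qed (use assms in \<open>auto simp: L2loc_V_def\<close>)

text \<open>Up to constants, \<open>(\<nabla>u, \<nabla>\<phi>)\<close> and \<open>(B(u,u), \<phi>)\<close> are dominated by \<open>1 + \<parallel>\<nabla>u\<parallel>\<^sup>2\<close>, which is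
  locally integrable in time.\<close>

lemma V_path_integrable:
  assumes u: "L2loc_V \<Omega> u" and T: "0 < T"
    and m: "g \<in> borel_measurable (lebesgue_on {0..})"
    and bound: "\<And>t. u t \<in> V_space \<Omega> \<Longrightarrow> \<bar>g t\<bar> \<le> K * (1 + (V_norm \<Omega> (u t))\<^sup>2)"
  shows "integrable (lebesgue_on {0..T}) g"
proof (rule Bochner_Integration.integrable_bound)
  have "finite_measure (lebesgue_on {0..T})" by (rule finite_measure_lebesgue_on) simp
  then show "integrable (lebesgue_on {0..T}) (\<lambda>t. K * (1 + (V_norm \<Omega> (u t))\<^sup>2))"
    using u T by (intro integrable_mult_right Bochner_Integration.integrable_add finite_measure.integrable_const)
      (auto simp: L2loc_V_def)
  show "g \<in> borel_measurable (lebesgue_on {0..T})"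
    by (rule measurable_restrict_mono[OF m]) auto
  have "AE t in lebesgue. t \<in> {0..} \<longrightarrow> u t \<in> V_space \<Omega>"
    using u by (simp add: L2loc_V_def AE_restrict_space_iff)
  then have "AE t in lebesgue_on {0..T}. u t \<in> V_space \<Omega>"
    by (subst AE_restrict_space_iff) (auto elim: eventually_mono)
  then show "AE t in lebesgue_on {0..T}. norm (g t) \<le> norm (K * (1 + (V_norm \<Omega> (u t))\<^sup>2))"
    by eventually_elim (metis abs_ge_self bound order_trans real_norm_def)
qed

lemma grad_inner_path_integrable:
  assumes u: "L2loc_V \<Omega> u" and \<phi>: "\<phi> \<in> V_space \<Omega>" and T: "0 < T"
  shows "integrable (lebesgue_on {0..T}) (\<lambda>t. L2_inner \<Omega> (weak_jac \<Omega> (u t)) (weak_jac \<Omega> \<phi>))"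
proof (rule V_path_integrable[OF u T grad_inner_path_measurable[OF u \<phi>]])
  fix t assume t: "u t \<in> V_space \<Omega>"
  have "V_norm \<Omega> (u t) \<le> 1 + (V_norm \<Omega> (u t))\<^sup>2"
    using zero_le_power2[of "V_norm \<Omega> (u t) - 1 / 2"] by (simp add: power2_diff power_divide)
  then have "V_norm \<Omega> (u t) * V_norm \<Omega> \<phi> \<le> (1 + (V_norm \<Omega> (u t))\<^sup>2) * V_norm \<Omega> \<phi>"
    by (rule mult_right_mono) (simp add: V_norm_def)
  then show "\<bar>L2_inner \<Omega> (weak_jac \<Omega> (u t)) (weak_jac \<Omega> \<phi>)\<bar> \<le> V_norm \<Omega> \<phi> * (1 + (V_norm \<Omega> (u t))\<^sup>2)"
    using L2_Cauchy_Schwarz[OF weak_jac_V_L2[OF t] weak_jac_V_L2[OF \<phi>]] unfolding V_norm_def by (simp add: mult.commute)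
qed

lemma B_pairing_path_integrable:
  assumes u: "L2loc_V \<Omega> u" and \<phi>: "\<phi> \<in> V_space \<Omega>" and T: "0 < T"
  shows "integrable (lebesgue_on {0..T}) (\<lambda>t. B_pairing \<Omega> (u t) (u t) \<phi>)"
proof (rule V_path_integrable[OF u T B_pairing_path_measurable[OF u \<phi>]])
  fix t assume t: "u t \<in> V_space \<Omega>"
  have "\<bar>B_pairing \<Omega> (u t) (u t) \<phi>\<bar> \<le> (ladyzhenskaya_const * V_norm \<Omega> \<phi>) * (V_norm \<Omega> (u t))\<^sup>2"
    using B_pairing_bound[OF t t \<phi>] by (simp add: power2_eq_square mult_ac)
  also have "\<dots> \<le> (ladyzhenskaya_const * V_norm \<Omega> \<phi>) * (1 + (V_norm \<Omega> (u t))\<^sup>2)"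
    using ladyzhenskaya_const(1) by (intro mult_left_mono) (auto simp: V_norm_def)
  finally show "\<bar>B_pairing \<Omega> (u t) (u t) \<phi>\<bar> \<le> (ladyzhenskaya_const * V_norm \<Omega> \<phi>) * (1 + (V_norm \<Omega> (u t))\<^sup>2)" .
qed

end

section \<open>Distributional derivatives in time\<close>

text \<open>The antiderivative of a bump, divided by its final value.\<close>

lemma smooth_step_exists:
  obtains R \<rho> :: "real \<Rightarrow> real" where "\<And>t. (R has_real_derivative \<rho> t) (at t)" "Cinf_on UNIV \<rho>"
    "\<And>t. 0 \<le> \<rho> t" "\<And>t. t \<le> 0 \<or> 1 \<le> t \<Longrightarrow> \<rho> t = 0" "\<And>t. t \<le> 0 \<Longrightarrow> R t = 0" "\<And>t. 1 \<le> t \<Longrightarrow> R t = 1"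
    "\<And>t. 0 \<le> R t" "\<And>t. R t \<le> 1"
proof -
  define b where "b = bump 0 1"
  have b: "0 \<le> b t" "t \<le> 0 \<or> 1 \<le> t \<Longrightarrow> b t = 0" "0 < t \<Longrightarrow> t < 1 \<Longrightarrow> 0 < b t" for t
    using bump_bounds[of 0 1 t] by (auto simp: b_def less_eq_real_def)
  have bC: "Cinf_on UNIV b" unfolding b_def by (rule Cinf_on_bump)
  \<comment> \<open>starting left of the support of \<open>b\<close> makes the derivative two-sided at 0\<close>
  define S where "S t = integral {-2..t} b" for t
  have S0: "S t = 0" if "t \<le> 0" for t
  proof -
    have "integral {-2..t} b = integral {-2..t} (\<lambda>t. 0)"
      by (rule Henstock_Kurzweil_Integration.integral_cong) (use that b(2) in auto)
    then show ?thesis by (simp add: S_def)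
  qed
  have dS: "(S has_real_derivative b t) (at t)" for t
  proof (cases "t < 0")
    case True
    have "((\<lambda>t. 0) has_real_derivative 0) (at t)" by simp
    then have "(S has_real_derivative 0) (at t)"
      by (rule has_field_derivative_transform_within_open[where S = "{..<0}"]) (use True S0 in auto)
    then show ?thesis using True b(2)[of t] by simp
  next
    case False
    have "((\<lambda>x. integral {-2..x} b) has_real_derivative b t) (at t within {-2..t + 1})"
      by (rule integral_has_real_derivative)
        (use False continuous_on_subset[OF Cinf_on_continuous[OF bC]] in auto)
    moreover have "at t within {-2..t + 1} = at t"
      using False by (intro at_within_interior) auto
    ultimately show ?thesis by (simp add: S_def[abs_def])
  qed
  have cS: "continuous_on A S" for A
    using dS by (intro continuous_at_imp_continuous_on ballI DERIV_isCont)
  define J where "J = S 1"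
  have "S 0 < S 1"
    by (rule DERIV_pos_imp_increasing_open) (use dS b(3) cS in auto)
  then have J: "0 < J" by (simp add: S0 J_def)
  have mono: "S s \<le> S t" if "s \<le> t" for s t
    by (rule DERIV_nonneg_imp_nondecreasing[OF that]) (use dS b(1) in blast)
  have S1: "S t = J" if "1 \<le> t" for t
  proof (cases "t = 1")
    case False
    have "S t = S 1"
      proof (rule DERIV_isconst_end[OF _ cS])
      show "1 < t" using that False by simp
      show "(S has_real_derivative 0) (at x)" if "1 < x" for x using dS[of x] b(2)[of x] that by simp
    qed
    then show ?thesis by (simp add: J_def)
  qed (simp add: J_def)
  have SJ: "S t \<le> J" for t using mono[of t 1] S1[of t] by (cases "t \<le> 1") (auto simp: J_def)
  have Sn: "0 \<le> S t" for t using mono[of 0 t] S0[of t] S0[of 0] by (cases "t \<le> 0") auto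
  have "Cinf_on UNIV (\<lambda>t. b t * (1 / J))" by (intro Cinf_on_mult Cinf_on_const bC)
  then have "Cinf_on UNIV (\<lambda>t. b t / J)" by simp
  moreover have "((\<lambda>t. S t / J) has_real_derivative b t / J) (at t)" for t
    by (rule DERIV_cdivide[OF dS])
  ultimately show thesis
    using that[of "\<lambda>t. S t / J" "\<lambda>t. b t / J"] b J S0 S1 SJ Sn by simp
qed

lemma LINT_restrict_support:
  fixes f :: "real \<Rightarrow> real"
  assumes "S \<in> sets lebesgue" "A \<in> sets lebesgue" "A \<subseteq> S" "\<And>t. t \<in> S \<Longrightarrow> t \<notin> A \<Longrightarrow> f t = 0"
  shows "(LINT t|lebesgue_on S. f t) = (LINT t|lebesgue_on A. f t)"
proof -
  have "(LINT t|lebesgue_on S. f t) = (LINT t|lebesgue. indicator S t *\<^sub>R f t)"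
    using assms(1) by (intro integral_restrict_space) auto
  also have "\<dots> = (LINT t|lebesgue. indicator A t *\<^sub>R f t)"
    using assms(3,4) by (intro Bochner_Integration.integral_cong) (auto simp: indicator_def)
  also have "\<dots> = (LINT t|lebesgue_on A. f t)"
    using assms(2) by (intro integral_restrict_space[symmetric]) auto
  finally show ?thesis .
qed

lemma integrable_lebesgue_on_subset:
  fixes f :: "real \<Rightarrow> real"
  assumes "integrable (lebesgue_on S) f" "S \<in> sets lebesgue" "A \<in> sets lebesgue" "A \<subseteq> S"
  shows "integrable (lebesgue_on A) f"
proof -
  have S: "S \<inter> space lebesgue \<in> sets lebesgue" "A \<inter> space lebesgue \<in> sets lebesgue" using assms by auto
  have "integrable lebesgue (\<lambda>t. indicator S t *\<^sub>R f t)"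
    by (rule integrable_restrict_space[OF S(1), THEN iffD1, OF assms(1)])
  then have "integrable lebesgue (\<lambda>t. indicator A t *\<^sub>R (indicator S t *\<^sub>R f t))"
    by (rule integrable_mult_indicator[OF assms(3)])
  also have "(\<lambda>t. indicator A t *\<^sub>R (indicator S t *\<^sub>R f t)) = (\<lambda>t. indicator A t *\<^sub>R f t)"
    using assms(4) by (auto simp: indicator_def fun_eq_iff)
  finally show ?thesis by (rule integrable_restrict_space[OF S(2), THEN iffD2])
qed

lemma AE_lebesgue_on_neq: "A \<in> sets lebesgue \<Longrightarrow> AE t in lebesgue_on A. t \<noteq> (a::real)"
proof -
  assume A: "A \<in> sets lebesgue"
  have "{a} \<in> null_sets lebesgue" by (simp add: null_sets_completionI)
  from AE_not_in[OF this] show ?thesis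
    using A by (subst AE_restrict_space_iff) (auto elim: eventually_mono)
qed

lemma approximate_identity_tendsto:
  fixes c :: "real \<Rightarrow> real" and k :: "nat \<Rightarrow> real \<Rightarrow> real"
  assumes c: "continuous_on {p..p + 1} c" and k: "\<And>n. continuous_on {p..p + 1} (k n)" "\<And>n t. 0 \<le> k n t"
    "\<And>n t. p + 1 / real (Suc n) \<le> t \<Longrightarrow> k n t = 0" "\<And>n. (LINT t|lebesgue_on {p..p + 1}. k n t) = 1"
  shows "(\<lambda>n. LINT t|lebesgue_on {p..p + 1}. c t * k n t) \<longlonglongrightarrow> c p"
proof (rule LIMSEQ_I)
  fix e :: real assume e: "0 < e"
  let ?M = "lebesgue_on {p..p + 1}"
  obtain d where d: "0 < d" "\<And>t. t \<in> {p..p + 1} \<Longrightarrow> \<bar>t - p\<bar> < d \<Longrightarrow> \<bar>c t - c p\<bar> < e / 2"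
    using c e unfolding continuous_on_iff dist_real_def
    by (metis add_increasing2 atLeastAtMost_iff half_gt_zero order_refl zero_le_one)
  obtain N :: nat where N: "1 / real (Suc N) < d" using d(1) nat_approx_posE by metis
  have "norm ((LINT t|?M. c t * k n t) - c p) < e" if n: "n \<ge> N" for n
  proof -
    have ik: "integrable ?M (k n)" and ick: "integrable ?M (\<lambda>t. c t * k n t)"
      by (intro continuous_imp_integrable_real continuous_on_mult c k)+
    have "(LINT t|?M. c t * k n t) - c p = (LINT t|?M. c t * k n t) - (LINT t|?M. c p * k n t)"
      by (simp add: k(4))
    also have "\<dots> = (LINT t|?M. c t * k n t - c p * k n t)"
      using ik ick by (intro Bochner_Integration.integral_diff[symmetric]) auto
    finally have "norm ((LINT t|?M. c t * k n t) - c p) \<le> (LINT t|?M. norm (c t * k n t - c p * k n t))"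
      using integral_norm_bound[of ?M "\<lambda>t. c t * k n t - c p * k n t"] by simp
    also have "\<dots> \<le> (LINT t|?M. e / 2 * k n t)"
    proof (rule integral_mono)
      show "integrable ?M (\<lambda>t. norm (c t * k n t - c p * k n t))" "integrable ?M (\<lambda>t. e / 2 * k n t)"
        using ik ick by (auto intro!: integrable_norm Bochner_Integration.integrable_diff)
      fix t assume "t \<in> space ?M"
      then have t: "t \<in> {p..p + 1}" by simp
      show "norm (c t * k n t - c p * k n t) \<le> e / 2 * k n t"
      proof (cases "p + 1 / real (Suc n) \<le> t")
        case False
        have "1 / real (Suc n) \<le> 1 / real (Suc N)" using n by (intro divide_left_mono) auto
        then have "\<bar>c t - c p\<bar> < e / 2" using False t N by (intro d(2)) auto
        then have "\<bar>c t - c p\<bar> * k n t \<le> e / 2 * k n t" using k(2) by (intro mult_right_mono) auto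
        then show ?thesis using k(2)[of n t] by (simp add: abs_mult flip: left_diff_distrib)
      qed (simp add: k(3))
    qed
    also have "\<dots> = e / 2" by (simp add: k(4))
    finally show ?thesis using e by linarith
  qed
  then show "\<exists>N. \<forall>n\<ge>N. norm ((LINT t|?M. c t * k n t) - c p) < e" by blast
qed

text \<open>The test functions are smoothed indicators of \<open>[a, b]\<close>: their derivatives are an
  approximate identity at \<open>a\<close> minus one at \<open>b\<close>.\<close>

lemma weak_derivative_increment_pos:
  fixes c g :: "real \<Rightarrow> real"
  assumes c: "continuous_on {0..} c" and g: "\<And>T. 0 < T \<Longrightarrow> integrable (lebesgue_on {0..T}) g"
    and weak: "\<And>\<theta>. \<theta> \<in> test_functions {0<..} \<Longrightarrow>
      - (LINT t|lebesgue_on {0<..}. c t * deriv \<theta> t) + (LINT t|lebesgue_on {0<..}. g t * \<theta> t)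
      = (LINT t|lebesgue_on {0<..}. r * \<theta> t)"
    and ab: "0 < a" "a < b"
  shows "c b - c a = (LINT t|lebesgue_on {a..b}. r - g t)"
proof -
  obtain R \<rho> :: "real \<Rightarrow> real" where R: "\<And>t. (R has_real_derivative \<rho> t) (at t)" and \<rho>: "Cinf_on UNIV \<rho>"
    "\<And>t. 0 \<le> \<rho> t" "\<And>t. t \<le> 0 \<or> 1 \<le> t \<Longrightarrow> \<rho> t = 0" and R01: "\<And>t. t \<le> 0 \<Longrightarrow> R t = 0" "\<And>t. 1 \<le> t \<Longrightarrow> R t = 1"
    "\<And>t. 0 \<le> R t" "\<And>t. R t \<le> 1"
    using smooth_step_exists by blast
  have RC: "Cinf_on UNIV R" by (rule Cinf_on_antiderivative[OF R \<rho>(1)])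
  define N where "N n = real (Suc n)" for n
  have N1: "1 \<le> N n" for n by (simp add: N_def)
  define \<theta> where "\<theta> n t = R (N n * (t - a)) - R (N n * (t - b))" for n t
  define k where "k p n t = N n * \<rho> (N n * (t - p))" for p n t
  have dRp: "((\<lambda>t. R (N n * (t - p))) has_real_derivative k p n t) (at t)" for n p t
  proof -
    have "((\<lambda>t. N n * (t - p)) has_real_derivative N n) (at t)"
      by (auto intro!: derivative_eq_intros)
    from DERIV_chain2[OF R this] show ?thesis by (simp add: k_def mult.commute)
  qed
  have d\<theta>: "deriv (\<theta> n) t = k a n t - k b n t" for n t
    unfolding \<theta>_def by (intro DERIV_imp_deriv DERIV_diff dRp)
  have Rlarge: "R (N n * (t - p)) = 1" if "p + 1 \<le> t" for n t p
  proof (rule R01(2))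
    have "1 * 1 \<le> N n * (t - p)" using that N1[of n] by (intro mult_mono) auto
    then show "1 \<le> N n * (t - p)" by simp
  qed
  have Rsmall: "R (N n * (t - p)) = 0" if "t \<le> p" for n t p
    using that N1[of n] by (intro R01(1)) (auto simp: mult_le_0_iff)
  have \<theta>0: "\<theta> n t = 0" if "t \<notin> {a..b + 1}" for n t
    using that ab Rsmall[of t a n] Rsmall[of t b n] Rlarge[of a t n] Rlarge[of b t n] by (auto simp: \<theta>_def)
  have Raff: "Cinf_on UNIV (\<lambda>t. R (N n * (t - p)))" for n p
    using Cinf_on_affine_real[OF bounded_linear_mult_right[of "N n"] RC, of "- (N n * p)"]
    by (simp add: right_diff_distrib)
  have \<theta>t: "\<theta> n \<in> test_functions {0<..}" for n
  proof (rule test_functionsI[where K = "{a..b + 1}"])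
    show "Cinf_on UNIV (\<theta> n)" unfolding \<theta>_def by (intro Cinf_on_diff Raff)
  qed (use ab \<theta>0 in auto)
  have k0: "k p n t = 0" if "t \<le> p \<or> p + 1 / N n \<le> t" for p n t
  proof -
    have "N n * (t - p) \<le> 0 \<or> 1 \<le> N n * (t - p)"
      using that N1[of n] by (auto simp: mult_le_0_iff field_simps)
    then show ?thesis by (simp add: k_def \<rho>(3))
  qed
  have kc: "continuous_on A (k p n)" for p n A
    unfolding k_def
    by (intro continuous_intros continuous_on_compose2[OF Cinf_on_continuous[OF \<rho>(1)]]) auto
  have kI: "(LINT t|lebesgue_on {p..p + 1}. k p n t) = 1" for p n
  proof -
    have "((\<lambda>t. k p n t) has_integral (R (N n * (p + 1 - p)) - R (N n * (p - p)))) {p..p + 1}"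
      by (rule fundamental_theorem_of_calculus)
        (auto simp flip: has_real_derivative_iff_has_vector_derivative intro: has_field_derivative_at_within dRp)
    then have "integral {p..p + 1} (k p n) = 1"
      using Rlarge[of p "p + 1" n] R01(1)[of 0] by (simp add: integral_unique)
    then show ?thesis
      by (subst lebesgue_integral_eq_integral) (auto intro!: continuous_imp_integrable_real kc)
  qed
  have cc: "continuous_on {p..q} c" if "0 < p" for p q
    using that by (intro continuous_on_subset[OF c]) auto
  have ck: "(\<lambda>n. LINT t|lebesgue_on {a..b + 1}. c t * k p n t) \<longlonglongrightarrow> c p" if p: "a \<le> p" "p \<le> b" for p
  proof -
    have "(\<lambda>n. LINT t|lebesgue_on {p..p + 1}. c t * k p n t) \<longlonglongrightarrow> c p"
      by (rule approximate_identity_tendsto)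
        (use p ab kc kI k0 N1 in \<open>auto intro!: cc simp: k_def \<rho>(2) N_def\<close>)
    moreover have "(LINT t|lebesgue_on {a..b + 1}. c t * k p n t) = (LINT t|lebesgue_on {p..p + 1}. c t * k p n t)" for n
    proof (rule LINT_restrict_support)
      fix t assume t: "t \<notin> {p..p + 1}"
      have "1 / N n \<le> 1" using N1[of n] by simp
      then have "t \<le> p \<or> p + 1 / N n \<le> t" using t by auto
      then show "c t * k p n t = 0" by (simp add: k0)
    qed (use p in auto)
    ultimately show ?thesis by simp
  qed
  have cd: "(\<lambda>n. LINT t|lebesgue_on {0<..}. c t * deriv (\<theta> n) t) \<longlonglongrightarrow> c a - c b"
  proof -
    have "(LINT t|lebesgue_on {0<..}. c t * deriv (\<theta> n) t)
        = (LINT t|lebesgue_on {a..b + 1}. c t * k a n t) - (LINT t|lebesgue_on {a..b + 1}. c t * k b n t)" for n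
    proof -
      have "(LINT t|lebesgue_on {0<..}. c t * deriv (\<theta> n) t) = (LINT t|lebesgue_on {a..b + 1}. c t * deriv (\<theta> n) t)"
      proof (rule LINT_restrict_support)
        fix t assume t: "t \<notin> {a..b + 1}"
        have "1 / N n \<le> 1" using N1[of n] by simp
        then have "(t \<le> a \<or> a + 1 / N n \<le> t)" "(t \<le> b \<or> b + 1 / N n \<le> t)" using t ab by auto
        then show "c t * deriv (\<theta> n) t = 0" by (simp add: k0 d\<theta>)
      qed (use ab in auto)
      also have "\<dots> = (LINT t|lebesgue_on {a..b + 1}. c t * k a n t - c t * k b n t)"
        by (simp add: d\<theta> right_diff_distrib)
      also have "\<dots> = (LINT t|lebesgue_on {a..b + 1}. c t * k a n t) - (LINT t|lebesgue_on {a..b + 1}. c t * k b n t)"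
        by (intro Bochner_Integration.integral_diff continuous_imp_integrable_real continuous_on_mult kc cc ab)
      finally show ?thesis .
    qed
    then show ?thesis using tendsto_diff[OF ck ck, of a b] ab by simp
  qed
  have h\<theta>: "(\<lambda>n. LINT t|lebesgue_on {0<..}. h t * \<theta> n t) \<longlonglongrightarrow> (LINT t|lebesgue_on {a..b}. h t)"
    if h: "integrable (lebesgue_on {a..b + 1}) h" for h
  proof -
    let ?M = "lebesgue_on {a..b + 1}"
    have "(LINT t|lebesgue_on {0<..}. h t * \<theta> n t) = (LINT t|?M. h t * \<theta> n t)" for n
      by (rule LINT_restrict_support) (use ab \<theta>0 in auto)
    moreover have "(\<lambda>n. LINT t|?M. h t * \<theta> n t) \<longlonglongrightarrow> (LINT t|?M. h t * indicator {a..b} t)"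
    proof (rule integral_dominated_convergence[where w = "\<lambda>t. \<bar>h t\<bar>"])
      have hm: "h \<in> borel_measurable ?M" using h by auto
      have "\<theta> n \<in> borel_measurable ?M" for n
        by (intro continuous_imp_measurable_on_sets_lebesgue continuous_on_subset[OF Cinf_on_continuous[OF test_functions_Cinf[OF \<theta>t]]]) auto
      then show "(\<lambda>t. h t * \<theta> n t) \<in> borel_measurable ?M" for n using hm by (intro borel_measurable_times)
      have "(indicator {a..b} :: real \<Rightarrow> real) \<in> borel_measurable ?M" by (intro measurable_restrict_space1 borel_measurable_indicator) simp
      then show "(\<lambda>t. h t * indicator {a..b} t) \<in> borel_measurable ?M" using hm by (intro borel_measurable_times)
      show "integrable ?M (\<lambda>t. \<bar>h t\<bar>)" using h by simp
      have "\<bar>\<theta> n t\<bar> \<le> 1" for n t unfolding \<theta>_def using R01(3,4) by (smt (verit))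
      then show "AE t in ?M. norm (h t * \<theta> n t) \<le> \<bar>h t\<bar>" for n
        by (intro AE_I2) (simp add: abs_mult mult_left_le)
      have lim1: "(\<lambda>n. R (N n * (t - p))) \<longlonglongrightarrow> 1" if pt: "p < t" for t p
      proof (rule tendsto_eventually)
        obtain M :: nat where M: "1 / real (Suc M) < t - p" using pt nat_approx_posE[of "t - p"] by (metis diff_gt_0_iff_gt)
        have "R (N n * (t - p)) = 1" if "n \<ge> M" for n
        proof (rule R01(2))
          have "1 \<le> N M * (t - p)" using M by (simp add: N_def field_simps)
          also have "\<dots> \<le> N n * (t - p)" using that \<open>p < t\<close> by (intro mult_right_mono) (auto simp: N_def)
          finally show "1 \<le> N n * (t - p)" .
        qed
        then show "\<forall>\<^sub>F n in sequentially. R (N n * (t - p)) = 1" by (intro eventually_sequentiallyI)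
      qed
      have lim: "(\<lambda>n. \<theta> n t) \<longlonglongrightarrow> indicator {a..b} t" if "t \<noteq> a" "t \<in> {a..b + 1}" for t
      proof (cases "t \<le> b")
        case True
        have "(\<lambda>n. \<theta> n t) \<longlonglongrightarrow> 1 - 0"
          unfolding \<theta>_def using that True by (intro tendsto_diff lim1) (auto simp: Rsmall)
        then show ?thesis using True that by simp
      next
        case False
        have "(\<lambda>n. \<theta> n t) \<longlonglongrightarrow> 1 - 1"
          unfolding \<theta>_def using that False by (intro tendsto_diff lim1) auto
        then show ?thesis using False by simp
      qed
      have "AE t in ?M. t \<in> {a..b + 1}" by (intro AE_I2) simp
      moreover have "AE t in ?M. t \<noteq> a" by (rule AE_lebesgue_on_neq) simp
      ultimately show "AE t in ?M. (\<lambda>n. h t * \<theta> n t) \<longlonglongrightarrow> h t * indicator {a..b} t"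
        by eventually_elim (intro tendsto_mult_left lim)
    qed
    moreover have "(LINT t|?M. h t * indicator {a..b} t) = (LINT t|lebesgue_on {a..b}. h t * indicator {a..b} t)"
      by (rule LINT_restrict_support) auto
    moreover have "\<dots> = (LINT t|lebesgue_on {a..b}. h t)"
      by (rule Bochner_Integration.integral_cong) auto
    ultimately show ?thesis by simp
  qed
  have g1: "integrable (lebesgue_on {a..b + 1}) g"
    by (rule integrable_lebesgue_on_subset[OF g[of "b + 1"]]) (use ab in auto)
  have r1: "integrable (lebesgue_on {p..q}) (\<lambda>t. r)" for p q :: real by (intro continuous_imp_integrable_real) simp
  have "(\<lambda>n. - (LINT t|lebesgue_on {0<..}. c t * deriv (\<theta> n) t) + (LINT t|lebesgue_on {0<..}. g t * \<theta> n t))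
      \<longlonglongrightarrow> - (c a - c b) + (LINT t|lebesgue_on {a..b}. g t)"
    by (intro tendsto_intros cd h\<theta> g1)
  then have "(\<lambda>n. LINT t|lebesgue_on {0<..}. r * \<theta> n t) \<longlonglongrightarrow> - (c a - c b) + (LINT t|lebesgue_on {a..b}. g t)"
    by (simp only: weak[OF \<theta>t])
  then have "- (c a - c b) + (LINT t|lebesgue_on {a..b}. g t) = (LINT t|lebesgue_on {a..b}. r)"
    using h\<theta>[OF r1] LIMSEQ_unique by blast
  moreover have "integrable (lebesgue_on {a..b}) g"
    by (rule integrable_lebesgue_on_subset[OF g1]) auto
  ultimately show ?thesis using r1 by simp
qed

text \<open>The test functions live on \<open>(0, \<infinity>)\<close>; the initial time is reached by continuity of \<open>c\<close> and
  integrability of \<open>g\<close> up to 0.\<close>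

lemma weak_derivative_increment:
  fixes c g :: "real \<Rightarrow> real"
  assumes c: "continuous_on {0..} c" and g: "\<And>T. 0 < T \<Longrightarrow> integrable (lebesgue_on {0..T}) g"
    and weak: "\<And>\<theta>. \<theta> \<in> test_functions {0<..} \<Longrightarrow>
      - (LINT t|lebesgue_on {0<..}. c t * deriv \<theta> t) + (LINT t|lebesgue_on {0<..}. g t * \<theta> t)
      = (LINT t|lebesgue_on {0<..}. r * \<theta> t)"
    and ab: "0 \<le> a" "a < b"
  shows "c b - c a = (LINT t|lebesgue_on {a..b}. r - g t)"
proof (cases "a = 0")
  case False
  then show ?thesis using ab by (intro weak_derivative_increment_pos[OF c g weak]) auto
next
  case True
  let ?M = "lebesgue_on {0..b}"
  define e where "e n = b / real (Suc (Suc n))" for n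
  have e: "0 < e n" "e n < b" for n using ab True by (auto simp: e_def field_simps intro: add_pos_nonneg)
  have e0: "e \<longlonglongrightarrow> 0"
    unfolding e_def using LIMSEQ_Suc[OF LIMSEQ_Suc[OF lim_const_over_n]] by blast
  have int: "integrable ?M (\<lambda>t. r - g t)"
    using ab True by (intro Bochner_Integration.integrable_diff g continuous_imp_integrable_real) auto
  have "(\<lambda>n. c (e n)) \<longlonglongrightarrow> c 0"
    by (rule continuous_on_tendsto_compose[OF c e0]) (use less_imp_le[OF e(1)] in auto)
  then have "(\<lambda>n. c b - c (e n)) \<longlonglongrightarrow> c b - c 0" by (intro tendsto_intros)
  moreover have "(\<lambda>n. LINT t|?M. (r - g t) * indicator {e n..b} t) \<longlonglongrightarrow> (LINT t|?M. r - g t)"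
  proof (rule integral_dominated_convergence[where w = "\<lambda>t. \<bar>r - g t\<bar>"])
    have "(indicator {e n..b} :: real \<Rightarrow> real) \<in> borel_measurable ?M" for n by (intro measurable_restrict_space1 borel_measurable_indicator) simp
    then show "(\<lambda>t. (r - g t) * indicator {e n..b} t) \<in> borel_measurable ?M" for n
      using int by (intro borel_measurable_times) auto
    have "AE t in ?M. t \<in> {0..b}" by (intro AE_I2) simp
    moreover have "AE t in ?M. t \<noteq> 0" by (rule AE_lebesgue_on_neq) simp
    ultimately show "AE t in ?M. (\<lambda>n. (r - g t) * indicator {e n..b} t) \<longlonglongrightarrow> r - g t"
    proof eventually_elim
      case (elim t)
      then have "\<forall>\<^sub>F n in sequentially. e n < t" using order_tendstoD(2)[OF e0, of t] by auto
      then have "\<forall>\<^sub>F n in sequentially. (r - g t) * indicator {e n..b} t = r - g t"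
        by eventually_elim (use elim in auto)
      then show ?case by (rule tendsto_eventually)
    qed
  qed (use int in \<open>auto simp: indicator_def\<close>)
  moreover have "c b - c (e n) = (LINT t|?M. (r - g t) * indicator {e n..b} t)" for n
  proof -
    have "c b - c (e n) = (LINT t|lebesgue_on {e n..b}. r - g t)"
      by (rule weak_derivative_increment_pos[OF c g weak e])
    also have "\<dots> = (LINT t|lebesgue_on {e n..b}. (r - g t) * indicator {e n..b} t)"
      by (rule Bochner_Integration.integral_cong) auto
    also have "\<dots> = (LINT t|?M. (r - g t) * indicator {e n..b} t)"
      using e[of n] by (intro LINT_restrict_support[symmetric]) auto
    finally show ?thesis .
  qed
  ultimately show ?thesis using True LIMSEQ_unique by force
qed

lemma integrable_continuous_mult:
  fixes c G :: "real \<Rightarrow> real"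
  assumes c: "continuous_on {0..T} c" and G: "integrable (lebesgue_on {0..T}) G"
  shows "integrable (lebesgue_on {0..T}) (\<lambda>t. c t * G t)"
proof -
  let ?M = "lebesgue_on {0..T}"
  obtain B where B: "\<And>t. t \<in> {0..T} \<Longrightarrow> \<bar>c t\<bar> \<le> B"
  proof -
    have "bounded (c ` {0..T})" by (rule compact_imp_bounded[OF compact_continuous_image[OF c]]) simp
    then obtain B where "\<forall>y\<in>c ` {0..T}. norm y \<le> B" by (auto simp: bounded_iff)
    then show ?thesis by (intro that[of B]) auto
  qed
  show ?thesis
  proof (rule Bochner_Integration.integrable_bound)
    show "integrable ?M (\<lambda>t. B * \<bar>G t\<bar>)" using G by simp
    show "(\<lambda>t. c t * G t) \<in> borel_measurable ?M"
      by (rule borel_measurable_times[OF continuous_imp_measurable_on_sets_lebesgue[OF c]]) (use G in auto)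
    show "AE t in ?M. norm (c t * G t) \<le> norm (B * \<bar>G t\<bar>)"
      using B by (intro AE_I2) (auto simp: abs_mult intro!: mult_right_mono order_trans[OF B abs_ge_self])
  qed
qed

text \<open>On a short interval \<open>c\<close> is nearly constant, so \<open>c b\<^sup>2 - c a\<^sup>2 = (c a + c b) \<integral> G\<close> differs from
  \<open>2 \<integral> c G\<close> by a small multiple of \<open>\<integral> \<bar>G\<bar>\<close>; the errors are summed over a fine partition.\<close>

lemma square_increment:
  fixes c G :: "real \<Rightarrow> real"
  assumes T: "0 < T" and c: "continuous_on {0..T} c" and G: "integrable (lebesgue_on {0..T}) G"
    and inc: "\<And>a b. 0 \<le> a \<Longrightarrow> a < b \<Longrightarrow> b \<le> T \<Longrightarrow> c b - c a = (LINT t|lebesgue_on {a..b}. G t)"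
  shows "integrable (lebesgue_on {0..T}) (\<lambda>t. c t * G t)"
    and "(c T)\<^sup>2 - (c 0)\<^sup>2 = 2 * (LINT t|lebesgue_on {0..T}. c t * G t)"
proof -
  let ?M = "lebesgue_on {0..T}"
  show cG: "integrable ?M (\<lambda>t. c t * G t)" by (rule integrable_continuous_mult[OF c G])
  have sub: "f integrable_on {a..b}" "(LINT t|lebesgue_on {a..b}. f t) = integral {a..b} f"
    if "integrable ?M f" "0 \<le> a" "b \<le> T" for f :: "real \<Rightarrow> real" and a b
  proof -
    have "integrable (lebesgue_on {a..b}) f" by (rule integrable_lebesgue_on_subset[OF that(1)]) (use that in auto)
    then show "f integrable_on {a..b}" "(LINT t|lebesgue_on {a..b}. f t) = integral {a..b} f"
      by (auto intro: integrable_on_lebesgue_on lebesgue_integral_eq_integral)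
  qed
  have aG: "integrable ?M (\<lambda>t. \<bar>G t\<bar>)" using G by simp
  define \<Phi> where "\<Phi> t = (c t)\<^sup>2 - 2 * integral {0..t} (\<lambda>t. c t * G t)" for t
  define A where "A t = integral {0..t} (\<lambda>t. \<bar>G t\<bar>)" for t
  have step: "\<bar>\<Phi> b - \<Phi> a\<bar> \<le> 2 * e * (A b - A a)"
    if ab: "0 \<le> a" "a < b" "b \<le> T" and e: "0 \<le> e" "\<And>s t. s \<in> {a..b} \<Longrightarrow> t \<in> {a..b} \<Longrightarrow> \<bar>c s - c t\<bar> \<le> e" for a b e
  proof -
    have comb: "integral {0..b} f - integral {0..a} f = integral {a..b} f" if "integrable ?M f" for f :: "real \<Rightarrow> real"
      using Henstock_Kurzweil_Integration.integral_combine[of 0 a b f] sub(1)[OF that, of 0 b] ab by simp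
    have iG: "G integrable_on {a..b}" "(\<lambda>t. c t * G t) integrable_on {a..b}" "(\<lambda>t. \<bar>G t\<bar>) integrable_on {a..b}"
      using sub(1)[OF G] sub(1)[OF cG] sub(1)[OF aG] ab by auto
    have "\<Phi> b - \<Phi> a = (c b + c a) * (c b - c a) - 2 * integral {a..b} (\<lambda>t. c t * G t)"
      using comb[OF cG] by (simp add: \<Phi>_def power2_eq_square algebra_simps)
    also have "c b - c a = integral {a..b} G" using inc[OF ab] sub(2)[OF G] ab by simp
    also have "(c b + c a) * integral {a..b} G - 2 * integral {a..b} (\<lambda>t. c t * G t)
        = integral {a..b} (\<lambda>t. (c b + c a) * G t - 2 * (c t * G t))"
      using iG by (subst Henstock_Kurzweil_Integration.integral_diff) (auto intro: integrable_on_mult_right)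
    also have "\<bar>\<dots>\<bar> \<le> integral {a..b} (\<lambda>t. 2 * e * \<bar>G t\<bar>)"
    proof -
      have "norm (integral {a..b} (\<lambda>t. (c b + c a) * G t - 2 * (c t * G t))) \<le> integral {a..b} (\<lambda>t. 2 * e * \<bar>G t\<bar>)"
    proof (rule integral_norm_bound_integral)
      show "(\<lambda>t. (c b + c a) * G t - 2 * (c t * G t)) integrable_on {a..b}"
        using iG by (intro Henstock_Kurzweil_Integration.integrable_diff integrable_on_mult_right)
      show "(\<lambda>t. 2 * e * \<bar>G t\<bar>) integrable_on {a..b}" using iG by (intro integrable_on_mult_right)
      fix t assume t: "t \<in> {a..b}"
      have "\<bar>c b + c a - 2 * c t\<bar> \<le> 2 * e" using e(2)[of b t] e(2)[of a t] t ab by auto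
      then have "\<bar>c b + c a - 2 * c t\<bar> * \<bar>G t\<bar> \<le> 2 * e * \<bar>G t\<bar>" by (rule mult_right_mono) simp
      then show "norm ((c b + c a) * G t - 2 * (c t * G t)) \<le> 2 * e * \<bar>G t\<bar>"
        by (simp add: left_diff_distrib flip: abs_mult)
    qed
      then show ?thesis by simp
    qed
    also have "\<dots> = 2 * e * (A b - A a)" using comb[OF aG] by (simp add: A_def)
    finally show ?thesis .
  qed
  have A0: "0 \<le> A T"
    unfolding A_def using sub(1)[OF aG, of 0 T] T by (intro Henstock_Kurzweil_Integration.integral_nonneg) auto
  have small: "\<bar>\<Phi> T - \<Phi> 0\<bar> \<le> 2 * e * A T" if e: "0 < e" for e
  proof -
    have "uniformly_continuous_on {0..T} c" by (intro compact_uniformly_continuous c) simp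
    then obtain d where d: "0 < d" "\<And>s t. s \<in> {0..T} \<Longrightarrow> t \<in> {0..T} \<Longrightarrow> \<bar>t - s\<bar> < d \<Longrightarrow> \<bar>c t - c s\<bar> < e"
      using e unfolding uniformly_continuous_on_def dist_real_def by metis
    obtain q :: nat where q: "1 / real (Suc q) < d / T" using d(1) T nat_approx_posE[of "d / T"] by auto
    define n where "n = Suc q"
    have n: "0 < real n" "T / real n < d" using q T by (auto simp: n_def field_simps)
    define p where "p i = real i * T / real n" for i
    have p: "p (Suc i) = p i + T / real n" "0 \<le> p i" for i using T by (auto simp: p_def add_divide_distrib algebra_simps)
    have pT: "p i \<le> T" if "i \<le> n" for i
      using that T n(1) mult_right_mono[of "real i" "real n" T] by (simp add: p_def divide_le_eq mult.commute)
    have "\<bar>\<Phi> (p k) - \<Phi> (p 0)\<bar> \<le> 2 * e * (A (p k) - A (p 0))" if "k \<le> n" for k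
      using that
    proof (induction k)
      case (Suc k)
      have "\<bar>\<Phi> (p (Suc k)) - \<Phi> (p k)\<bar> \<le> 2 * e * (A (p (Suc k)) - A (p k))"
      proof (rule step)
        show "p k < p (Suc k)" using p(1)[of k] T n(1) by simp
        fix s t assume st: "s \<in> {p k..p (Suc k)}" "t \<in> {p k..p (Suc k)}"
        then have "\<bar>s - t\<bar> < d" using p(1)[of k] n(2) by auto
        moreover have "s \<in> {0..T}" "t \<in> {0..T}" using st p(2)[of k] pT[OF Suc.prems] by auto
        ultimately show "\<bar>c s - c t\<bar> \<le> e" using d(2)[of t s] by auto
      qed (use p(2) pT[OF Suc.prems] e in auto)
      then show ?case using Suc by (simp add: algebra_simps)
    qed simp
    from this[of n] have "\<bar>\<Phi> T - \<Phi> 0\<bar> \<le> 2 * e * (A T - A 0)" using n(1) by (simp add: p_def)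
    then show ?thesis by (simp add: A_def)
  qed
  have "\<bar>\<Phi> T - \<Phi> 0\<bar> \<le> 0"
  proof (rule field_le_epsilon)
    fix e :: real assume "0 < e"
    have "\<bar>\<Phi> T - \<Phi> 0\<bar> \<le> 2 * (e / (2 * (A T + 1))) * A T"
      using \<open>0 < e\<close> A0 by (intro small) auto
    also have "\<dots> \<le> e" using \<open>0 < e\<close> A0 by (simp add: field_simps)
    finally show "\<bar>\<Phi> T - \<Phi> 0\<bar> \<le> 0 + e" by simp
  qed
  then show "(c T)\<^sup>2 - (c 0)\<^sup>2 = 2 * (LINT t|?M. c t * G t)"
    using sub(2)[OF cG, of 0 T] by (simp add: \<Phi>_def)
qed

section \<open>The energy balance of the splitting\<close>

locale leray_hopf_splitting = orthonormal_basis +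
  fixes \<nu> :: real and f u0 :: vfield and u :: "real \<Rightarrow> vfield" and m :: nat
  assumes \<nu>: "0 < \<nu>" and f: "f \<in> L2 \<Omega>" and w_V: "w k \<in> V_space \<Omega>"
    and f_proj: "AE x in lebesgue_on \<Omega>. P_proj \<Omega> w m f x = f x"
    and sol: "leray_hopf_solution \<Omega> \<nu> f u0 u"
begin

lemma u_H: "0 \<le> t \<Longrightarrow> u t \<in> H_space \<Omega>"
  using sol by (simp add: leray_hopf_solution_def weakly_continuous_H_def)

lemma coef_u_continuous: "continuous_on {0..} (\<lambda>t. coef (u t) k)"
  using sol w_H[of k] by (simp add: leray_hopf_solution_def weakly_continuous_H_def)

lemma coef_u_continuous_Icc: "continuous_on {0..T} (\<lambda>t. coef (u t) k)"
  by (rule continuous_on_subset[OF coef_u_continuous]) auto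

lemma u_L2loc_V: "L2loc_V \<Omega> u"
  using sol by (simp add: leray_hopf_solution_def)

lemma AE_subinterval:
  assumes "AE t in lebesgue_on {0::real..}. P t"
  shows "AE t in lebesgue_on {0..T}. P t"
proof -
  have "AE t in lebesgue. t \<in> {0..} \<longrightarrow> P t" using assms by (simp add: AE_restrict_space_iff)
  then show ?thesis by (subst AE_restrict_space_iff) (auto elim: eventually_mono)
qed

definition "grad_coef t k = L2_inner \<Omega> (weak_jac \<Omega> (u t)) (weak_jac \<Omega> (w k))"
definition "conv_coef t k = B_pairing \<Omega> (u t) (u t) (w k)"

lemma grad_coef_integrable: "0 < T \<Longrightarrow> integrable (lebesgue_on {0..T}) (\<lambda>t. grad_coef t k)"
  unfolding grad_coef_def by (intro grad_inner_path_integrable u_L2loc_V w_V)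

lemma conv_coef_integrable: "0 < T \<Longrightarrow> integrable (lebesgue_on {0..T}) (\<lambda>t. conv_coef t k)"
  unfolding conv_coef_def by (intro B_pairing_path_integrable u_L2loc_V w_V)

lemma LINT_coef_sum:
  assumes T: "0 < T"
  shows "integrable (lebesgue_on {0..T}) (\<lambda>t. \<Sum>k<m. coef (u t) k * grad_coef t k)"
    and "integrable (lebesgue_on {0..T}) (\<lambda>t. \<Sum>k<m. coef (u t) k * conv_coef t k)"
    and "integrable (lebesgue_on {0..T}) (\<lambda>t. \<Sum>k<m. coef (u t) k * coef f k)"
  by (intro Bochner_Integration.integrable_sum integrable_continuous_mult coef_u_continuous_Icc
      grad_coef_integrable conv_coef_integrable T continuous_imp_integrable_real continuous_on_const)+

text \<open>Testing the equation with \<open>w\<^sub>k\<close> gives an equation for the \<open>k\<close>-th coefficient that may be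
  multiplied by this coefficient, unlike the equation for \<open>u\<close>. So the low modes satisfy an energy
  equality, while the full solution only satisfies an inequality.\<close>

lemma low_mode_energy_identity:
  assumes T: "0 < T"
  shows "(\<Sum>k<m. (coef (u T) k)\<^sup>2) - (\<Sum>k<m. (coef (u 0) k)\<^sup>2) =
    2 * ((LINT t|lebesgue_on {0..T}. (\<Sum>k<m. coef (u t) k * coef f k))
      - \<nu> * (LINT t|lebesgue_on {0..T}. (\<Sum>k<m. coef (u t) k * grad_coef t k))
      - (LINT t|lebesgue_on {0..T}. (\<Sum>k<m. coef (u t) k * conv_coef t k)))"
proof -
  let ?M = "lebesgue_on {0..T}"
  define g where "g k t = \<nu> * grad_coef t k + conv_coef t k" for k t
  have g: "integrable (lebesgue_on {0..S}) (g k)" if "0 < S" for S k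
    unfolding g_def using that
    by (intro Bochner_Integration.integrable_add integrable_mult_right grad_coef_integrable conv_coef_integrable)
  have weak: "- (LINT t|lebesgue_on {0<..}. coef (u t) k * deriv \<theta> t) + (LINT t|lebesgue_on {0<..}. g k t * \<theta> t)
      = (LINT t|lebesgue_on {0<..}. coef f k * \<theta> t)" if "\<theta> \<in> test_functions {0<..}" for k \<theta>
    using sol w_V[of k] that
    by (simp add: leray_hopf_solution_def NSE_weak_form_def g_def grad_coef_def conv_coef_def)
  note inc = weak_derivative_increment[OF coef_u_continuous g weak]
  have G: "integrable ?M (\<lambda>t. coef f k - g k t)" for k
    by (intro Bochner_Integration.integrable_diff g T continuous_imp_integrable_real continuous_on_const)
  have sq: "(coef (u T) k)\<^sup>2 - (coef (u 0) k)\<^sup>2 = 2 * (LINT t|?M. coef (u t) k * (coef f k - g k t))" for k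
    by (rule square_increment(2)[OF T coef_u_continuous_Icc G inc])
  have cG: "integrable ?M (\<lambda>t. coef (u t) k * (coef f k - g k t))" for k
    by (rule integrable_continuous_mult[OF coef_u_continuous_Icc G])
  have "(\<Sum>k<m. (coef (u T) k)\<^sup>2) - (\<Sum>k<m. (coef (u 0) k)\<^sup>2)
      = 2 * (\<Sum>k<m. LINT t|?M. coef (u t) k * (coef f k - g k t))"
    by (simp add: sq sum_distrib_left flip: sum_subtractf)
  also have "(\<Sum>k<m. LINT t|?M. coef (u t) k * (coef f k - g k t)) = (LINT t|?M. (\<Sum>k<m. coef (u t) k * (coef f k - g k t)))"
    by (rule Bochner_Integration.integral_sum[symmetric]) (rule cG)
  also have "\<dots> = (LINT t|?M. (\<Sum>k<m. coef (u t) k * coef f k)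
      - \<nu> * (\<Sum>k<m. coef (u t) k * grad_coef t k) - (\<Sum>k<m. coef (u t) k * conv_coef t k))"
    by (intro Bochner_Integration.integral_cong refl)
      (simp add: g_def sum_distrib_left algebra_simps sum.distrib sum_subtractf)
  also have "\<dots> = (LINT t|?M. (\<Sum>k<m. coef (u t) k * coef f k))
      - \<nu> * (LINT t|?M. (\<Sum>k<m. coef (u t) k * grad_coef t k)) - (LINT t|?M. (\<Sum>k<m. coef (u t) k * conv_coef t k))"
    using LINT_coef_sum[OF T] by simp
  finally show ?thesis .
qed

text \<open>A force in the span of the low modes only sees the low modes of the solution.\<close>

lemma force_u_inner:
  assumes "0 \<le> t"
  shows "L2_inner \<Omega> f (u t) = (\<Sum>k<m. coef (u t) k * coef f k)"
proof -
  have "L2_inner \<Omega> f (u t) = L2_inner \<Omega> (P_proj \<Omega> w m f) (u t)"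
    using f_proj f assms by (intro L2_inner_cong_AE) (auto simp: P_proj_eq comb_L2 H_L2 u_H)
  also have "\<dots> = L2_inner \<Omega> (u t) (comb (coef f) {..<m})"
    by (simp add: P_proj_eq f L2_inner_commute)
  also have "\<dots> = (\<Sum>k<m. coef (u t) k * coef f k)"
    using assms by (simp add: inner_comb H_L2 u_H mult.commute)
  finally show ?thesis .
qed

text \<open>This is \<open>\<parallel>\<nabla>y\<parallel>\<^sup>2\<close>; as a polynomial in the coefficients it is visibly continuous in time.\<close>

definition "low_grad_sq t = (\<Sum>k<m. \<Sum>l<m. coef (u t) k * coef (u t) l * L2_inner \<Omega> (weak_jac \<Omega> (w k)) (weak_jac \<Omega> (w l)))"

text \<open>The first sum is \<open>(B(u,u), y)\<close> and the second is \<open>(\<nabla>u, \<nabla>y)\<close>. The inequality says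
  \<open>0 \<le> \<parallel>\<nabla>z\<parallel>\<^sup>2\<close>.\<close>

lemma splitting_pointwise:
  assumes t: "0 \<le> t" and V: "u t \<in> V_space \<Omega>"
  shows "e_m \<Omega> w m (u t) + E_m \<Omega> \<nu> w m (u t) = (\<Sum>k<m. coef (u t) k * conv_coef t k)
      - \<nu> * (\<Sum>k<m. coef (u t) k * grad_coef t k) + \<nu> * low_grad_sq t"
    and "2 * (\<Sum>k<m. coef (u t) k * grad_coef t k) - (V_norm \<Omega> (u t))\<^sup>2 \<le> low_grad_sq t"
proof -
  define y where "y = comb (coef (u t)) {..<m}"
  define z where "z x = u t x - y x" for x
  have P: "P_proj \<Omega> w m (u t) = y" "Q_proj \<Omega> w m (u t) = z"
    using t by (simp_all add: Q_proj_def P_proj_eq H_L2 u_H y_def z_def[abs_def])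
  let ?Y = "\<lambda>x. \<Sum>k<m. coef (u t) k *\<^sub>R weak_jac \<Omega> (w k) x"
  have yV: "y \<in> V_space \<Omega>" and y_jac: "AE x in lebesgue_on \<Omega>. weak_jac \<Omega> y x = ?Y x"
    using V_sum[of "{..<m}" w "coef (u t)"] w_V by (auto simp: y_def comb_def)
  have zV: "z \<in> V_space \<Omega>" unfolding z_def by (rule V_diff[OF V yV])
  note J = weak_jac_V_L2[OF V] weak_jac_V_L2[OF yV] weak_jac_V_L2[OF zV]
  have wJ: "weak_jac \<Omega> (w k) \<in> L2 \<Omega>" for k by (rule weak_jac_V_L2[OF w_V])
  have YL: "?Y \<in> L2 \<Omega>" by (intro L2_sum L2_scaleR wJ)
  have inner_Y: "L2_inner \<Omega> h (weak_jac \<Omega> y) = (\<Sum>k<m. coef (u t) k * L2_inner \<Omega> h (weak_jac \<Omega> (w k)))"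
    if h: "h \<in> L2 \<Omega>" for h
  proof -
    have "L2_inner \<Omega> h (weak_jac \<Omega> y) = L2_inner \<Omega> h ?Y"
      by (rule L2_inner_cong_AE[OF h h J(2) YL _ y_jac]) simp
    also have "\<dots> = (\<Sum>k<m. coef (u t) k * L2_inner \<Omega> h (weak_jac \<Omega> (w k)))"
      by (subst L2_inner_sum_right) (auto intro: L2_scaleR wJ h simp: L2_inner_scaleR_right)
    finally show ?thesis .
  qed
  have uy: "L2_inner \<Omega> (weak_jac \<Omega> (u t)) (weak_jac \<Omega> y) = (\<Sum>k<m. coef (u t) k * grad_coef t k)"
    unfolding inner_Y[OF J(1)] grad_coef_def by simp
  have yw: "L2_inner \<Omega> (weak_jac \<Omega> y) (weak_jac \<Omega> (w k)) =
      (\<Sum>l<m. coef (u t) l * L2_inner \<Omega> (weak_jac \<Omega> (w k)) (weak_jac \<Omega> (w l)))" for k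
    unfolding L2_inner_commute[of \<Omega> "weak_jac \<Omega> y" "weak_jac \<Omega> (w k)"] by (rule inner_Y[OF wJ])
  have yy: "L2_inner \<Omega> (weak_jac \<Omega> y) (weak_jac \<Omega> y) = low_grad_sq t"
    unfolding inner_Y[OF J(2)] yw low_grad_sq_def
    by (simp add: sum_distrib_left mult.assoc)
  have z_jac: "AE x in lebesgue_on \<Omega>. weak_jac \<Omega> z x = weak_jac \<Omega> (u t) x - weak_jac \<Omega> y x"
    unfolding z_def by (rule weak_jac_diff_AE[OF V_H10[OF V] V_H10[OF yV]])
  note D = L2_diff[OF J(1,2)]
  have yz: "L2_inner \<Omega> (weak_jac \<Omega> y) (weak_jac \<Omega> z) = (\<Sum>k<m. coef (u t) k * grad_coef t k) - low_grad_sq t"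
  proof -
    have "L2_inner \<Omega> (weak_jac \<Omega> y) (weak_jac \<Omega> z) = L2_inner \<Omega> (weak_jac \<Omega> y) (\<lambda>x. weak_jac \<Omega> (u t) x - weak_jac \<Omega> y x)"
      by (rule L2_inner_cong_AE[OF J(2) J(2) J(3) D _ z_jac]) simp
    also have "\<dots> = L2_inner \<Omega> (weak_jac \<Omega> y) (weak_jac \<Omega> (u t)) - L2_inner \<Omega> (weak_jac \<Omega> y) (weak_jac \<Omega> y)"
      by (rule L2_inner_diff_right[OF J(1,2,2)])
    finally show ?thesis unfolding L2_inner_commute[of \<Omega> "weak_jac \<Omega> y" "weak_jac \<Omega> (u t)"] uy yy .
  qed
  have "0 \<le> L2_inner \<Omega> (\<lambda>x. weak_jac \<Omega> (u t) x - weak_jac \<Omega> y x) (\<lambda>x. weak_jac \<Omega> (u t) x - weak_jac \<Omega> y x)"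
    by (rule L2_inner_self_nonneg)
  also have "\<dots> = (V_norm \<Omega> (u t))\<^sup>2 - 2 * (\<Sum>k<m. coef (u t) k * grad_coef t k) + low_grad_sq t"
    unfolding L2_inner_diff_left[OF J(1,2) D] L2_inner_diff_right[OF J(1,2,1)] L2_inner_diff_right[OF J(1,2,2)]
      L2_inner_commute[of \<Omega> "weak_jac \<Omega> y" "weak_jac \<Omega> (u t)"] uy yy V_norm_def L2_norm_sq by simp
  finally show "2 * (\<Sum>k<m. coef (u t) k * grad_coef t k) - (V_norm \<Omega> (u t))\<^sup>2 \<le> low_grad_sq t" by linarith
  have "B_pairing \<Omega> (u t) (u t) y = (\<Sum>k<m. coef (u t) k * conv_coef t k)"
    unfolding y_def comb_def conv_coef_def by (rule B_pairing_sum_right[OF V V w_V])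
  then have "e_m \<Omega> w m (u t) = (\<Sum>k<m. coef (u t) k * conv_coef t k)"
    using B_pairing_splitting[OF V yV] by (simp add: e_m_def Let_def P z_def[abs_def])
  then show "e_m \<Omega> w m (u t) + E_m \<Omega> \<nu> w m (u t) = (\<Sum>k<m. coef (u t) k * conv_coef t k)
      - \<nu> * (\<Sum>k<m. coef (u t) k * grad_coef t k) + \<nu> * low_grad_sq t"
    by (simp add: E_m_def Let_def P yz algebra_simps)
qed

text \<open>Subtracting the energy equality of the low modes from the energy inequality of the solution
  leaves a lower bound for the energy transfer that does not depend on \<open>T\<close>; the dissipation of the
  high modes enters with the favourable sign.\<close>

lemma energy_transfer_lower_bound:
  assumes T: "0 < T"
  shows "- ((L2_norm \<Omega> u0)\<^sup>2 / 2) \<le> (LINT t|lebesgue_on {0..T}. e_m \<Omega> w m (u t) + E_m \<Omega> \<nu> w m (u t))"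
proof -
  let ?M = "lebesgue_on {0..T}"
  let ?r = "\<lambda>t. \<Sum>k<m. coef (u t) k * coef f k" and ?d = "\<lambda>t. \<Sum>k<m. coef (u t) k * grad_coef t k"
    and ?b = "\<lambda>t. \<Sum>k<m. coef (u t) k * conv_coef t k" and ?v = "\<lambda>t. (V_norm \<Omega> (u t))\<^sup>2"
  note int = LINT_coef_sum[OF T]
  have v: "integrable ?M ?v" using u_L2loc_V T by (simp add: L2loc_V_def)
  have q: "integrable ?M low_grad_sq"
    unfolding low_grad_sq_def[abs_def]
    by (intro continuous_imp_integrable_real continuous_on_sum continuous_on_mult coef_u_continuous_Icc continuous_on_const)
  have AE_V: "AE t in ?M. u t \<in> V_space \<Omega>"
    using u_L2loc_V by (intro AE_subinterval) (simp add: L2loc_V_def)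
  have AE_T: "AE t in ?M. t \<in> {0..T}" by (intro AE_I2) simp
  let ?e = "\<lambda>t. e_m \<Omega> w m (u t) + E_m \<Omega> \<nu> w m (u t)" and ?s = "\<lambda>t. ?b t - \<nu> * ?d t + \<nu> * low_grad_sq t"
  have eq: "AE t in ?M. ?s t = ?e t"
    using AE_V AE_T by eventually_elim (simp add: splitting_pointwise(1))
  have s_int: "integrable ?M ?s"
    by (intro Bochner_Integration.integrable_add Bochner_Integration.integrable_diff integrable_mult_right int q)
  have "?e \<in> borel_measurable ?M"
  proof (rule AE_limit_measurable)
    show "?s \<in> borel_measurable ?M" using s_int by (rule borel_measurable_integrable)
    show "AE t in ?M. (\<lambda>n. ?s t) \<longlonglongrightarrow> ?e t" using eq by eventually_elim simp
  qed simp
  then have e_eq: "(LINT t|?M. ?e t) = (LINT t|?M. ?s t)"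
    using eq s_int by (intro integral_cong_AE) (auto elim: eventually_mono)
  have "(LINT t|?M. ?b t + \<nu> * ?d t - \<nu> * ?v t) \<le> (LINT t|?M. ?s t)"
  proof (rule integral_mono_AE[OF _ s_int])
    show "integrable ?M (\<lambda>t. ?b t + \<nu> * ?d t - \<nu> * ?v t)"
      by (intro Bochner_Integration.integrable_add Bochner_Integration.integrable_diff integrable_mult_right int v)
    show "AE t in ?M. ?b t + \<nu> * ?d t - \<nu> * ?v t \<le> ?s t"
      using AE_V AE_T
    proof eventually_elim
      case (elim t)
      have "\<nu> * (2 * ?d t - ?v t) \<le> \<nu> * low_grad_sq t"
        using elim \<nu> by (intro mult_left_mono splitting_pointwise(2)) auto
      then show ?case by (simp add: algebra_simps)
    qed
  qed
  then have 1: "(LINT t|?M. ?b t) + \<nu> * (LINT t|?M. ?d t) - \<nu> * (LINT t|?M. ?v t) \<le> (LINT t|?M. ?e t)"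
    using int v by (simp add: e_eq)
  have force: "(LINT t|?M. L2_inner \<Omega> f (u t)) = (LINT t|?M. ?r t)"
    by (rule Bochner_Integration.integral_cong) (auto simp: force_u_inner)
  have 2: "(L2_norm \<Omega> (u T))\<^sup>2 / 2 + \<nu> * (LINT t|?M. ?v t) \<le> (L2_norm \<Omega> u0)\<^sup>2 / 2 + (LINT t|?M. ?r t)"
    unfolding force[symmetric] using sol T unfolding leray_hopf_solution_def by blast
  have 3: "(\<Sum>k<m. (coef (u T) k)\<^sup>2) \<le> (L2_norm \<Omega> (u T))\<^sup>2"
    using T by (intro Bessel H_L2 u_H) auto
  have 4: "0 \<le> (\<Sum>k<m. (coef (u 0) k)\<^sup>2)" by (simp add: sum_nonneg)
  define B where "B = (LINT t|?M. ?b t)"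
  define D where "D = \<nu> * (LINT t|?M. ?d t)"
  define R where "R = (LINT t|?M. ?r t)"
  define V where "V = \<nu> * (LINT t|?M. ?v t)"
  note low_mode_energy_identity[OF T, folded B_def D_def R_def]
  with 1[folded B_def D_def V_def] 2[folded R_def V_def] 3 4 show ?thesis by argo
qed

lemma high_mode_path:
  obtains C where "\<And>T. 0 < T \<Longrightarrow> weakly_continuous_path T C (\<lambda>t. Q_proj \<Omega> w m (u t))"
proof -
  obtain C where C: "AE t in lebesgue_on {0..}. L2_norm \<Omega> (u t) \<le> C"
    using sol by (auto simp: leray_hopf_solution_def Linf_H_def)
  have "weakly_continuous_path T C (\<lambda>t. Q_proj \<Omega> w m (u t))" if T: "0 < T" for T
    unfolding weakly_continuous_path_def
  proof (intro conjI ballI allI T)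
    show "Q_proj \<Omega> w m (u t) \<in> H_space \<Omega>" if "t \<in> {0..T}" for t
      using that by (intro Q_proj_H u_H) simp
    show "continuous_on {0..T} (\<lambda>t. coef (Q_proj \<Omega> w m (u t)) k)" for k
    proof (rule continuous_on_cong[THEN iffD1])
      show "continuous_on {0..T} (\<lambda>t. if k < m then 0 else coef (u t) k)"
        by (cases "k < m") (simp_all add: coef_u_continuous_Icc)
      show "(if k < m then 0 else coef (u t) k) = coef (Q_proj \<Omega> w m (u t)) k" if "t \<in> {0..T}" for t
        using that by (simp add: coef_Q_proj H_L2 u_H)
    qed simp
    have "AE t in lebesgue_on {0..T}. t \<in> {0..T}" by (intro AE_I2) simp
    then show "AE t in lebesgue_on {0..T}. L2_norm \<Omega> (Q_proj \<Omega> w m (u t)) \<le> C"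
      using AE_subinterval[OF C]
    proof eventually_elim
      case (elim t)
      then have "L2_norm \<Omega> (Q_proj \<Omega> w m (u t)) \<le> L2_norm \<Omega> (u t)"
        by (intro norm_Q_proj_le H_L2 u_H) simp
      with elim show ?case by linarith
    qed
  qed
  then show thesis using that by blast
qed

end

theorem theorem4p1:
  fixes \<Omega> :: "(real^3) set" and \<nu> :: real and f u0 :: "real^3 \<Rightarrow> real^3"
    and u :: "real \<Rightarrow> real^3 \<Rightarrow> real^3" and w :: "nat \<Rightarrow> real^3 \<Rightarrow> real^3" and m :: nat
  assumes "smooth_bounded_domain \<Omega>"
    and "\<nu> > 0"
    and "u0 \<in> H_space \<Omega>"
    and "f \<in> L2 \<Omega>"
    and "\<And>k. w k \<in> V_space \<Omega>"
    and "orthonormal_basis_H \<Omega> w"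
    and "m \<ge> 1"
    and "AE x in lebesgue_on \<Omega>. P_proj \<Omega> w m f x = f x"
    and "leray_hopf_solution \<Omega> \<nu> f u0 u"
  shows "\<exists>(t :: nat \<Rightarrow> real) zbar.
           (\<forall>n. t n > 0) \<and> filterlim t at_top sequentially \<and>
           zbar \<in> H_space \<Omega> \<and>
           weakly_converges_H \<Omega> (\<lambda>n. field_mean \<Omega> (t n) (\<lambda>s. Q_proj \<Omega> w m (u s))) zbar \<and>
           liminf (\<lambda>n. ereal (scalar_mean (t n) (\<lambda>s. e_m \<Omega> w m (u s) + E_m \<Omega> \<nu> w m (u s)))) \<ge> 0"
proof -
  interpret leray_hopf_splitting \<Omega> w \<nu> f u0 u m
    using assms by unfold_locales (auto simp: smooth_bounded_domain_def)
  obtain C where C: "\<And>T. 0 < T \<Longrightarrow> weakly_continuous_path T C (\<lambda>t. Q_proj \<Omega> w m (u t))"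
    using high_mode_path by blast
  \<comment> \<open>weak compactness selects times among the positive integers; the energy bound holds at all of them\<close>
  define v where "v n = field_mean \<Omega> (real (Suc n)) (\<lambda>s. Q_proj \<Omega> w m (u s))" for n
  have v: "v n \<in> H_space \<Omega>" "L2_norm \<Omega> (v n) \<le> C" for n
    unfolding v_def using field_mean_H[OF C] field_mean_norm_le[OF C] by simp_all
  obtain r :: "nat \<Rightarrow> nat" and a where r: "strict_mono r" and a: "a \<in> H_space \<Omega>"
    "weakly_converges_H \<Omega> (\<lambda>n. v (r n)) a"
    using weak_compactness[of v C] v by blast
  define t where "t n = real (Suc (r n))" for n
  have t: "0 < t n" for n by (simp add: t_def)
  have "filterlim (\<lambda>n. Suc (r n)) at_top sequentially"
    using filterlim_compose[OF filterlim_Suc filterlim_subseq[OF r]] .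
  then have t_top: "filterlim t at_top sequentially"
    unfolding t_def by (rule filterlim_compose[OF filterlim_real_sequentially])
  let ?e = "\<lambda>s. e_m \<Omega> w m (u s) + E_m \<Omega> \<nu> w m (u s)"
  have "(\<lambda>n. - ((L2_norm \<Omega> u0)\<^sup>2 / 2) / t n) \<longlonglongrightarrow> 0"
    by (rule tendsto_divide_0[OF tendsto_const filterlim_at_top_imp_at_infinity[OF t_top]])
  then have "(\<lambda>n. ereal (- ((L2_norm \<Omega> u0)\<^sup>2 / 2) / t n)) \<longlonglongrightarrow> ereal 0" by simp
  then have "liminf (\<lambda>n. ereal (- ((L2_norm \<Omega> u0)\<^sup>2 / 2) / t n)) = 0"
    using lim_imp_Liminf[OF trivial_limit_sequentially] zero_ereal_def by metis
  moreover have "- ((L2_norm \<Omega> u0)\<^sup>2 / 2) / t n \<le> scalar_mean (t n) ?e" for n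
    using divide_right_mono[OF energy_transfer_lower_bound[OF t[of n]], of "t n"] t[of n]
    by (simp add: scalar_mean_def)
  then have "liminf (\<lambda>n. ereal (- ((L2_norm \<Omega> u0)\<^sup>2 / 2) / t n)) \<le> liminf (\<lambda>n. ereal (scalar_mean (t n) ?e))"
    by (intro Liminf_mono always_eventually allI) simp
  ultimately have "0 \<le> liminf (\<lambda>n. ereal (scalar_mean (t n) ?e))" by simp
  moreover have "weakly_converges_H \<Omega> (\<lambda>n. field_mean \<Omega> (t n) (\<lambda>s. Q_proj \<Omega> w m (u s))) a"
    using a(2) by (simp add: v_def t_def)
  ultimately show ?thesis using t t_top a(1) by blast
qed

end
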